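(* Let $\mathcal G$ be a connected metric graph with finitely many edges which is either compact, or noncompact with non-empty compact core $\mathcal K$ (if $\mathcal G$ is compact, $\mathcal K=\mathcal G$). Let $p>2$, and let $A:\mathcal G\to\mathbb R$, $V:\mathcal G\to[1,+\infty)$ satisfy $A\in L^2_{\rm loc}(\mathcal G,\mathbb R)$, $V\in L^1_{\rm loc}(\mathcal G,\mathbb R)$. Assume that at least one of the following holds: (G) the infimum $\lambda_1=\inf_{u\in H^1_A(\mathcal G,\mathbb C)\setminus\{0\}}\|u\|^2/\|u\|_2^2$ is achieved by some $\varphi_1$ with $\varphi_1|_{\mathcal K}\not\equiv 0$; (G$_m$) there exist $m\ge 1$ (possibly $m=+\infty$) distinct eigenvalues of $D_A^2+V(x)$ below $\inf\sigma_{\rm ess}(D_A^2+V(x))$, i.e. $D_A^2+V(x)$ has an increasing sequence of $m$ eigenvalues $1\le\lambda_1<\lambda_2<\dots<\lambda_j<\dots$ with $\lambda_j<\inf\sigma_{\rm ess}(D_A^2+V(x))$ for every $j$. Then there exists $\mu_0>0$ such that, for any $0<\mu\le\mu_0$, $E(\cdot,\mathcal G)$ has a critical point $u\in H^1_A(\mathcal G,\mathbb C)$ constrained on $H_\mu(\mathcal G)$ with Lagrange multiplier $\lambda\in[0,\lambda_1]$ (and $\lambda\in[0,\lambda_1)$ if (G) holds). Moreover, if $2<p<6$, then for every $\mu>0$, $E(\cdot,\mathcal G)$ has a critical point $u\in H^1_A(\mathcal G,\mathbb C)$ constrained on $H_\mu(\mathcal G)$ with Lagrange multiplier $\lambda\in(-\infty,\lambda_1]$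 (and $\lambda\in(-\infty,\lambda_1)$ if (G) holds).
   Context: Metric graphs: each bounded edge $e$ of $\mathcal G=(\mathrm V,\mathrm E)$ is identified with $I_e=[0,\ell_e]$, $\ell_e>0$, each unbounded edge with $I_e=[0,+\infty)$. The compact core $\mathcal K$ is the metric subgraph consisting of all bounded edges. A function $u:\mathcal G\to\mathbb C$ is identified with the family $(u_e)_{e\in\mathrm E}$, $u_e:I_e\to\mathbb C$; $L^p(\mathcal G,\mathbb C)=\bigoplus_e L^p(I_e,\mathbb C)$ with norm $\|\cdot\|_p$. $A\in L^2_{\rm loc}$, $V\in L^1_{\rm loc}$ mean $A\in L^2(B)$, $V\in L^1(B)$ for every bounded $B\subset\mathcal G$. Magnetic Sobolev space: $D_A=\frac1i\frac{d}{dx}-A(x)$ (edgewise, weak derivative), $H^1_A(\mathcal G,\mathbb C)=\{u\in C(\mathcal G,\mathbb C): D_Au\in L^2(\mathcal G,\mathbb C),\ \int_{\mathcal G}V|u|^2dx<+\infty\}$, with $\|u\|^2=\int_{\mathcal G}(|D_Au|^2+V|u|^2)dx$ and real inner products $(u,v)=\operatorname{Re}\int_{\mathcal G}(D_Au\overline{D_Av}+Vu\bar v)dx$, $(u,v)_2=\operatorname{Re}\int_{\mathcal G}u\bar v\,dx$. Operator: $D_A^2+V(x)$ denotes the unique self-adjoint operator $T$ in the complex Hilbert space $L^2(\mathcal G,\mathbb C)$ with $\operatorname{dom}(T)\subset H^1_A(\mathcal G,\mathbb C)$ and $\int_{\mathcal G}(D_Au\overline{D_Av}+Vu\bar v)dx=\int_{\mathcal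 G}(Tu)\bar v\,dx$ for all $u\in\operatorname{dom}(T)$, $v\in H^1_A(\mathcal G,\mathbb C)$. $\sigma_{\rm ess}$ is its essential spectrum, with $\inf\emptyset=+\infty$. The symbol $\lambda_1$ always denotes $\inf_{u\neq0}\|u\|^2/\|u\|_2^2$ (under (G$_m$) it is the first eigenvalue). Energy: $E(u,\mathcal G)=\frac12\|u\|^2-\frac1p\int_{\mathcal K}|u|^pdx$ on $H^1_A(\mathcal G,\mathbb C)$ (with $\mathcal K=\mathcal G$ if $\mathcal G$ is compact). For $\mu>0$, $H_\mu(\mathcal G)=\{u\in H^1_A(\mathcal G,\mathbb C):\int_{\mathcal G}|u|^2dx=\mu\}$. $u\in H_\mu(\mathcal G)$ is a critical point of $E(\cdot,\mathcal G)$ constrained on $H_\mu(\mathcal G)$ with Lagrange multiplier $\lambda\in\mathbb R$ if $(u,v)-\operatorname{Re}\int_{\mathcal K}|u|^{p-2}u\bar v\,dx=\lambda(u,v)_2$ for all $v\in H^1_A(\mathcal G,\mathbb C)$. *)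

theory Defs
  imports "HOL-Analysis.Analysis"
begin

section \<open>Metric graphs\<close>

text \<open>
  Loops and multiple edges are allowed. A bounded edge \<open>e\<close> is \<open>[0, len e]\<close>, with \<open>0\<close> at the vertex
  \<open>src e\<close> and \<open>len e\<close> at \<open>tgt e\<close>. An unbounded edge (a ray) is \<open>[0, \<infinity>)\<close>, with \<open>0\<close> at \<open>src e\<close>;
  its \<open>len\<close> and \<open>tgt\<close> are never used, as the end at infinity is not a point of the graph.
\<close>

record ('v, 'e) metric_graph =
  verts :: "'v set"
  bedges :: "'e set"
  rays :: "'e set"
  len :: "'e \<Rightarrow> real"
  src :: "'e \<Rightarrow> 'v"
  tgt :: "'e \<Rightarrow> 'v"

definition edges :: "('v, 'e) metric_graph \<Rightarrow> 'e set" where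
  "edges G = bedges G \<union> rays G"

definition edge_interval :: "('v, 'e) metric_graph \<Rightarrow> 'e \<Rightarrow> real set" where
  "edge_interval G e = (if e \<in> bedges G then {0..len G e} else {0..})"

definition finite_metric_graph :: "('v, 'e) metric_graph \<Rightarrow> bool" where
  "finite_metric_graph G \<longleftrightarrow>
     finite (edges G) \<and> bedges G \<inter> rays G = {} \<and>
     (\<forall>e\<in>bedges G. 0 < len G e) \<and>
     (\<forall>e\<in>edges G. src G e \<in> verts G) \<and> (\<forall>e\<in>bedges G. tgt G e \<in> verts G)"

text \<open>Rays have a single endpoint, so they play no role in joining vertices.\<close>

definition connected_graph :: "('v, 'e) metric_graph \<Rightarrow> bool" where
  "connected_graph G \<longleftrightarrow>
     (\<forall>v\<in>verts G. \<forall>w\<in>verts G.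
        (v, w) \<in> ((\<lambda>e. (src G e, tgt G e)) ` bedges G \<union> (\<lambda>e. (tgt G e, src G e)) ` bedges G)\<^sup>*)"

definition compact_graph :: "('v, 'e) metric_graph \<Rightarrow> bool" where
  "compact_graph G \<longleftrightarrow> rays G = {}"

text \<open>
  A function on the graph is a family \<open>u e x\<close>; its values for \<open>e\<close> not an edge, or \<open>x\<close> outside the
  interval of \<open>e\<close>, are irrelevant. The set \<open>F\<close> of edges is \<open>edges G\<close> for an integral over the whole
  graph and \<open>bedges G\<close> for an integral over the compact core (the two agree for a compact graph).
\<close>

definition graph_integral ::
  "('v, 'e) metric_graph \<Rightarrow> 'e set \<Rightarrow> ('e \<Rightarrow> real \<Rightarrow> 'b) \<Rightarrow> 'b::{banach, second_countable_topology}" where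
  "graph_integral G F f = (\<Sum>e\<in>F. set_lebesgue_integral lebesgue (edge_interval G e) (f e))"

definition continuous_on_graph :: "('v, 'e) metric_graph \<Rightarrow> ('e \<Rightarrow> real \<Rightarrow> complex) \<Rightarrow> bool" where
  "continuous_on_graph G u \<longleftrightarrow>
     (\<forall>e\<in>edges G. continuous_on (edge_interval G e) (u e)) \<and>
     (\<exists>val. (\<forall>e\<in>edges G. u e 0 = val (src G e)) \<and> (\<forall>e\<in>bedges G. u e (len G e) = val (tgt G e)))"

definition nonzero_on :: "('v, 'e) metric_graph \<Rightarrow> 'e set \<Rightarrow> ('e \<Rightarrow> real \<Rightarrow> complex) \<Rightarrow> bool" where
  "nonzero_on G F u \<longleftrightarrow> (\<exists>e\<in>F. \<exists>x\<in>edge_interval G e. u e x \<noteq> 0)"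

definition square_integrable_on ::
  "real set \<Rightarrow> (real \<Rightarrow> 'b::{banach, second_countable_topology}) \<Rightarrow> bool" where
  "square_integrable_on S f \<longleftrightarrow>
     set_borel_measurable lebesgue S f \<and> set_integrable lebesgue S (\<lambda>x. (norm (f x))\<^sup>2)"

definition L2_loc :: "('v, 'e) metric_graph \<Rightarrow> ('e \<Rightarrow> real \<Rightarrow> real) \<Rightarrow> bool" where
  "L2_loc G A \<longleftrightarrow> (\<forall>e\<in>edges G. \<forall>B\<in>sets lebesgue. bounded B \<and> B \<subseteq> edge_interval G e \<longrightarrow>
     square_integrable_on B (A e))"

definition L1_loc :: "('v, 'e) metric_graph \<Rightarrow> ('e \<Rightarrow> real \<Rightarrow> real) \<Rightarrow> bool" where
  "L1_loc G V \<longleftrightarrow> (\<forall>e\<in>edges G. \<forall>B\<in>sets lebesgue. bounded B \<and> B \<subseteq> edge_interval G e \<longrightarrow>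
     set_integrable lebesgue B (V e))"


section \<open>The magnetic Sobolev space\<close>

definition test_function :: "real set \<Rightarrow> (real \<Rightarrow> real) \<Rightarrow> bool" where
  "test_function U \<phi> \<longleftrightarrow>
     (\<forall>n x. (deriv ^^ n) \<phi> differentiable (at x)) \<and>
     compact (closure {x. \<phi> x \<noteq> 0}) \<and> closure {x. \<phi> x \<noteq> 0} \<subseteq> U"

text \<open>The weak derivative is taken on the interior of the interval \<open>S\<close>.\<close>

definition has_weak_deriv :: "real set \<Rightarrow> (real \<Rightarrow> complex) \<Rightarrow> (real \<Rightarrow> complex) \<Rightarrow> bool" where
  "has_weak_deriv S u w \<longleftrightarrow>
     (\<forall>C. compact C \<and> C \<subseteq> interior S \<longrightarrow> set_integrable lebesgue C u \<and> set_integrable lebesgue C w) \<and>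
     (\<forall>\<phi>. test_function (interior S) \<phi> \<longrightarrow>
        set_lebesgue_integral lebesgue S (\<lambda>x. deriv \<phi> x *\<^sub>R u x) =
        - set_lebesgue_integral lebesgue S (\<lambda>x. \<phi> x *\<^sub>R w x))"

text \<open>
  A weak derivative is unique only up to null sets; \<open>weak_deriv\<close> picks a representative, and is
  used only under integrals.
\<close>

definition weak_deriv :: "real set \<Rightarrow> (real \<Rightarrow> complex) \<Rightarrow> real \<Rightarrow> complex" where
  "weak_deriv S u = (SOME w. has_weak_deriv S u w)"

definition D_mag ::
  "('v, 'e) metric_graph \<Rightarrow> ('e \<Rightarrow> real \<Rightarrow> real) \<Rightarrow> ('e \<Rightarrow> real \<Rightarrow> complex) \<Rightarrow> 'e \<Rightarrow> real \<Rightarrow> complex" where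
  "D_mag G A u = (\<lambda>e x. (1 / \<i>) * weak_deriv (edge_interval G e) (u e) x
                        - complex_of_real (A e x) * u e x)"

definition H1_mag ::
  "('v, 'e) metric_graph \<Rightarrow> ('e \<Rightarrow> real \<Rightarrow> real) \<Rightarrow> ('e \<Rightarrow> real \<Rightarrow> real) \<Rightarrow> ('e \<Rightarrow> real \<Rightarrow> complex) set" where
  "H1_mag G A V = {u. continuous_on_graph G u \<and>
     (\<forall>e\<in>edges G.
        (\<exists>w. has_weak_deriv (edge_interval G e) (u e) w) \<and>
        square_integrable_on (edge_interval G e) (D_mag G A u e) \<and>
        set_integrable lebesgue (edge_interval G e) (\<lambda>x. V e x * (norm (u e x))\<^sup>2))}"

definition form_mag ::
  "('v, 'e) metric_graph \<Rightarrow> ('e \<Rightarrow> real \<Rightarrow> real) \<Rightarrow> ('e \<Rightarrow> real \<Rightarrow> real) \<Rightarrow>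
   ('e \<Rightarrow> real \<Rightarrow> complex) \<Rightarrow> ('e \<Rightarrow> real \<Rightarrow> complex) \<Rightarrow> complex" where
  "form_mag G A V u v = graph_integral G (edges G)
     (\<lambda>e x. D_mag G A u e x * cnj (D_mag G A v e x) + complex_of_real (V e x) * u e x * cnj (v e x))"

definition energy_normsq ::
  "('v, 'e) metric_graph \<Rightarrow> ('e \<Rightarrow> real \<Rightarrow> real) \<Rightarrow> ('e \<Rightarrow> real \<Rightarrow> real) \<Rightarrow> ('e \<Rightarrow> real \<Rightarrow> complex) \<Rightarrow> real" where
  "energy_normsq G A V u = graph_integral G (edges G)
     (\<lambda>e x. (norm (D_mag G A u e x))\<^sup>2 + V e x * (norm (u e x))\<^sup>2)"


section \<open>The operator \<open>D_A\<^sup>2 + V\<close> and its spectrum\<close>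

text \<open>
  Elements of \<open>L\<^sup>2\<close> are represented by functions, identified by \<open>ae_eq\<close>. An operator is
  represented by its graph \<open>T\<close>, a set of pairs of representatives.
\<close>

definition L2_space :: "('v, 'e) metric_graph \<Rightarrow> ('e \<Rightarrow> real \<Rightarrow> complex) set" where
  "L2_space G = {f. \<forall>e\<in>edges G. square_integrable_on (edge_interval G e) (f e)}"

definition ae_eq ::
  "('v, 'e) metric_graph \<Rightarrow> ('e \<Rightarrow> real \<Rightarrow> complex) \<Rightarrow> ('e \<Rightarrow> real \<Rightarrow> complex) \<Rightarrow> bool" where
  "ae_eq G f g \<longleftrightarrow> (\<forall>e\<in>edges G. AE x in lebesgue. x \<in> edge_interval G e \<longrightarrow> f e x = g e x)"

definition L2_inner ::
  "('v, 'e) metric_graph \<Rightarrow> ('e \<Rightarrow> real \<Rightarrow> complex) \<Rightarrow> ('e \<Rightarrow> real \<Rightarrow> complex) \<Rightarrow> complex" where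
  "L2_inner G f g = graph_integral G (edges G) (\<lambda>e x. f e x * cnj (g e x))"

definition L2_normsq :: "('v, 'e) metric_graph \<Rightarrow> ('e \<Rightarrow> real \<Rightarrow> complex) \<Rightarrow> real" where
  "L2_normsq G f = graph_integral G (edges G) (\<lambda>e x. (norm (f e x))\<^sup>2)"

type_synonym 'e graph_op = "(('e \<Rightarrow> real \<Rightarrow> complex) \<times> ('e \<Rightarrow> real \<Rightarrow> complex)) set"

definition densely_defined :: "('v, 'e) metric_graph \<Rightarrow> 'e graph_op \<Rightarrow> bool" where
  "densely_defined G T \<longleftrightarrow>
     (\<forall>g\<in>L2_space G. \<forall>\<epsilon>>0. \<exists>(u, f)\<in>T. sqrt (L2_normsq G (\<lambda>e x. g e x - u e x)) < \<epsilon>)"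

definition adjoint_op :: "('v, 'e) metric_graph \<Rightarrow> 'e graph_op \<Rightarrow> 'e graph_op" where
  "adjoint_op G T = {(v, g). v \<in> L2_space G \<and> g \<in> L2_space G \<and>
     (\<forall>(u, f)\<in>T. L2_inner G f v = L2_inner G u g)}"

text \<open>
  Linearity, compatibility with \<open>ae_eq\<close> and (by density) single-valuedness up to \<open>ae_eq\<close> hold
  for every adjoint, hence need not be required separately.
\<close>

definition self_adjoint :: "('v, 'e) metric_graph \<Rightarrow> 'e graph_op \<Rightarrow> bool" where
  "self_adjoint G T \<longleftrightarrow>
     T \<subseteq> L2_space G \<times> L2_space G \<and> densely_defined G T \<and> adjoint_op G T = T"

definition is_magnetic_op ::
  "('v, 'e) metric_graph \<Rightarrow> ('e \<Rightarrow> real \<Rightarrow> real) \<Rightarrow> ('e \<Rightarrow> real \<Rightarrow> real) \<Rightarrow> 'e graph_op \<Rightarrow> bool" where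
  "is_magnetic_op G A V T \<longleftrightarrow> self_adjoint G T \<and>
     (\<forall>(u, f)\<in>T. \<exists>u'\<in>H1_mag G A V. ae_eq G u u') \<and>
     (\<forall>(u, f)\<in>T. u \<in> H1_mag G A V \<longrightarrow> (\<forall>v\<in>H1_mag G A V. form_mag G A V u v = L2_inner G f v))"

definition magnetic_op ::
  "('v, 'e) metric_graph \<Rightarrow> ('e \<Rightarrow> real \<Rightarrow> real) \<Rightarrow> ('e \<Rightarrow> real \<Rightarrow> real) \<Rightarrow> 'e graph_op" where
  "magnetic_op G A V = (THE T. is_magnetic_op G A V T)"

text \<open>
  The estimate expresses both injectivity of \<open>T - z\<close> (up to \<open>ae_eq\<close>) and boundedness of its inverse.
\<close>

definition resolvent_set :: "('v, 'e) metric_graph \<Rightarrow> 'e graph_op \<Rightarrow> complex set" where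
  "resolvent_set G T = {z.
     (\<forall>g\<in>L2_space G. \<exists>(u, f)\<in>T. ae_eq G (\<lambda>e x. f e x - z * u e x) g) \<and>
     (\<exists>C. \<forall>(u, f)\<in>T. sqrt (L2_normsq G u) \<le> C * sqrt (L2_normsq G (\<lambda>e x. f e x - z * u e x)))}"

definition op_spectrum :: "('v, 'e) metric_graph \<Rightarrow> 'e graph_op \<Rightarrow> complex set" where
  "op_spectrum G T = - resolvent_set G T"

definition op_eigenspace :: "'e graph_op \<Rightarrow> complex \<Rightarrow> ('e \<Rightarrow> real \<Rightarrow> complex) set" where
  "op_eigenspace T z = {u. (u, \<lambda>e x. z * u e x) \<in> T}"

definition op_eigenvalue :: "('v, 'e) metric_graph \<Rightarrow> 'e graph_op \<Rightarrow> complex \<Rightarrow> bool" where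
  "op_eigenvalue G T z \<longleftrightarrow> (\<exists>u\<in>op_eigenspace T z. \<not> ae_eq G u (\<lambda>e x. 0))"

definition finite_multiplicity :: "('v, 'e) metric_graph \<Rightarrow> 'e graph_op \<Rightarrow> complex \<Rightarrow> bool" where
  "finite_multiplicity G T z \<longleftrightarrow>
     (\<exists>B. finite B \<and> B \<subseteq> op_eigenspace T z \<and>
       (\<forall>u\<in>op_eigenspace T z. \<exists>c. ae_eq G u (\<lambda>e x. \<Sum>b\<in>B. c b * b e x)))"

text \<open>
  For self-adjoint operators, to which it is applied here, this agrees with the other usual
  definitions (Weyl sequences, Fredholmness).
\<close>

definition ess_spectrum :: "('v, 'e) metric_graph \<Rightarrow> 'e graph_op \<Rightarrow> complex set" where
  "ess_spectrum G T = op_spectrum G T -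
     {z. z isolated_in op_spectrum G T \<and> op_eigenvalue G T z \<and> finite_multiplicity G T z}"

text \<open>
  Extended reals give the convention \<open>inf \<emptyset> = \<infinity>\<close>. The spectrum of a self-adjoint operator is
  real, so restricting to real points loses nothing.
\<close>

definition inf_ess_spectrum :: "('v, 'e) metric_graph \<Rightarrow> 'e graph_op \<Rightarrow> ereal" where
  "inf_ess_spectrum G T = Inf (ereal ` {x. complex_of_real x \<in> ess_spectrum G T})"


section \<open>The variational problem\<close>

definition lambda1 ::
  "('v, 'e) metric_graph \<Rightarrow> ('e \<Rightarrow> real \<Rightarrow> real) \<Rightarrow> ('e \<Rightarrow> real \<Rightarrow> real) \<Rightarrow> real" where
  "lambda1 G A V =
     Inf {energy_normsq G A V u / L2_normsq G u | u. u \<in> H1_mag G A V \<and> nonzero_on G (edges G) u}"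

definition cond_G ::
  "('v, 'e) metric_graph \<Rightarrow> ('e \<Rightarrow> real \<Rightarrow> real) \<Rightarrow> ('e \<Rightarrow> real \<Rightarrow> real) \<Rightarrow> bool" where
  "cond_G G A V \<longleftrightarrow> (\<exists>\<phi>\<in>H1_mag G A V. nonzero_on G (edges G) \<phi> \<and>
     energy_normsq G A V \<phi> / L2_normsq G \<phi> = lambda1 G A V \<and> nonzero_on G (bedges G) \<phi>)"

text \<open>The sequence \<open>\<Lambda>\<close> is indexed from \<open>1\<close>; \<open>m = \<infinity>\<close> is allowed.\<close>

definition cond_Gm ::
  "('v, 'e) metric_graph \<Rightarrow> ('e \<Rightarrow> real \<Rightarrow> real) \<Rightarrow> ('e \<Rightarrow> real \<Rightarrow> real) \<Rightarrow> bool" where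
  "cond_Gm G A V \<longleftrightarrow> (\<exists>m::enat. 1 \<le> m \<and> (\<exists>\<Lambda> :: nat \<Rightarrow> real.
     1 \<le> \<Lambda> 1 \<and>
     (\<forall>i j. 1 \<le> i \<and> i < j \<and> enat j \<le> m \<longrightarrow> \<Lambda> i < \<Lambda> j) \<and>
     (\<forall>j. 1 \<le> j \<and> enat j \<le> m \<longrightarrow>
        op_eigenvalue G (magnetic_op G A V) (complex_of_real (\<Lambda> j)) \<and>
        ereal (\<Lambda> j) < inf_ess_spectrum G (magnetic_op G A V))))"

definition mass_sphere ::
  "('v, 'e) metric_graph \<Rightarrow> ('e \<Rightarrow> real \<Rightarrow> real) \<Rightarrow> ('e \<Rightarrow> real \<Rightarrow> real) \<Rightarrow> real \<Rightarrow>
   ('e \<Rightarrow> real \<Rightarrow> complex) set" where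
  "mass_sphere G A V \<mu> = {u \<in> H1_mag G A V. L2_normsq G u = \<mu>}"

text \<open>
  The equation below says \<open>E'(u) v = \<lambda> Re (\<integral> u cnj v)\<close> for the energy
  \<open>E(u) = 1/2 energy_normsq u - 1/p \<integral> |u|\<^sup>p\<close>, the last integral being over the compact core.
\<close>

definition constrained_critical_point ::
  "('v, 'e) metric_graph \<Rightarrow> ('e \<Rightarrow> real \<Rightarrow> real) \<Rightarrow> ('e \<Rightarrow> real \<Rightarrow> real) \<Rightarrow> real \<Rightarrow> real \<Rightarrow>
   ('e \<Rightarrow> real \<Rightarrow> complex) \<Rightarrow> real \<Rightarrow> bool" where
  "constrained_critical_point G A V p \<mu> u lam \<longleftrightarrow> u \<in> mass_sphere G A V \<mu> \<and>
     (\<forall>v\<in>H1_mag G A V.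
        Re (form_mag G A V u v)
        - Re (graph_integral G (bedges G)
               (\<lambda>e x. complex_of_real (norm (u e x) powr (p - 2)) * u e x * cnj (v e x)))
        = lam * Re (L2_inner G u v))"

end

theory Submission
  imports Defs "HOL-Complex_Analysis.Great_Picard"
begin

text \<open>
  Write \<open>K\<close> for the compact core, \<open>Q(u)\<close> for the energy \<open>energy_normsq G A V u\<close> and \<open>|u|\<^sub>2\<close> for the
  norm of \<open>L\<^sup>2\<close> of the graph.

  \<^bold>\<open>The ground state sees the core.\<close> Assume that \<open>\<lambda>\<^sub>1\<close> is attained by some \<open>\<phi>\<^sub>1\<close> that does not vanish on
  \<open>K\<close>. The nonlinearity \<open>|u|^(p-2) u\<close> is first saturated: \<open>|u|^(p-2)\<close> is replaced by \<open>h(|u|\<^sup>2)\<close> with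
  \<open>h(s) = min(s, k\<^sup>2)^((p-2)/2)\<close>, and \<open>|u|^p / p\<close> by \<open>\<Gamma>(|u|\<^sup>2)\<close> with \<open>\<Gamma>' = h/2\<close>. The functional
  \<open>J(u) = Q(u)/2 - \<integral>\<^sub>K \<Gamma>(|u|\<^sup>2)\<close> is bounded below on the sphere \<open>|u|\<^sub>2\<^sup>2 = \<mu>\<close>, and testing with a
  multiple of \<open>\<phi>\<^sub>1\<close> shows that its infimum \<open>m\<close> is strictly below \<open>\<lambda>\<^sub>1 \<mu> / 2\<close>. This gap makes up for the lack of
  compactness on the rays. By the Arzela-Ascoli theorem a minimizing sequence may be
  taken uniformly Cauchy on \<open>K\<close>. If \<open>a\<close>, \<open>b\<close> are two of its members that are close on \<open>K\<close>, the
  parallelogram law shows that \<open>J((a+b)/2) + Q((a-b)/2)/2\<close> is at most slightly above \<open>m\<close>. On the other hand,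
  \<open>\<Gamma>(ts) \<ge> t \<Gamma>(s)\<close> for \<open>t \<ge> 1\<close> gives \<open>J(w) \<ge> m |w|\<^sub>2\<^sup>2 / \<mu>\<close> inside the sphere, and
  \<open>Q((a-b)/2) \<ge> \<lambda>\<^sub>1 |(a-b)/2|\<^sub>2\<^sup>2\<close>, where \<open>\<lambda>\<^sub>1/2 > m/\<mu>\<close>. Both together make \<open>Q(a-b)\<close> small
  (\<open>almost_minimizers_close\<close>), so the sequence converges in norm.

  \<open>\<Gamma>\<close> is convex, hence lies above its tangents. A minimizer \<open>u\<close> therefore also minimizes the
  \<^emph>\<open>quadratic\<close> form \<open>Q(w) - \<integral>\<^sub>K h(|u|\<^sup>2) |w|\<^sup>2\<close> on the sphere, and the Euler-Lagrange equation becomes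
  the algebra of a nonnegative quadratic polynomial that vanishes at \<open>0\<close>
  (\<open>critical_point_exists\<close>). The gap gives \<open>\<lambda> < \<lambda>\<^sub>1\<close>, and \<open>h \<le> k^(p-2)\<close> gives
  \<open>\<lambda> \<ge> \<lambda>\<^sub>1 - k^(p-2)\<close>. Finally \<open>|u(x)|^4 \<le> C |u|\<^sub>2\<^sup>2 Q(u)\<close> on \<open>K\<close> (\<open>core_sup_bound\<close>), and
  \<open>Q(u) \<le> (\<lambda>\<^sub>1 + k^(p-2)) \<mu>\<close>. Hence \<open>|u| \<le> k\<close> on \<open>K\<close>, and \<open>u\<close> solves the original equation, as soon as
  \<open>C \<mu>\<^sup>2 (\<lambda>\<^sub>1 + k^(p-2)) \<le> k^4\<close>. For \<open>k = 1\<close> this holds when \<open>\<mu>\<close> is small, and \<open>\<lambda> \<ge> \<lambda>\<^sub>1 - 1 \<ge> 0\<close>; for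
  \<open>p < 6\<close> and any \<open>\<mu>\<close> it holds when \<open>k\<close> is large.

  \<^bold>\<open>Every ground state vanishes on the core.\<close> Assume now an eigenvalue below the essential spectrum,
  while no ground state is nonzero on \<open>K\<close>. If \<open>\<lambda>\<^sub>1\<close> is attained at all, a ground state of mass \<open>\<mu>\<close> has no
  nonlinear term and is itself a critical point with \<open>\<lambda> = \<lambda>\<^sub>1\<close>. To see that \<open>\<lambda>\<^sub>1\<close> is attained, the
  operator is identified: the operator of the form is self-adjoint, and every operator with the
  required properties equals it (\<open>magnetic_op_eq\<close>). Its spectrum contains \<open>\<lambda>\<^sub>1\<close>, since a
  bounded inverse of \<open>T - \<lambda>\<^sub>1\<close> would push the infimum of the form strictly above \<open>\<lambda>\<^sub>1\<close>
  (\<open>lambda1_in_spectrum\<close>). As \<open>\<lambda>\<^sub>1\<close> is at most the given eigenvalue, it lies below the essential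
  spectrum, so it is an eigenvalue.

  The analytic basis is built from smooth plateau functions: inserted into the definition of a weak
  derivative \<open>w\<close> of \<open>u\<close>, they give \<open>u(y) - u(x) = \<integral>\<^sub>x\<^sup>y w\<close>. The pointwise estimates, the compactness
  on the core and, together with the Riesz-Fischer theorem, the completeness of the magnetic Sobolev
  space (\<open>H1_complete\<close>) rest on this formula.
\<close>

section \<open>Smooth cut-off functions\<close>

text \<open>
  Smoothness by coinduction: instead of computing iterated derivatives, it is enough to exhibit a family
  of functions that is closed under differentiation.
\<close>

lemma smooth_if_closed_under_deriv:
  fixes f :: "real \<Rightarrow> real"
  assumes "f \<in> S"
    and closed: "\<And>g. g \<in> S \<Longrightarrow> \<exists>g'\<in>S. \<forall>x. (g has_real_derivative g' x) (at x)"
  shows "(deriv ^^ n) f differentiable (at x)"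
proof -
  have der: "g differentiable (at x) \<and> deriv g \<in> S" if gS: "g \<in> S" for g :: "real \<Rightarrow> real" and x :: real
  proof -
    obtain g' where g': "g' \<in> S" "\<And>x. (g has_real_derivative g' x) (at x)"
      using closed[OF gS] by blast
    have "deriv g = g'"
      using g'(2) by (auto intro: DERIV_imp_deriv)
    then show ?thesis
      using g' real_differentiable_def by blast
  qed
  have "(deriv ^^ n) f \<in> S"
    by (induction n) (use assms(1) der in auto)
  then show ?thesis
    using der by blast
qed

lemma smooth_deriv:
  fixes f :: "real \<Rightarrow> real"
  assumes "\<And>n x. (deriv ^^ n) f differentiable (at x)"
  shows "((deriv ^^ n) f has_real_derivative (deriv ^^ Suc n) f x) (at x)"
  using assms[of n x] by (simp add: DERIV_deriv_iff_real_differentiable)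

text \<open>
  With \<open>y = x (1 - x)\<close>, the functions \<open>q(x) / y^m exp(-1/y)\<close>, extended by zero outside \<open>(0,1)\<close>. The
  standard bump \<open>exp(-1/y)\<close> is among them, and by the quotient rule so are all its derivatives.
\<close>

definition bump_deriv :: "nat \<Rightarrow> real poly \<Rightarrow> real \<Rightarrow> real" where
  "bump_deriv m q x = (if 0 < x \<and> x < 1
     then poly q x / (x * (1 - x)) ^ m * exp (- 1 / (x * (1 - x))) else 0)"

definition bump :: "real \<Rightarrow> real" where
  "bump = bump_deriv 0 1"

lemma exp_neg_inverse_le:
  fixes y :: real
  assumes "0 < y"
  shows "exp (- 1 / y) \<le> fact k * y ^ k"
proof -
  have "(1 / y) ^ k / fact k \<le> exp (1 / y)"
  proof -
    have "(\<Sum>n\<in>{k}. inverse (fact n) * (1 / y) ^ n) \<le> (\<Sum>n. inverse (fact n) * (1 / y) ^ n)"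
      by (rule sum_le_suminf) (use assms summable_exp[of "1/y"] in \<open>auto\<close>)
    then show ?thesis
      by (simp add: exp_def divide_inverse mult.commute scaleR_conv_of_real)
  qed
  then have "inverse (exp (1 / y)) \<le> inverse ((1 / y) ^ k / fact k)"
    using assms by (intro le_imp_inverse_le) auto
  then show ?thesis
    using assms by (simp add: exp_minus divide_simps power_divide) (simp add: field_simps)
qed

text \<open>
  \<open>exp(-1/y)\<close> beats every power of \<open>1/y\<close>, so these functions vanish to second order at both ends of
  \<open>[0,1]\<close>. This is what makes them differentiable there.
\<close>

lemma bump_deriv_bound:
  obtains C where "0 \<le> C" "\<And>x. \<bar>bump_deriv m q x\<bar> \<le> C * x\<^sup>2" "\<And>x. \<bar>bump_deriv m q x\<bar> \<le> C * (x - 1)\<^sup>2"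
proof -
  have "compact (poly q ` {0..1})"
    by (intro compact_continuous_image continuous_intros) auto
  then have "bounded (poly q ` {0..1})"
    by (rule compact_imp_bounded)
  then obtain B where B: "0 < B" "\<And>x. x \<in> {0..1} \<Longrightarrow> \<bar>poly q x\<bar> \<le> B"
    unfolding bounded_pos by (metis image_eqI real_norm_def)
  define C where "C = B * fact (m + 2)"
  have main: "\<bar>bump_deriv m q x\<bar> \<le> C * (x * (1 - x))\<^sup>2" if x: "0 < x" "x < 1" for x
  proof -
    have y: "0 < x * (1 - x)"
      using x by simp
    have "\<bar>bump_deriv m q x\<bar> = \<bar>poly q x\<bar> / (x * (1 - x)) ^ m * exp (- 1 / (x * (1 - x)))"
      using x y by (simp add: bump_deriv_def abs_mult del: mult_pos_pos)
    also have "\<dots> \<le> B / (x * (1 - x)) ^ m * (fact (m + 2) * (x * (1 - x)) ^ (m + 2))"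
      using B x y by (intro mult_mono divide_right_mono exp_neg_inverse_le) auto
    also have "\<dots> = C * (x * (1 - x))\<^sup>2"
      using y x by (simp add: C_def power_add power2_eq_square)
    finally show ?thesis .
  qed
  have "0 \<le> C"
    using B by (simp add: C_def)
  show ?thesis
  proof (rule that[OF \<open>0 \<le> C\<close>])
    fix x :: real
    show "\<bar>bump_deriv m q x\<bar> \<le> C * x\<^sup>2"
    proof (cases "0 < x \<and> x < 1")
      case True
      have "(x * (1 - x))\<^sup>2 \<le> x\<^sup>2"
        using True by (intro power_mono) (auto simp: mult_le_cancel_left1)
      with main True \<open>0 \<le> C\<close> show ?thesis
        by (meson mult_left_mono order_trans)
    next
      case False
      then show ?thesis
        using \<open>0 \<le> C\<close> by (auto simp: bump_deriv_def)
    qed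
    show "\<bar>bump_deriv m q x\<bar> \<le> C * (x - 1)\<^sup>2"
    proof (cases "0 < x \<and> x < 1")
      case True
      have "(x * (1 - x))\<^sup>2 \<le> (1 - x)\<^sup>2"
        using True by (intro power_mono) (auto simp: mult_le_cancel_right1)
      with main True \<open>0 \<le> C\<close> show ?thesis
        by (metis mult_left_mono order_trans power2_commute)
    next
      case False
      then show ?thesis
        using \<open>0 \<le> C\<close> by (auto simp: bump_deriv_def)
    qed
  qed
qed

lemma has_derivative_zero_if_quadratic_bound:
  fixes f :: "real \<Rightarrow> real"
  assumes "\<And>x. \<bar>f x\<bar> \<le> C * (x - a)\<^sup>2"
  shows "(f has_real_derivative 0) (at a)"
proof -
  have "f a = 0"
    using assms[of a] by simp
  have "((\<lambda>x. (f x - f a) / (x - a)) \<longlongrightarrow> 0) (at a)"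
  proof (rule Lim_null_comparison)
    show "\<forall>\<^sub>F x in at a. norm ((f x - f a) / (x - a)) \<le> C * \<bar>x - a\<bar>"
    proof (rule eventually_mono[OF eventually_neq_at_within[of a]])
      fix x :: real assume "x \<noteq> a"
      then show "norm ((f x - f a) / (x - a)) \<le> C * \<bar>x - a\<bar>"
        using assms[of x] \<open>f a = 0\<close>
        by (auto simp: divide_simps power2_eq_square abs_mult mult.assoc split: if_splits)
    qed
    show "((\<lambda>x. C * \<bar>x - a\<bar>) \<longlongrightarrow> 0) (at a)"
      by (auto intro!: tendsto_eq_intros)
  qed
  then show ?thesis
    by (simp add: has_field_derivative_iff)
qed

lemma bump_deriv_has_derivative:
  "\<exists>m' q'. \<forall>x. (bump_deriv m q has_real_derivative bump_deriv m' q' x) (at x)"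
proof -
  let ?y = "[:0, 1, -1:] :: real poly"
  let ?y' = "[:1, -2:] :: real poly"
  \<comment> \<open>The numerator of the derivative over the common denominator \<open>y^(m+2) exp(1/y)\<close>.\<close>
  define q' where "q' = pderiv q * ?y\<^sup>2 - smult (of_nat m) (q * ?y' * ?y) + q * ?y'"
  have py: "poly ?y x = x * (1 - x)" "poly ?y' x = 1 - 2 * x" for x
    by (auto simp: algebra_simps)
  have "(bump_deriv m q has_real_derivative bump_deriv (m + 2) q' x) (at x)" for x
  proof -
    obtain C where C: "\<And>x. \<bar>bump_deriv m q x\<bar> \<le> C * x\<^sup>2" "\<And>x. \<bar>bump_deriv m q x\<bar> \<le> C * (x - 1)\<^sup>2"
      using bump_deriv_bound by blast
    consider "x = 0" | "x = 1" | "x < 0 \<or> x > 1" | "0 < x" "x < 1"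
      by linarith
    then show ?thesis
    proof cases
      case 1
      then show ?thesis
        using has_derivative_zero_if_quadratic_bound[of "bump_deriv m q" C 0] C
        by (simp add: bump_deriv_def)
    next
      case 2
      then show ?thesis
        using has_derivative_zero_if_quadratic_bound[of "bump_deriv m q" C 1] C
        by (simp add: bump_deriv_def)
    next
      case 3
      have "((\<lambda>_. 0) has_real_derivative 0) (at x)"
        by simp
      then have "(bump_deriv m q has_real_derivative 0) (at x)"
        by (rule has_field_derivative_transform_within_open[where S="{..<0} \<union> {1<..}"])
           (use 3 in \<open>auto simp: bump_deriv_def\<close>)
      then show ?thesis
        using 3 by (auto simp: bump_deriv_def)
    next
      case 4
      define y where "y = x * (1 - x)"
      have y: "0 < y"
        using 4 by (simp add: y_def)
      have dy: "((\<lambda>x. x * (1 - x)) has_real_derivative 1 - 2 * x) (at x)"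
        by (auto intro!: derivative_eq_intros)
      have "((\<lambda>x. poly q x / (x * (1 - x)) ^ m * exp (- 1 / (x * (1 - x)))) has_real_derivative
         (poly (pderiv q) x * y ^ m - poly q x * (of_nat m * (1 - 2 * x) * y ^ (m - 1))) / (y ^ m * y ^ m)
           * exp (- 1 / y) + poly q x / y ^ m * (exp (- 1 / y) * ((1 - 2 * x) / y ^ 2))) (at x)"
      proof -
        have dpow: "((\<lambda>x. (x * (1 - x)) ^ m) has_real_derivative of_nat m * (1 - 2 * x) * y ^ (m - 1)) (at x)"
          using DERIV_power[OF dy, of m] by (simp add: y_def ac_simps)
        have "((\<lambda>x. - 1 / (x * (1 - x))) has_real_derivative (1 - 2 * x) / y ^ 2) (at x)"
          using DERIV_divide[OF DERIV_const[of "- 1"] dy] y 4 by (simp add: y_def power2_eq_square)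
        then have dexp: "((\<lambda>x. exp (- 1 / (x * (1 - x)))) has_real_derivative
            exp (- 1 / y) * ((1 - 2 * x) / y ^ 2)) (at x)"
          unfolding y_def by (rule DERIV_fun_exp)
        show ?thesis
          using DERIV_mult[OF DERIV_divide[OF poly_DERIV[of q] dpow] dexp] y 4
          by (simp add: y_def mult.commute add.commute)
      qed
      also have "(poly (pderiv q) x * y ^ m - poly q x * (of_nat m * (1 - 2 * x) * y ^ (m - 1))) / (y ^ m * y ^ m)
           * exp (- 1 / y) + poly q x / y ^ m * (exp (- 1 / y) * ((1 - 2 * x) / y ^ 2))
         = bump_deriv (m + 2) q' x"
      proof -
        have "of_nat m * y ^ (m - 1) = of_nat m * y ^ m / y"
          using y by (cases m) auto
        then have "of_nat m * (1 - 2 * x) * y ^ (m - 1) = of_nat m * (1 - 2 * x) * y ^ m / y"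
          by (metis (no_types, lifting) mult.assoc mult.commute times_divide_eq_right)
        moreover have "poly q' x = poly (pderiv q) x * y\<^sup>2 - of_nat m * (poly q x * (1 - 2 * x) * y) + poly q x * (1 - 2 * x)"
          unfolding q'_def poly_add poly_diff poly_mult poly_smult poly_power py y_def by simp
        moreover have "(P' * Y - P * (M * D * Y / y)) / (Y * Y) * E + P / Y * (E * (D / y\<^sup>2))
            = (P' * y\<^sup>2 - M * (P * D * y) + P * D) / (Y * y\<^sup>2) * E" if "0 < Y" for P P' Y M D E :: real
          using that y by (simp add: field_simps power2_eq_square)
        moreover have "bump_deriv (m + 2) q' x = poly q' x / (y ^ m * y\<^sup>2) * exp (- 1 / y)"
          using 4 by (simp add: bump_deriv_def y_def power_add power2_eq_square)
        ultimately show ?thesis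
          using y by simp
      qed
      finally show ?thesis
        by (rule has_field_derivative_transform_within_open[where S="{0<..<1}"])
           (use 4 in \<open>auto simp: bump_deriv_def\<close>)
    qed
  qed
  then show ?thesis
    by blast
qed

lemma bump_deriv_continuous: "continuous_on UNIV (bump_deriv m q)"
proof -
  have "isCont (bump_deriv m q) x" for x
    using bump_deriv_has_derivative[of m q] DERIV_isCont by blast
  then show ?thesis
    by (simp add: continuous_at_imp_continuous_on)
qed

lemma bump_nonneg: "0 \<le> bump x"
  by (simp add: bump_def bump_deriv_def)

lemma bump_eq_0: "x \<le> 0 \<or> 1 \<le> x \<Longrightarrow> bump x = 0"
  by (auto simp: bump_def bump_deriv_def)

lemma bump_cont: "continuous_on X bump"
  unfolding bump_def using bump_deriv_continuous continuous_on_subset by blast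

definition bump_mass :: real where
  "bump_mass = integral {0..1} bump"

lemma bump_mass_pos: "0 < bump_mass"
proof -
  have "bump_mass \<noteq> 0"
  proof
    assume "bump_mass = 0"
    then have "bump (1/2) = 0"
      using integral_eq_0_iff[of 0 1 bump] bump_cont bump_nonneg
      by (auto simp: bump_mass_def)
    then show False
      by (simp add: bump_def bump_deriv_def)
  qed
  moreover have "0 \<le> bump_mass"
    unfolding bump_mass_def by (intro integral_nonneg integrable_continuous_interval bump_cont bump_nonneg)
  ultimately show ?thesis
    by simp
qed

text \<open>
  A smooth transition from \<open>0\<close> on \<open>(-\<infinity>,0]\<close> to \<open>1\<close> on \<open>[1,\<infinity>)\<close>.
\<close>

definition smooth_step :: "real \<Rightarrow> real" where
  "smooth_step t = integral {0..t} bump / bump_mass"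

lemma smooth_step_deriv: "(smooth_step has_real_derivative bump t / bump_mass) (at t)"
proof -
  \<comment> \<open>Starting the integral left of both \<open>0\<close> and \<open>t\<close> changes nothing, as the bump vanishes there, and makes \<open>t\<close> an interior point.\<close>
  define a where "a = min t 0 - 1"
  have eq: "integral {a..s} bump = integral {0..s} bump" if "a \<le> s" for s
  proof (cases "s \<le> 0")
    case True
    then have "integral {a..s} bump = integral {a..s} (\<lambda>_. 0)"
      by (intro integral_cong) (auto simp: bump_eq_0)
    moreover have "integral {0..s} bump = 0"
      using True bump_eq_0[of 0] by (cases "s = 0") auto
    ultimately show ?thesis
      by simp
  next
    case False
    have "integral {a..0} bump = integral {a..0} (\<lambda>_. 0)"
      by (intro integral_cong) (auto simp: bump_eq_0)
    moreover have "integral {a..0} bump + integral {0..s} bump = integral {a..s} bump"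
      using False by (intro Henstock_Kurzweil_Integration.integral_combine integrable_continuous_interval bump_cont) (auto simp: a_def)
    ultimately show ?thesis
      by simp
  qed
  have "((\<lambda>s. integral {a..s} bump) has_real_derivative bump t) (at t within {a..t + 1})"
    by (rule integral_has_real_derivative[OF bump_cont]) (auto simp: a_def)
  then have "((\<lambda>s. integral {a..s} bump) has_real_derivative bump t) (at t)"
    by (simp add: at_within_Icc_at a_def)
  then have "((\<lambda>s. integral {0..s} bump) has_real_derivative bump t) (at t)"
    by (rule has_field_derivative_transform_within_open[where S="{a<..}"]) (use eq in \<open>auto simp: a_def\<close>)
  then show ?thesis
    unfolding smooth_step_def by (rule DERIV_cdivide)
qed

lemma smooth_step_eq_0: "t \<le> 0 \<Longrightarrow> smooth_step t = 0"
  using bump_eq_0[of 0] by (cases "t = 0") (auto simp: smooth_step_def)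

lemma smooth_step_mono: "s \<le> t \<Longrightarrow> smooth_step s \<le> smooth_step t"
  by (rule DERIV_nonneg_imp_nondecreasing[of s t])
     (use smooth_step_deriv bump_nonneg bump_mass_pos in \<open>auto intro!: exI divide_nonneg_pos\<close>)

lemma smooth_step_eq_1:
  assumes "1 \<le> t"
  shows "smooth_step t = 1"
proof -
  have "integral {0..1} bump + integral {1..t} bump = integral {0..t} bump"
    using assms by (intro Henstock_Kurzweil_Integration.integral_combine integrable_continuous_interval bump_cont) auto
  moreover have "integral {1..t} bump = integral {1..t} (\<lambda>_. 0)"
    by (intro integral_cong) (auto simp: bump_eq_0)
  ultimately show ?thesis
    using bump_mass_pos by (simp add: smooth_step_def bump_mass_def)
qed

lemma smooth_step_bounds: "0 \<le> smooth_step t" "smooth_step t \<le> 1"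
  using smooth_step_mono[of "min t 0" t] smooth_step_eq_0[of "min t 0"]
    smooth_step_mono[of t "max t 1"] smooth_step_eq_1[of "max t 1"] by auto

text \<open>
  A smooth approximation, as \<open>n \<rightarrow> \<infinity>\<close>, of the indicator function of \<open>(x,y]\<close>: it rises on
  \<open>[x, x + 1/n]\<close> and falls on \<open>[y, y + 1/n]\<close>, so its derivative is an approximate identity at \<open>x\<close> minus
  one at \<open>y\<close>.
\<close>

definition plateau :: "real \<Rightarrow> real \<Rightarrow> nat \<Rightarrow> real \<Rightarrow> real" where
  "plateau x y n t = smooth_step (real n * (t - x)) - smooth_step (real n * (t - y))"

lemma plateau_deriv:
  "(plateau x y n has_real_derivative
     real n * (bump (real n * (t - x)) - bump (real n * (t - y))) / bump_mass) (at t)"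
proof -
  have "((\<lambda>t. smooth_step (real n * (t - z))) has_real_derivative
      bump (real n * (t - z)) / bump_mass * real n) (at t)" for z
    by (rule DERIV_chain2[OF smooth_step_deriv]) (auto intro!: derivative_eq_intros)
  from DERIV_diff[OF this[of x] this[of y]] show ?thesis
    unfolding plateau_def by (simp add: right_diff_distrib diff_divide_distrib ac_simps)
qed

lemma plateau_smooth: "(deriv ^^ k) (plateau x y n) differentiable (at t)"
proof (rule smooth_if_closed_under_deriv[where S = "insert (plateau x y n)
    {\<lambda>t. c * (bump_deriv m q (real n * (t - x)) - bump_deriv m q (real n * (t - y))) | c m q. True}"])
  fix g assume "g \<in> insert (plateau x y n)
    {\<lambda>t. c * (bump_deriv m q (real n * (t - x)) - bump_deriv m q (real n * (t - y))) | c m q. True}"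
  then consider "g = plateau x y n"
    | c m q where "g = (\<lambda>t. c * (bump_deriv m q (real n * (t - x)) - bump_deriv m q (real n * (t - y))))"
    by blast
  then show "\<exists>g'\<in>insert (plateau x y n)
    {\<lambda>t. c * (bump_deriv m q (real n * (t - x)) - bump_deriv m q (real n * (t - y))) | c m q. True}.
      \<forall>x. (g has_real_derivative g' x) (at x)"
  proof cases
    case 1
    then have "\<forall>s. (g has_real_derivative (\<lambda>t. real n / bump_mass *
      (bump_deriv 0 1 (real n * (t - x)) - bump_deriv 0 1 (real n * (t - y)))) s) (at s)"
      using plateau_deriv[of x y n] by (simp add: bump_def)
    then show ?thesis
      by (intro bexI[where x = "\<lambda>t. real n / bump_mass *
      (bump_deriv 0 1 (real n * (t - x)) - bump_deriv 0 1 (real n * (t - y)))"]) blast+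
  next
    case 2
    obtain m' q' where d: "\<And>x. (bump_deriv m q has_real_derivative bump_deriv m' q' x) (at x)"
      using bump_deriv_has_derivative by blast
    have "((\<lambda>t. bump_deriv m q (real n * (t - z))) has_real_derivative
        bump_deriv m' q' (real n * (t - z)) * real n) (at t)" for z t
      by (rule DERIV_chain2[OF d]) (auto intro!: derivative_eq_intros)
    from DERIV_cmult[OF DERIV_diff[OF this[of x] this[of y]], of c]
    have "\<forall>s. (g has_real_derivative (\<lambda>t. (c * real n) *
      (bump_deriv m' q' (real n * (t - x)) - bump_deriv m' q' (real n * (t - y)))) s) (at s)"
      unfolding 2 by (simp add: algebra_simps)
    then show ?thesis
      by (intro bexI[where x = "\<lambda>t. (c * real n) *
      (bump_deriv m' q' (real n * (t - x)) - bump_deriv m' q' (real n * (t - y)))"]) blast+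
  qed
qed auto

lemma plateau_outside:
  assumes "x \<le> y" "0 < n" "t \<le> x \<or> y + 1 / real n \<le> t"
  shows "plateau x y n t = 0"
proof -
  consider "t \<le> x" | "y + 1 / real n \<le> t"
    using assms by blast
  then show ?thesis
  proof cases
    case 1
    then have "real n * (t - x) \<le> 0" "real n * (t - y) \<le> 0"
      using assms by (auto intro: mult_nonneg_nonpos)
    then show ?thesis
      by (simp add: plateau_def smooth_step_eq_0)
  next
    case 2
    then have "real n * (t - x) \<ge> 1" "real n * (t - y) \<ge> 1"
      using assms mult_left_mono[of "1 / real n" "t - x" "real n"] mult_left_mono[of "1 / real n" "t - y" "real n"]
      by auto
    then show ?thesis
      by (simp add: plateau_def smooth_step_eq_1)
  qed
qed

lemma plateau_test_function:
  assumes "x \<le> y" "0 < n" "{x..y + 1 / real n} \<subseteq> U"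
  shows "test_function U (plateau x y n)"
proof -
  have "{t. plateau x y n t \<noteq> 0} \<subseteq> {x..y + 1 / real n}"
    using plateau_outside[OF assms(1,2)] by (auto intro: ccontr simp: le_less_linear) (meson nle_le)+
  then have cl: "closure {t. plateau x y n t \<noteq> 0} \<subseteq> {x..y + 1 / real n}"
    by (intro closure_minimal) auto
  moreover have "compact (closure {t. plateau x y n t \<noteq> 0})"
    using cl by (meson bounded_closed_interval bounded_subset closed_closure compact_eq_bounded_closed)
  ultimately show ?thesis
    unfolding test_function_def using plateau_smooth assms(3) by blast
qed

lemma plateau_abs_le_1: "\<bar>plateau x y n t\<bar> \<le> 1"
  using smooth_step_bounds[of "real n * (t - x)"] smooth_step_bounds[of "real n * (t - y)"]
  by (simp add: plateau_def)

lemma plateau_tendsto: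
  assumes "x \<le> y"
  shows "(\<lambda>n. plateau x y n t) \<longlonglongrightarrow> indicator {x<..y} t"
proof -
  have 0: "(\<lambda>n. smooth_step (real n * (t - z))) \<longlonglongrightarrow> (if z < t then 1 else 0)" for z
  proof (cases "z < t")
    case True
    have "\<forall>\<^sub>F n in sequentially. real n * (t - z) \<ge> 1"
    proof -
      obtain N where N: "real N * (t - z) > 1"
        using True reals_Archimedean3[of "t - z"] by fastforce
      have "real n * (t - z) \<ge> 1" if "N \<le> n" for n
      proof -
        have "real N * (t - z) \<le> real n * (t - z)"
          using that True by (intro mult_right_mono) auto
        then show ?thesis
          using N by linarith
      qed
      then show ?thesis
        using eventually_at_top_linorder by blast
    qed
    then have "\<forall>\<^sub>F n in sequentially. smooth_step (real n * (t - z)) = 1"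
      by eventually_elim (simp add: smooth_step_eq_1)
    then show ?thesis
      using True by (simp add: tendsto_eventually)
  next
    case False
    then show ?thesis
      by (simp add: smooth_step_eq_0 mult_nonneg_nonpos)
  qed
  have "(\<lambda>n. plateau x y n t) \<longlonglongrightarrow> (if x < t then 1 else 0) - (if y < t then 1 else 0)"
    unfolding plateau_def by (intro tendsto_diff 0)
  then show ?thesis
    using assms by (auto simp: indicator_def split: if_splits)
qed

section \<open>Weak derivatives on an interval\<close>

lemma plateau_cont: "continuous_on X (plateau x y n)"
  using plateau_deriv[of x y n] DERIV_isCont by (blast intro: continuous_at_imp_continuous_on)

lemma deriv_plateau:
  "deriv (plateau x y n) t = real n * bump (real n * (t - x)) / bump_mass - real n * bump (real n * (t - y)) / bump_mass"
  using DERIV_imp_deriv[OF plateau_deriv[of x y n t]] by (simp add: diff_divide_distrib right_diff_distrib)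

lemma interior_extend_right:
  fixes x y :: real
  assumes "x \<le> y" "{x..y} \<subseteq> interior S"
  obtains y' where "y < y'" "{x..y'} \<subseteq> interior S"
proof -
  obtain e where e: "0 < e" "cball y e \<subseteq> interior S"
    using assms open_contains_cball[of "interior S"] by (metis atLeastAtMost_iff open_interior order_refl subset_iff)
  have "{x..y + e} \<subseteq> {x..y} \<union> cball y e"
    by (auto simp: dist_real_def)
  then show ?thesis
    using e assms by (auto intro!: that[of "y + e"] order_trans[of "{x..y + e}" "{x..y} \<union> cball y e"] simp del: atLeastatMost_subset_iff)
qed

lemma eventually_inverse_le:
  assumes "0 < (d::real)"
  shows "\<forall>\<^sub>F n in sequentially. 0 < n \<and> 1 / real n \<le> d"
proof -
  have "(\<lambda>n. 1 / real n) \<longlonglongrightarrow> 0"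
    by (rule lim_1_over_n)
  then have "\<forall>\<^sub>F n in sequentially. 1 / real n < d"
    using assms by (rule order_tendstoD)
  then show ?thesis
    using eventually_gt_at_top[of 0] by eventually_elim auto
qed

text \<open>
  The plateau overshoots \<open>y\<close> by \<open>1/n\<close>. Since the interior is open, there is room for this when \<open>n\<close> is
  large.
\<close>

lemma eventually_plateau_test_function:
  assumes "x \<le> y" "{x..y} \<subseteq> interior S"
  shows "\<forall>\<^sub>F n in sequentially. test_function (interior S) (plateau x y n)"
proof -
  obtain y' where y': "y < y'" "{x..y'} \<subseteq> interior S"
    using interior_extend_right[OF assms] by blast
  have "\<forall>\<^sub>F n in sequentially. 0 < n \<and> 1 / real n \<le> y' - y"
    using eventually_inverse_le[of "y' - y"] y' by simp
  then show ?thesis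
  proof eventually_elim
    case (elim n)
    then have "{x..y + 1 / real n} \<subseteq> {x..y'}"
      by auto
    then show ?case
      using elim assms(1) y'(2) by (intro plateau_test_function) auto
  qed
qed

lemma plateau_integral_tendsto:
  fixes f :: "real \<Rightarrow> complex"
  assumes xy: "x \<le> y" "{x..y} \<subseteq> interior S"
    and f: "\<And>C. compact C \<Longrightarrow> C \<subseteq> interior S \<Longrightarrow> set_integrable lebesgue C f"
  shows "(\<lambda>n. LINT t:S|lebesgue. plateau x y n t *\<^sub>R f t) \<longlonglongrightarrow> (LINT t:{x..y}|lebesgue. f t)"
proof -
  obtain y' where y': "y < y'" "{x..y'} \<subseteq> interior S"
    using interior_extend_right[OF xy] by blast
  let ?g = "\<lambda>t. indicator {x..y'} t *\<^sub>R f t"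
  have g: "integrable lebesgue ?g"
    using f[of "{x..y'}"] y' by (auto simp: set_integrable_def)
  have meas: "plateau x y n \<in> borel_measurable lebesgue" for n
    using borel_measurable_continuous_onI[OF plateau_cont] by (simp add: measurable_completion)
  have lim: "(\<lambda>n. LINT t|lebesgue. plateau x y n t *\<^sub>R ?g t)
      \<longlonglongrightarrow> (LINT t|lebesgue. indicator {x<..y} t *\<^sub>R ?g t)"
  proof (rule integral_dominated_convergence[where w = "\<lambda>t. norm (?g t)"])
    show "(\<lambda>t. plateau x y n t *\<^sub>R ?g t) \<in> borel_measurable lebesgue" for n
      by (rule borel_measurable_scaleR[OF meas borel_measurable_integrable[OF g]])
    show "(\<lambda>t. indicator {x<..y} t *\<^sub>R ?g t) \<in> borel_measurable lebesgue"
      by (rule borel_measurable_scaleR[OF _ borel_measurable_integrable[OF g]]) (simp add: borel_measurable_indicator)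
    show "AE t in lebesgue. (\<lambda>n. plateau x y n t *\<^sub>R ?g t) \<longlonglongrightarrow> indicator {x<..y} t *\<^sub>R ?g t"
      by (intro AE_I2 tendsto_scaleR plateau_tendsto xy tendsto_const)
    show "integrable lebesgue (\<lambda>t. norm (?g t))"
      by (rule integrable_norm[OF g])
    show "AE t in lebesgue. norm (plateau x y n t *\<^sub>R ?g t) \<le> norm (?g t)" for n
      using plateau_abs_le_1 by (intro AE_I2) (simp only: norm_scaleR real_norm_def, rule mult_left_le_one_le, auto)
  qed
  have eq: "(LINT t|lebesgue. indicator {x<..y} t *\<^sub>R ?g t) = (LINT t:{x..y}|lebesgue. f t)"
    unfolding set_lebesgue_integral_def
  proof (rule integral_cong_AE)
    have "set_integrable lebesgue {x..y} f"
      using xy f by auto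
    then show "(\<lambda>t. indicator {x..y} t *\<^sub>R f t) \<in> borel_measurable lebesgue"
      by (auto simp: set_integrable_def intro: borel_measurable_integrable)
    show "(\<lambda>t. indicator {x<..y} t *\<^sub>R ?g t) \<in> borel_measurable lebesgue"
      by (rule borel_measurable_scaleR[OF _ borel_measurable_integrable[OF g]]) (simp add: borel_measurable_indicator)
    have "AE t in lebesgue. t \<noteq> x"
      using AE_not_in[of "{x}" lebesgue] null_sets_completionI[of "{x}" lborel] by simp
    then show "AE t in lebesgue. indicator {x<..y} t *\<^sub>R ?g t = indicator {x..y} t *\<^sub>R f t"
      by eventually_elim (use y' in \<open>auto simp: indicator_def\<close>)
  qed
  have ev: "\<forall>\<^sub>F n in sequentially. (LINT t|lebesgue. plateau x y n t *\<^sub>R ?g t)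
      = (LINT t:S|lebesgue. plateau x y n t *\<^sub>R f t)"
  proof -
    have "\<forall>\<^sub>F n in sequentially. 0 < n \<and> 1 / real n \<le> y' - y"
      using eventually_inverse_le[of "y' - y"] y' by simp
    then show ?thesis
    proof eventually_elim
      case (elim n)
      have "plateau x y n t = 0" if "t \<notin> {x..y'}" for t
        using plateau_outside[OF xy(1), of n t] that elim by auto
      moreover have "{x..y'} \<subseteq> S"
        using y' interior_subset by blast
      ultimately show ?case
        unfolding set_lebesgue_integral_def
        by (intro Bochner_Integration.integral_cong refl) (auto simp: indicator_def)
    qed
  qed
  show ?thesis
    using Lim_transform_eventually[OF lim ev] unfolding eq .
qed

text \<open>
  The rescaled bumps are an approximate identity: they have integral \<open>1\<close> and concentrate at \<open>z\<close>, where
  \<open>u\<close> is nearly constant.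
\<close>

lemma bump_kernel_tendsto:
  fixes u :: "real \<Rightarrow> complex"
  assumes ab: "a \<le> z" "z < b" and u: "continuous_on {a..b} u"
  shows "(\<lambda>n. integral {a..b} (\<lambda>t. (real n * bump (real n * (t - z)) / bump_mass) *\<^sub>R u t)) \<longlonglongrightarrow> u z"
proof (rule metric_LIMSEQ_I)
  fix r :: real assume "0 < r"
  let ?K = "\<lambda>n t. real n * bump (real n * (t - z)) / bump_mass"
  obtain d where d: "0 < d" "\<And>t. t \<in> {a..b} \<Longrightarrow> dist t z < d \<Longrightarrow> dist (u t) (u z) < r / 2"
    using u ab \<open>0 < r\<close> unfolding continuous_on_iff
    by (metis atLeastAtMost_iff half_gt_zero less_eq_real_def)
  have Kc: "continuous_on X (?K n)" for X n
    by (intro continuous_intros continuous_on_compose2[OF bump_cont[of UNIV]]) (use bump_mass_pos in auto)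
  have "\<forall>\<^sub>F n in sequentially. 0 < n \<and> 1 / real n \<le> min (d/2) (b - z)"
    using eventually_inverse_le[of "min (d/2) (b - z)"] d ab by simp
  then have "\<forall>\<^sub>F n in sequentially. dist (integral {a..b} (\<lambda>t. ?K n t *\<^sub>R u t)) (u z) < r"
  proof eventually_elim
    case (elim n)
    have "(?K n has_integral smooth_step (real n * (b - z)) - smooth_step (real n * (a - z))) {a..b}"
    proof (rule fundamental_theorem_of_calculus)
      fix t assume "t \<in> {a..b}"
      have "((\<lambda>t. smooth_step (real n * (t - z))) has_real_derivative
          bump (real n * (t - z)) / bump_mass * real n) (at t)"
        by (rule DERIV_chain2[OF smooth_step_deriv]) (auto intro!: derivative_eq_intros)
      then show "((\<lambda>t. smooth_step (real n * (t - z))) has_vector_derivative ?K n t) (at t within {a..b})"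
        by (simp add: has_real_derivative_iff_has_vector_derivative[symmetric] mult.commute has_field_derivative_at_within)
    qed (use ab in auto)
    moreover have "smooth_step (real n * (b - z)) = 1"
      using elim by (intro smooth_step_eq_1) (auto simp: field_simps)
    moreover have "smooth_step (real n * (a - z)) = 0"
      using ab by (intro smooth_step_eq_0) (auto intro: mult_nonneg_nonpos)
    ultimately have K1: "(?K n has_integral 1) {a..b}"
      by simp
    have i1: "(\<lambda>t. ?K n t *\<^sub>R u t) integrable_on {a..b}"
      by (intro integrable_continuous_interval continuous_intros Kc u)
    have "((\<lambda>t. ?K n t *\<^sub>R u z) has_integral 1 *\<^sub>R u z) {a..b}"
      by (rule has_integral_scaleR_left[OF K1])
    then have i2: "(\<lambda>t. ?K n t *\<^sub>R u z) integrable_on {a..b}" "integral {a..b} (\<lambda>t. ?K n t *\<^sub>R u z) = u z"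
      unfolding has_integral_iff by (simp_all only: scaleR_one)
    then have dif: "integral {a..b} (\<lambda>t. ?K n t *\<^sub>R u t) - u z = integral {a..b} (\<lambda>t. ?K n t *\<^sub>R u t - ?K n t *\<^sub>R u z)"
      unfolding Henstock_Kurzweil_Integration.integral_diff[OF i1 i2(1)] by (simp only:)
    have "norm (integral {a..b} (\<lambda>t. ?K n t *\<^sub>R u t - ?K n t *\<^sub>R u z)) \<le> integral {a..b} (\<lambda>t. (r / 2) * ?K n t)"
    proof (rule integral_norm_bound_integral)
      show "(\<lambda>t. ?K n t *\<^sub>R u t - ?K n t *\<^sub>R u z) integrable_on {a..b}"
        by (intro integrable_continuous_interval continuous_intros Kc u)
      show "(\<lambda>t. (r / 2) * ?K n t) integrable_on {a..b}"
        by (intro integrable_continuous_interval continuous_on_mult Kc continuous_on_const)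
      fix t assume t: "t \<in> {a..b}"
      have K0: "0 \<le> ?K n t"
        using bump_nonneg bump_mass_pos by simp
      show "norm (?K n t *\<^sub>R u t - ?K n t *\<^sub>R u z) \<le> (r / 2) * ?K n t"
      proof (cases "?K n t = 0")
        case False
        then have "0 < real n * (t - z)" "real n * (t - z) < 1"
          using bump_eq_0[of "real n * (t - z)"] by force+
        then have "0 < t - z" "t - z < 1 / real n"
          using elim by (auto simp: zero_less_mult_iff field_simps)
        then have "dist t z < d"
          using elim d(1) by (auto simp: dist_real_def)
        then have "norm (u t - u z) \<le> r / 2"
          using d(2)[OF t] by (simp add: dist_norm)
        then have "?K n t * norm (u t - u z) \<le> ?K n t * (r / 2)"
          using K0 by (rule mult_left_mono)
        then show ?thesis
          by (simp only: scaleR_diff_right[symmetric] norm_scaleR abs_of_nonneg[OF K0] mult.commute[of "r / 2"])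
      next
        case True
        show ?thesis
          by (simp only: True scaleR_zero_left mult_zero_right diff_self norm_zero order_refl)
      qed
    qed
    moreover have "integral {a..b} (\<lambda>t. (r / 2) * ?K n t) = r / 2 * 1"
      by (rule integral_unique, rule has_integral_mult_right, rule K1)
    ultimately have "norm (integral {a..b} (\<lambda>t. ?K n t *\<^sub>R u t) - u z) \<le> r / 2"
      unfolding dif by (simp only: mult_1_right)
    then show ?case
      using \<open>0 < r\<close> unfolding dist_norm by linarith
  qed
  then show "\<exists>no. \<forall>n\<ge>no. dist (integral {a..b} (\<lambda>t. ?K n t *\<^sub>R u t)) (u z) < r"
    unfolding eventually_sequentially .
qed

lemma deriv_plateau_integral_tendsto:
  fixes u :: "real \<Rightarrow> complex"
  assumes xy: "x \<le> y" "{x..y} \<subseteq> interior S" and u: "continuous_on S u"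
  shows "(\<lambda>n. LINT t:S|lebesgue. deriv (plateau x y n) t *\<^sub>R u t) \<longlonglongrightarrow> u x - u y"
proof -
  obtain y' where y': "y < y'" "{x..y'} \<subseteq> interior S"
    using interior_extend_right[OF xy] by blast
  then have S: "{x..y'} \<subseteq> S"
    using interior_subset by blast
  have uc: "continuous_on {x..y'} u"
    using u S continuous_on_subset by blast
  let ?K = "\<lambda>n z t. real n * bump (real n * (t - z)) / bump_mass"
  have Kc: "continuous_on X (?K n z)" for X n z
    by (intro continuous_intros continuous_on_compose2[OF bump_cont[of UNIV]]) (use bump_mass_pos in auto)
  have lim: "(\<lambda>n. integral {x..y'} (\<lambda>t. ?K n x t *\<^sub>R u t) - integral {x..y'} (\<lambda>t. ?K n y t *\<^sub>R u t))
     \<longlonglongrightarrow> u x - u y"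
    by (intro tendsto_diff bump_kernel_tendsto uc) (use xy y' in auto)
  have ev: "\<forall>\<^sub>F n in sequentially.
     integral {x..y'} (\<lambda>t. ?K n x t *\<^sub>R u t) - integral {x..y'} (\<lambda>t. ?K n y t *\<^sub>R u t)
     = (LINT t:S|lebesgue. deriv (plateau x y n) t *\<^sub>R u t)"
  proof -
    have "\<forall>\<^sub>F n in sequentially. 0 < n \<and> 1 / real n \<le> y' - y"
      using eventually_inverse_le[of "y' - y"] y' by simp
    then show ?thesis
    proof eventually_elim
      case (elim n)
      have K0: "?K n z t = 0" if "t \<notin> {x..y'}" "z \<in> {x,y}" for t z
      proof -
        have "t - z \<le> 0 \<or> 1 / real n \<le> t - z"
          using that elim xy by auto
        then have "real n * (t - z) \<le> 0 \<or> 1 \<le> real n * (t - z)"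
          using elim by (auto simp: field_simps mult_nonneg_nonpos)
        then show ?thesis
          by (simp add: bump_eq_0)
      qed
      then have "indicator S t *\<^sub>R (deriv (plateau x y n) t *\<^sub>R u t)
         = indicator {x..y'} t *\<^sub>R (deriv (plateau x y n) t *\<^sub>R u t)" for t
        using S by (auto simp: indicator_def deriv_plateau)
      then have "(LINT t:S|lebesgue. deriv (plateau x y n) t *\<^sub>R u t)
         = (LINT t:{x..y'}|lebesgue. deriv (plateau x y n) t *\<^sub>R u t)"
        unfolding set_lebesgue_integral_def by (rule Bochner_Integration.integral_cong[OF refl])
      also have "\<dots> = integral {x..y'} (\<lambda>t. deriv (plateau x y n) t *\<^sub>R u t)"
        unfolding deriv_plateau
        by (intro set_lebesgue_integral_eq_integral absolutely_integrable_continuous_real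
              continuous_intros Kc uc)
      also have "\<dots> = integral {x..y'} (\<lambda>t. ?K n x t *\<^sub>R u t) - integral {x..y'} (\<lambda>t. ?K n y t *\<^sub>R u t)"
        unfolding deriv_plateau scaleR_diff_left
        by (intro Henstock_Kurzweil_Integration.integral_diff integrable_continuous_interval
              continuous_intros Kc uc)
      finally show ?case
        by simp
    qed
  qed
  show ?thesis
    using lim ev by (rule Lim_transform_eventually)
qed

text \<open>
  By Lebesgue's differentiation theorem, \<open>f\<close> is almost everywhere the limit of its averages over short
  intervals, all of which vanish. Countably many intervals with rational endpoints cover the interior.
\<close>

lemma AE_zero_if_interval_integrals_zero:
  fixes f :: "real \<Rightarrow> complex"
  assumes f: "\<And>C. compact C \<Longrightarrow> C \<subseteq> interior S \<Longrightarrow> set_integrable lebesgue C f"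
    and 0: "\<And>x y. x \<le> y \<Longrightarrow> {x..y} \<subseteq> interior S \<Longrightarrow> (LINT t:{x..y}|lebesgue. f t) = 0"
  shows "AE t in lebesgue. t \<in> interior S \<longrightarrow> f t = 0"
proof -
  have local: "AE t in lebesgue. t \<in> {a<..<b} \<longrightarrow> f t = 0" if ab: "{a..b} \<subseteq> interior S" for a b
  proof -
    define g where "g = (\<lambda>t. if t \<in> {a..b} then f t else 0)"
    have fab: "set_integrable lebesgue {a..b} f"
      using f ab by auto
    have "g integrable_on UNIV"
      unfolding g_def integrable_restrict_UNIV using fab set_lebesgue_integral_eq_integral(1) by blast
    then have "g integrable_on cbox c d" for c d
      using integrable_on_subcbox by blast
    then obtain N where N: "negligible N"
       "\<And>x e. x \<notin> N \<Longrightarrow> 0 < e \<Longrightarrow> \<exists>d>0. \<forall>h. 0 < h \<and> h < d \<longrightarrow>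
            norm (integral (cbox x (x + h *\<^sub>R One)) g /\<^sub>R h ^ DIM(real) - g x) < e"
      using integrable_ccontinuous_explicit by metis
    have "f t = 0" if t: "t \<notin> N" "t \<in> {a<..<b}" for t
    proof (rule ccontr)
      assume "f t \<noteq> 0"
      then obtain d where d: "0 < d" "\<And>h. 0 < h \<Longrightarrow> h < d \<Longrightarrow>
          norm (integral (cbox t (t + h *\<^sub>R One)) g /\<^sub>R h ^ DIM(real) - g t) < norm (f t)"
        using N(2)[OF t(1), of "norm (f t)"] by auto
      \<comment> \<open>Averages over \<open>[t, t + h]\<close> vanish, yet they should approximate \<open>f t\<close>.\<close>
      define h where "h = min (d/2) (b - t)"
      have h: "0 < h" "h < d" "t + h \<le> b"
        using d t by (auto simp: h_def)
      have "integral {t..t + h} g = integral {t..t + h} f"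
        using h t by (intro integral_cong) (auto simp: g_def)
      also have "\<dots> = (LINT s:{t..t + h}|lebesgue. f s)"
        using h t ab by (intro set_lebesgue_integral_eq_integral(2)[symmetric] f) auto
      also have "\<dots> = 0"
        using h t ab by (intro 0) auto
      finally have "norm (g t) < norm (f t)"
        using d(2)[OF h(1,2)] by simp
      then show False
        using t by (simp add: g_def)
    qed
    moreover have "AE t in lebesgue. t \<notin> N"
      using N(1) by (simp add: AE_not_in negligible_iff_null_sets)
    ultimately show ?thesis
      by (auto elim: eventually_mono)
  qed
  have "AE t in lebesgue. \<forall>p\<in>{p. fst p \<in> \<rat> \<and> snd p \<in> \<rat> \<and> {fst p..snd p} \<subseteq> interior S}.
     t \<in> {fst p<..<snd p} \<longrightarrow> f t = 0"
  proof (subst AE_ball_countable)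
    have "{p. fst p \<in> \<rat> \<and> snd p \<in> \<rat> \<and> {fst p..snd p} \<subseteq> interior S} \<subseteq> (\<rat> :: real set) \<times> \<rat>"
      by auto
    then show "countable {p. fst p \<in> \<rat> \<and> snd p \<in> \<rat> \<and> {fst p..snd p} \<subseteq> interior S}"
      by (rule countable_subset) (simp add: countable_rat)
  qed (use local in auto)
  then show ?thesis
  proof eventually_elim
    case (elim t)
    show ?case
    proof
      assume "t \<in> interior S"
      then obtain e where e: "0 < e" "cball t e \<subseteq> interior S"
        using open_contains_cball[of "interior S"] by auto
      obtain a where a: "a \<in> \<rat>" "t - e < a" "a < t"
        using Rats_dense_in_real[of "t - e" t] e by auto
      obtain b where b: "b \<in> \<rat>" "t < b" "b < t + e"
        using Rats_dense_in_real[of t "t + e"] e by auto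
      have "{a..b} \<subseteq> cball t e"
        using a b by (auto simp: dist_real_def)
      then show "f t = 0"
        using elim e a b by (auto dest: bspec[where x = "(a, b)"])
    qed
  qed
qed

text \<open>
  Testing with plateaus shows that the integrals over all compact intervals vanish.
\<close>

lemma fundamental_lemma:
  fixes f :: "real \<Rightarrow> complex"
  assumes f: "\<And>C. compact C \<Longrightarrow> C \<subseteq> interior S \<Longrightarrow> set_integrable lebesgue C f"
    and 0: "\<And>\<phi>. test_function (interior S) \<phi> \<Longrightarrow> (LINT t:S|lebesgue. \<phi> t *\<^sub>R f t) = 0"
  shows "AE t in lebesgue. t \<in> interior S \<longrightarrow> f t = 0"
proof (rule AE_zero_if_interval_integrals_zero[OF f])
  fix x y :: real assume xy: "x \<le> y" "{x..y} \<subseteq> interior S"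
  have "(\<lambda>n. LINT t:S|lebesgue. plateau x y n t *\<^sub>R f t) \<longlonglongrightarrow> 0"
    by (rule tendsto_eventually, rule eventually_mono[OF eventually_plateau_test_function[OF xy]]) (rule 0)
  then show "(LINT t:{x..y}|lebesgue. f t) = 0"
    using plateau_integral_tendsto[OF xy f] LIMSEQ_unique by blast
qed

text \<open>
  Insert the plateau of \<open>[x,y]\<close> into the definition of the weak derivative. On one side its derivative
  acts as a difference of point evaluations, on the other side the plateau tends to the indicator
  function of the interval.
\<close>

lemma weak_deriv_integral_interior:
  assumes wd: "has_weak_deriv S u w" and u: "continuous_on S u"
    and xy: "x \<le> y" "{x..y} \<subseteq> interior S"
  shows "u y - u x = (LINT t:{x..y}|lebesgue. w t)"
proof -
  have lim: "(\<lambda>n. - (LINT t:S|lebesgue. plateau x y n t *\<^sub>R w t)) \<longlonglongrightarrow> - (LINT t:{x..y}|lebesgue. w t)"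
    using wd by (intro tendsto_minus plateau_integral_tendsto xy) (auto simp: has_weak_deriv_def)
  have ev: "\<forall>\<^sub>F n in sequentially. - (LINT t:S|lebesgue. plateau x y n t *\<^sub>R w t)
     = (LINT t:S|lebesgue. deriv (plateau x y n) t *\<^sub>R u t)"
    by (rule eventually_mono[OF eventually_plateau_test_function[OF xy]])
       (use wd in \<open>auto simp: has_weak_deriv_def\<close>)
  have "u x - u y = - (LINT t:{x..y}|lebesgue. w t)"
    using deriv_plateau_integral_tendsto[OF xy u] Lim_transform_eventually[OF lim ev] LIMSEQ_unique by blast
  then show ?thesis
    by (simp add: algebra_simps minus_equation_iff)
qed

text \<open>
  The formula extends to the endpoints of the edge: \<open>u\<close> minus a primitive of \<open>w\<close> is continuous on the
  closed interval and constant on its interior.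
\<close>

lemma weak_deriv_integral:
  assumes wd: "has_weak_deriv S u w" and u: "continuous_on S u"
    and ab: "{a..b} \<subseteq> S" and w: "set_integrable lebesgue {a..b} w"
    and xy: "a \<le> x" "x \<le> y" "y \<le> b"
  shows "u y - u x = (LINT t:{x..y}|lebesgue. w t)"
proof (cases "x = y")
  case True
  have "(LINT t:{x..y}|lebesgue. w t) = integral {x..y} w"
    using xy by (intro set_lebesgue_integral_eq_integral set_integrable_subset[OF w]) auto
  then show ?thesis
    using True by simp
next
  case False
  then have lt: "x < y"
    using xy by simp
  have wxy: "set_integrable lebesgue {x..y} w"
    using xy by (intro set_integrable_subset[OF w]) auto
  have int: "{x<..<y} \<subseteq> interior S"
    using ab xy by (intro interior_maximal) auto
  define g where "g = (\<lambda>t. u t - integral {x..t} w)"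
  define m where "m = (x + y) / 2"
  have m: "x < m" "m < y"
    using lt by (auto simp: m_def)
  have wi: "w integrable_on {x..y}"
    using wxy set_lebesgue_integral_eq_integral(1) by blast
  have inner: "integral {x..t} w - integral {x..s} w = u t - u s" if st: "x < s" "s \<le> t" "t < y" for s t
  proof -
    have "integral {x..s} w + integral {s..t} w = integral {x..t} w"
      using st by (intro Henstock_Kurzweil_Integration.integral_combine integrable_subinterval_real[OF wi]) auto
    moreover have "integral {s..t} w = (LINT t:{s..t}|lebesgue. w t)"
      using st by (intro set_lebesgue_integral_eq_integral(2)[symmetric] set_integrable_subset[OF wxy]) auto
    moreover have "u t - u s = (LINT t:{s..t}|lebesgue. w t)"
      using st int by (intro weak_deriv_integral_interior[OF wd u]) auto
    ultimately show ?thesis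
      by (simp add: algebra_simps)
  qed
  have "continuous_on {x..y} g"
    unfolding g_def using ab xy
    by (intro continuous_intros indefinite_integral_continuous_1 wi continuous_on_subset[OF u]) auto
  then have "continuous_on (closure {x<..<y}) g"
    using lt by (simp add: closure_greaterThanLessThan)
  moreover have "g t = g m" if "t \<in> {x<..<y}" for t
  proof (cases "t \<le> m")
    case True
    then show ?thesis
      using inner[of t m] that m by (simp add: g_def algebra_simps)
  next
    case False
    then show ?thesis
      using inner[of m t] that m by (simp add: g_def algebra_simps)
  qed
  ultimately have "g t = g m" if "t \<in> closure {x<..<y}" for t
    using that by (rule continuous_constant_on_closure)
  then have "g x = g y"
    using lt by (simp add: closure_greaterThanLessThan)
  then have "u y - u x = integral {x..y} w"
    by (simp add: g_def algebra_simps)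
  then show ?thesis
    using wxy by (simp add: set_lebesgue_integral_eq_integral(2))
qed

section \<open>Square-integrable functions\<close>

definition square_integrable :: "'a measure \<Rightarrow> ('a \<Rightarrow> complex) \<Rightarrow> bool" where
  "square_integrable M f \<longleftrightarrow> f \<in> borel_measurable M \<and> integrable M (\<lambda>x. (norm (f x))\<^sup>2)"

lemma norm_square_measurable: "square_integrable N f \<Longrightarrow> (\<lambda>x. (norm (f x))\<^sup>2) \<in> borel_measurable N"
  unfolding square_integrable_def by (blast intro: borel_measurable_integrable)

lemma square_integrable_on_iff:
  assumes "S \<in> sets lebesgue"
  shows "square_integrable_on S f \<longleftrightarrow> square_integrable (lebesgue_on S) f"
  using assms unfolding square_integrable_on_def square_integrable_def set_borel_measurable_def set_integrable_def
  by (simp add: borel_measurable_restrict_space_iff integrable_restrict_space)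

lemma set_integrable_iff_lebesgue_on:
  fixes f :: "real \<Rightarrow> 'b::{banach, second_countable_topology}"
  assumes "S \<in> sets lebesgue"
  shows "set_integrable lebesgue S f \<longleftrightarrow> integrable (lebesgue_on S) f"
  using assms unfolding set_integrable_def by (subst integrable_restrict_space) auto

lemma set_lebesgue_integral_eq_lebesgue_on:
  fixes f :: "real \<Rightarrow> 'b::{banach, second_countable_topology}"
  assumes "S \<in> sets lebesgue"
  shows "(LINT x:S|lebesgue. f x) = integral\<^sup>L (lebesgue_on S) f"
  using assms unfolding set_lebesgue_integral_def by (simp add: integral_restrict_space)

lemma AE_lebesgue_on:
  assumes "S \<in> sets lebesgue"
  shows "(AE x in lebesgue_on S. P x) \<longleftrightarrow> (AE x in lebesgue. x \<in> S \<longrightarrow> P x)"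
  using assms by (simp add: AE_restrict_space_iff)

lemma integrable_norm_mult:
  assumes "square_integrable M f" "square_integrable M g"
  shows "integrable M (\<lambda>x. norm (f x) * norm (g x))"
proof (rule Bochner_Integration.integrable_bound)
  show "integrable M (\<lambda>x. (norm (f x))\<^sup>2 + (norm (g x))\<^sup>2)"
    using assms by (simp add: square_integrable_def)
  show "(\<lambda>x. norm (f x) * norm (g x)) \<in> borel_measurable M"
    using assms by (auto simp: square_integrable_def intro!: borel_measurable_times borel_measurable_norm)
  have "a * b \<le> a\<^sup>2 + b\<^sup>2" if "0 \<le> a" "0 \<le> b" for a b :: real
    using sum_squares_bound[of a b] that mult_nonneg_nonneg[of a b] by linarith
  then show "AE x in M. norm (norm (f x) * norm (g x)) \<le> norm ((norm (f x))\<^sup>2 + (norm (g x))\<^sup>2)"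
    by simp
qed

lemma integrable_mult_cnj:
  assumes "square_integrable M f" "square_integrable M g"
  shows "integrable M (\<lambda>x. f x * cnj (g x))"
proof (rule Bochner_Integration.integrable_bound[OF integrable_norm_mult[OF assms]])
  have "(\<lambda>x. cnj (g x)) \<in> borel_measurable M"
    using assms(2) by (intro borel_measurable_continuous_on[OF continuous_on_cnj[OF continuous_on_id]])
      (auto simp: square_integrable_def)
  then show "(\<lambda>x. f x * cnj (g x)) \<in> borel_measurable M"
    using assms(1) by (intro borel_measurable_times) (auto simp: square_integrable_def)
qed (simp add: norm_mult)

lemma square_integrable_lincomb:
  assumes "square_integrable M f" "square_integrable M g"
  shows "square_integrable M (\<lambda>x. a * f x + b * g x)"
  unfolding square_integrable_def
proof
  show meas: "(\<lambda>x. a * f x + b * g x) \<in> borel_measurable M"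
    using assms by (auto simp: square_integrable_def intro!: borel_measurable_add borel_measurable_times)
  show "integrable M (\<lambda>x. (norm (a * f x + b * g x))\<^sup>2)"
  proof (rule Bochner_Integration.integrable_bound)
    show "integrable M (\<lambda>x. 2 * ((norm a)\<^sup>2 * (norm (f x))\<^sup>2 + (norm b)\<^sup>2 * (norm (g x))\<^sup>2))"
      using assms by (simp add: square_integrable_def)
    show "(\<lambda>x. (norm (a * f x + b * g x))\<^sup>2) \<in> borel_measurable M"
      by (rule borel_measurable_power[OF measurable_compose[OF meas borel_measurable_norm]])
    have "(norm (a * f x + b * g x))\<^sup>2 \<le> 2 * ((norm a)\<^sup>2 * (norm (f x))\<^sup>2 + (norm b)\<^sup>2 * (norm (g x))\<^sup>2)" for x
    proof -
      have "(norm (a * f x + b * g x))\<^sup>2 \<le> (norm (a * f x) + norm (b * g x))\<^sup>2"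
        by (intro power_mono norm_triangle_ineq) auto
      also have "\<dots> \<le> 2 * ((norm (a * f x))\<^sup>2 + (norm (b * g x))\<^sup>2)"
        using sum_squares_bound[of "norm (a * f x)" "norm (b * g x)"] by (simp add: power2_sum)
      finally show ?thesis
        by (simp add: norm_mult power_mult_distrib)
    qed
    then show "AE x in M. norm ((norm (a * f x + b * g x))\<^sup>2)
        \<le> norm (2 * ((norm a)\<^sup>2 * (norm (f x))\<^sup>2 + (norm b)\<^sup>2 * (norm (g x))\<^sup>2))"
      by auto
  qed
qed

text \<open>
  The common source of the Cauchy-Schwarz inequalities and of the Euler-Lagrange equation below: for
  \<open>a = 0\<close> it says that the linear coefficient vanishes.
\<close>

lemma quadratic_nonneg_imp_discriminant:
  fixes a b c :: real
  assumes "\<And>s. 0 \<le> a + 2 * s * b + s\<^sup>2 * c"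
  shows "b\<^sup>2 \<le> a * c"
proof (cases "c = 0")
  case True
  have "b = 0"
  proof (rule ccontr)
    assume "b \<noteq> 0"
    then show False
      using assms[of "- (a + 1) / (2 * b)"] True by (simp add: field_simps)
  qed
  then show ?thesis
    using True by simp
next
  case False
  have "0 \<le> a"
    using assms[of 0] by simp
  have "0 < c"
  proof (rule ccontr)
    assume "\<not> 0 < c"
    with False have c: "c < 0"
      by simp
    \<comment> \<open>Adding the inequalities for \<open>s\<close> and \<open>-s\<close> removes the linear term; this \<open>s\<close> is large enough that \<open>s\<^sup>2 |c|\<close> exceeds \<open>a\<close>.\<close>
    define s where "s = 2 * (a + 1 + \<bar>b\<bar>) / \<bar>c\<bar> + 1"
    have "0 \<le> a - s\<^sup>2 * \<bar>c\<bar>"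
      using assms[of s] assms[of "- s"] c by simp
    moreover have "s\<^sup>2 * \<bar>c\<bar> \<ge> s * \<bar>c\<bar>"
    proof (rule mult_right_mono)
      have "1 \<le> s"
        using \<open>0 \<le> a\<close> by (simp add: s_def)
      then show "s \<le> s\<^sup>2"
        by (simp add: power2_eq_square)
    qed simp
    moreover have "s * \<bar>c\<bar> > a"
    proof -
      have "s * \<bar>c\<bar> = 2 * (a + 1 + \<bar>b\<bar>) + \<bar>c\<bar>"
        using c by (simp add: s_def field_simps)
      moreover have "a < 2 * (a + 1 + \<bar>b\<bar>) + \<bar>c\<bar>"
        using \<open>0 \<le> a\<close> by (smt (verit) abs_ge_zero)
      ultimately show ?thesis
        by (simp only:)
    qed
    ultimately show False
      by simp
  qed
  have "0 \<le> (a + 2 * (- b / c) * b + (- b / c)\<^sup>2 * c) * c"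
    using assms[of "- b / c"] \<open>0 < c\<close> by (intro mult_nonneg_nonneg) auto
  also have "\<dots> = a * c - b\<^sup>2"
    using \<open>0 < c\<close> by (simp add: field_simps power2_eq_square)
  finally show ?thesis
    by simp
qed

lemma integral_norm_mult_le:
  assumes f: "square_integrable M f" and g: "square_integrable M g"
  shows "(LINT x|M. norm (f x) * norm (g x))\<^sup>2 \<le> (LINT x|M. (norm (f x))\<^sup>2) * (LINT x|M. (norm (g x))\<^sup>2)"
proof (rule quadratic_nonneg_imp_discriminant)
  fix s :: real
  have "0 \<le> (LINT x|M. (norm (f x) + s * norm (g x))\<^sup>2)"
    by simp
  also have "\<dots> = (LINT x|M. (norm (f x))\<^sup>2 + 2 * s * (norm (f x) * norm (g x)) + s\<^sup>2 * (norm (g x))\<^sup>2)"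
    by (rule Bochner_Integration.integral_cong) (auto simp: power2_sum power_mult_distrib)
  also have "\<dots> = (LINT x|M. (norm (f x))\<^sup>2) + 2 * s * (LINT x|M. norm (f x) * norm (g x))
      + s\<^sup>2 * (LINT x|M. (norm (g x))\<^sup>2)"
    using f g integrable_norm_mult[OF f g] by (simp add: square_integrable_def)
  finally show "0 \<le> (LINT x|M. (norm (f x))\<^sup>2) + 2 * s * (LINT x|M. norm (f x) * norm (g x))
      + s\<^sup>2 * (LINT x|M. (norm (g x))\<^sup>2)" .
qed

lemma fast_Cauchy_subsequence:
  fixes d :: "nat \<Rightarrow> nat \<Rightarrow> real" and \<epsilon> :: "nat \<Rightarrow> real"
  assumes "\<And>e. 0 < e \<Longrightarrow> \<exists>N. \<forall>m\<ge>N. \<forall>n\<ge>N. d m n < e" and "\<And>n. 0 < \<epsilon> n"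
  obtains r where "strict_mono r" "\<And>n m. r n \<le> m \<Longrightarrow> d m (r n) < \<epsilon> n"
proof -
  have "\<forall>k. \<exists>N. \<forall>m\<ge>N. \<forall>n\<ge>N. d m n < \<epsilon> k"
    using assms by blast
  from choice[OF this] obtain N where N: "\<forall>k. \<forall>m\<ge>N k. \<forall>n\<ge>N k. d m n < \<epsilon> k" ..
  \<comment> \<open>Strictly increasing, and at least \<open>N n\<close>.\<close>
  define r where "r n = n + (\<Sum>i\<le>n. N i)" for n
  have "strict_mono r"
    by (rule strict_monoI_Suc) (simp add: r_def)
  moreover have "N n \<le> r n" for n
    unfolding r_def using member_le_sum[of n "{..n}" N] by simp
  ultimately show ?thesis
    using N by (intro that[of r]) (auto intro: order_trans)
qed

text \<open>
  By monotone convergence the weighted series has a finite integral, since \<open>2^n / 4^n\<close> is summable.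
\<close>

lemma AE_summable_if_integrals_small:
  fixes h :: "nat \<Rightarrow> 'a \<Rightarrow> real"
  assumes h: "\<And>n. integrable M (h n)" "\<And>n x. 0 \<le> h n x" and le: "\<And>n. (LINT x|M. h n x) \<le> (1/4)^n"
  shows "AE x in M. summable (\<lambda>n. 2 ^ n * h n x)"
proof -
  have "(\<integral>\<^sup>+x. (\<Sum>n. ennreal (2 ^ n * h n x)) \<partial>M) = (\<Sum>n. \<integral>\<^sup>+x. ennreal (2 ^ n * h n x) \<partial>M)"
    using h(1) by (intro nn_integral_suminf) (auto intro: borel_measurable_integrable)
  also have "\<dots> \<le> (\<Sum>n. ennreal ((1/2)^n))"
  proof (rule suminf_le)
    fix n
    have "(\<integral>\<^sup>+x. ennreal (2 ^ n * h n x) \<partial>M) = ennreal (LINT x|M. 2 ^ n * h n x)"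
      using h by (intro nn_integral_eq_integral) auto
    also have "\<dots> \<le> ennreal ((1/2)^n)"
    proof (rule ennreal_leI)
      have "(LINT x|M. 2 ^ n * h n x) \<le> 2 ^ n * (1/4)^n"
        using le[of n] by simp
      also have "\<dots> = (1/2)^n"
        by (simp add: power_mult_distrib[symmetric])
      finally show "(LINT x|M. 2 ^ n * h n x) \<le> (1/2)^n" .
    qed
    finally show "(\<integral>\<^sup>+x. ennreal (2 ^ n * h n x) \<partial>M) \<le> ennreal ((1/2)^n)" .
  qed auto
  also have "\<dots> < \<infinity>"
  proof -
    have "(\<Sum>n. ennreal ((1/2)^n)) = ennreal (\<Sum>n. (1/2)^n)"
      by (rule suminf_ennreal2) (auto intro: summable_geometric)
    then show ?thesis
      by simp
  qed
  finally have "AE x in M. (\<Sum>n. ennreal (2 ^ n * h n x)) \<noteq> \<infinity>"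
    using h(1) by (intro nn_integral_PInf_AE) (auto intro!: borel_measurable_suminf borel_measurable_integrable)
  then show ?thesis
  proof eventually_elim
    case (elim x)
    then show ?case
      using h(2) by (intro summable_suminf_not_top) auto
  qed
qed

text \<open>
  By the inequality of arithmetic and geometric means each increment \<open>d\<close> satisfies
  \<open>2 d \<le> 2^n d\<^sup>2 + 2^(-n)\<close>, so the increments are summable.
\<close>

lemma Cauchy_if_weighted_increments_summable:
  fixes f :: "nat \<Rightarrow> complex"
  assumes "summable (\<lambda>n. 2 ^ n * (norm (f (Suc n) - f n))\<^sup>2)"
  shows "convergent f"
proof -
  let ?a = "\<lambda>n. 2 ^ n * (norm (f (Suc n) - f n))\<^sup>2"
  have "norm (f (Suc n) - f n) \<le> (?a n + (1/2) ^ n) / 2" for n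
  proof -
    have "2 * (sqrt (2 ^ n) * norm (f (Suc n) - f n)) * sqrt ((1/2) ^ n)
        \<le> (sqrt (2 ^ n) * norm (f (Suc n) - f n))\<^sup>2 + (sqrt ((1/2) ^ n))\<^sup>2"
      by (rule sum_squares_bound)
    moreover have "sqrt (2 ^ n) * sqrt ((1/2) ^ n) = (1::real)"
      by (simp add: real_sqrt_mult[symmetric] power_mult_distrib[symmetric])
    then have "2 * (sqrt (2 ^ n) * norm (f (Suc n) - f n)) * sqrt ((1/2) ^ n) = 2 * norm (f (Suc n) - f n)"
      by (metis (no_types, opaque_lifting) mult.assoc mult.commute mult_1)
    ultimately show ?thesis
      by (simp add: power_mult_distrib)
  qed
  moreover have "summable (\<lambda>n. (?a n + (1/2) ^ n) / 2)"
    by (intro summable_divide summable_add assms summable_geometric) simp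
  ultimately have "summable (\<lambda>n. f (Suc n) - f n)"
    using summable_comparison_test'[of "\<lambda>n. (?a n + (1/2) ^ n) / 2" 0 "\<lambda>n. f (Suc n) - f n"] by blast
  then have "convergent (\<lambda>n. \<Sum>i<n. f (Suc i) - f i)"
    by (simp add: summable_iff_convergent)
  then have "convergent (\<lambda>n. f n - f 0)"
    by (simp add: sum_lessThan_telescope)
  then have "convergent (\<lambda>n. (f n - f 0) + f 0)"
    by (intro convergent_add convergent_const)
  then show ?thesis
    by simp
qed

text \<open>
  A subsequence with rapidly decaying increments converges almost everywhere; Fatou's lemma turns the
  pointwise limit into a limit of the whole sequence in the norm of \<open>L\<^sup>2\<close>.
\<close>

lemma Riesz_Fischer:
  fixes f :: "nat \<Rightarrow> 'a \<Rightarrow> complex"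
  assumes f: "\<And>n. square_integrable M (f n)"
    and cauchy: "\<And>e. 0 < e \<Longrightarrow> \<exists>N. \<forall>m\<ge>N. \<forall>n\<ge>N. (LINT x|M. (norm (f m x - f n x))\<^sup>2) < e"
  obtains g r where "square_integrable M g" "(\<lambda>n. LINT x|M. (norm (f n x - g x))\<^sup>2) \<longlonglongrightarrow> 0"
    "strict_mono (r :: nat \<Rightarrow> nat)" "AE x in M. (\<lambda>n. f (r n) x) \<longlonglongrightarrow> g x"
proof -
  have diff: "square_integrable M (\<lambda>x. f m x - f n x)" for m n
    using square_integrable_lincomb[OF f[of m] f[of n], of 1 "-1"] by simp
  obtain r where r: "strict_mono r"
    "\<And>n m. r n \<le> m \<Longrightarrow> (LINT x|M. (norm (f m x - f (r n) x))\<^sup>2) < (1/4)^n"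
    by (rule fast_Cauchy_subsequence[OF cauchy, where \<epsilon> = "\<lambda>n. (1/4)^n"]) auto
  have "AE x in M. summable (\<lambda>n. 2 ^ n * (norm (f (r (Suc n)) x - f (r n) x))\<^sup>2)"
    using diff r by (intro AE_summable_if_integrals_small)
      (auto simp: square_integrable_def strict_mono_less_eq intro: less_imp_le)
  then have ae: "AE x in M. convergent (\<lambda>n. f (r n) x)"
    by eventually_elim (rule Cauchy_if_weighted_increments_summable)
  define g where "g x = lim (\<lambda>n. f (r n) x)" for x
  have lim: "AE x in M. (\<lambda>n. f (r n) x) \<longlonglongrightarrow> g x"
    using ae by eventually_elim (simp add: g_def convergent_LIMSEQ_iff)
  have g: "g \<in> borel_measurable M"
    unfolding g_def using f by (intro borel_measurable_lim_metric) (auto simp: square_integrable_def)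
  have fatou: "integrable M (\<lambda>x. (norm (f n x - g x))\<^sup>2) \<and> (LINT x|M. (norm (f n x - g x))\<^sup>2) \<le> e"
    if e: "0 \<le> e" "\<And>k. k \<ge> N \<Longrightarrow> (LINT x|M. (norm (f n x - f (r k) x))\<^sup>2) \<le> e" for n N e
  proof -
    have meas: "(\<lambda>x. (norm (f n x - g x))\<^sup>2) \<in> borel_measurable M"
      using f[of n] g by (intro borel_measurable_power borel_measurable_norm borel_measurable_diff)
        (auto simp: square_integrable_def)
    have "(\<integral>\<^sup>+x. ennreal ((norm (f n x - g x))\<^sup>2) \<partial>M)
        \<le> (\<integral>\<^sup>+x. liminf (\<lambda>k. ennreal ((norm (f n x - f (r k) x))\<^sup>2)) \<partial>M)"
    proof (rule nn_integral_mono_AE)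
      show "AE x in M. ennreal ((norm (f n x - g x))\<^sup>2) \<le> liminf (\<lambda>k. ennreal ((norm (f n x - f (r k) x))\<^sup>2))"
        using lim
      proof eventually_elim
        case (elim x)
        then have "(\<lambda>k. ennreal ((norm (f n x - f (r k) x))\<^sup>2)) \<longlonglongrightarrow> ennreal ((norm (f n x - g x))\<^sup>2)"
          by (intro tendsto_intros tendsto_ennrealI)
        then show ?case
          by (subst lim_imp_Liminf) auto
      qed
    qed
    also have "\<dots> \<le> liminf (\<lambda>k. \<integral>\<^sup>+x. ennreal ((norm (f n x - f (r k) x))\<^sup>2) \<partial>M)"
      using diff by (intro nn_integral_liminf) (auto simp: square_integrable_def)
    also have "\<dots> \<le> ennreal e"
    proof (rule Liminf_le)
      have "(\<integral>\<^sup>+x. ennreal ((norm (f n x - f (r k) x))\<^sup>2) \<partial>M) \<le> ennreal e" if "N \<le> k" for k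
        using diff[of n "r k"] e(2)[OF that]
        by (subst nn_integral_eq_integral) (auto simp: square_integrable_def intro: ennreal_leI)
      then show "\<forall>\<^sub>F k in sequentially. (\<integral>\<^sup>+x. ennreal ((norm (f n x - f (r k) x))\<^sup>2) \<partial>M) \<le> ennreal e"
        unfolding eventually_sequentially by blast
    qed simp
    finally have le: "(\<integral>\<^sup>+x. ennreal ((norm (f n x - g x))\<^sup>2) \<partial>M) \<le> ennreal e" .
    have int: "integrable M (\<lambda>x. (norm (f n x - g x))\<^sup>2)"
      using meas le by (intro integrableI_bounded) (auto simp: less_top[symmetric] top_unique)
    then have "ennreal (LINT x|M. (norm (f n x - g x))\<^sup>2) \<le> ennreal e"
      using le by (subst nn_integral_eq_integral[symmetric]) auto
    then show ?thesis
      using int e(1) by (simp add: ennreal_le_iff)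
  qed
  have step: "\<exists>N. \<forall>n\<ge>N. integrable M (\<lambda>x. (norm (f n x - g x))\<^sup>2) \<and> (LINT x|M. (norm (f n x - g x))\<^sup>2) < e"
    if e: "0 < e" for e
  proof -
    obtain N where N: "\<And>m n. N \<le> m \<Longrightarrow> N \<le> n \<Longrightarrow> (LINT x|M. (norm (f m x - f n x))\<^sup>2) < e / 2"
      using cauchy[of "e/2"] half_gt_zero[OF e] by blast
    have "N \<le> r k" if "N \<le> k" for k
      using seq_suble[OF r(1), of k] that by simp
    then have "integrable M (\<lambda>x. (norm (f n x - g x))\<^sup>2) \<and> (LINT x|M. (norm (f n x - g x))\<^sup>2) \<le> e / 2"
      if "N \<le> n" for n
      using fatou[of "e/2" N n] N that e by (auto intro: less_imp_le)
    then show ?thesis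
      using e by (intro exI[of _ N]) fastforce
  qed
  have "(\<lambda>n. LINT x|M. (norm (f n x - g x))\<^sup>2) \<longlonglongrightarrow> 0"
    unfolding LIMSEQ_iff using step by (fastforce simp: abs_of_nonneg)
  moreover obtain n where "integrable M (\<lambda>x. (norm (f n x - g x))\<^sup>2)"
    using step[of 1] by auto
  then have "square_integrable M (\<lambda>x. f n x - g x)"
    using f[of n] g by (auto simp: square_integrable_def intro!: borel_measurable_diff)
  then have "square_integrable M g"
    using square_integrable_lincomb[OF f[of n], of "\<lambda>x. f n x - g x" 1 "-1"] by simp
  ultimately show ?thesis
    using that r(1) lim by blast
qed

lemma pairing_lincomb:
  assumes "square_integrable N f" "square_integrable N g" "square_integrable N h"
  shows "(LINT x|N. (a * f x + b * g x) * cnj (h x)) = a * (LINT x|N. f x * cnj (h x)) + b * (LINT x|N. g x * cnj (h x))"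
proof -
  have "(LINT x|N. (a * f x + b * g x) * cnj (h x)) = (LINT x|N. a * (f x * cnj (h x)) + b * (g x * cnj (h x)))"
    by (rule Bochner_Integration.integral_cong) (auto simp: algebra_simps)
  then show ?thesis
    using integrable_mult_cnj[OF assms(1,3)] integrable_mult_cnj[OF assms(2,3)] by simp
qed

lemma pairing_commute:
  "(LINT x|N. g x * cnj (f x)) = cnj (LINT x|N. f x * cnj (g x))"
proof -
  have "(LINT x|N. g x * cnj (f x)) = (LINT x|N. cnj (f x * cnj (g x)))"
    by (rule Bochner_Integration.integral_cong) (auto simp: mult.commute)
  then show ?thesis
    by (simp only: Bochner_Integration.integral_cnj)
qed

lemma pairing_self:
  "(LINT x|N. f x * cnj (f x)) = complex_of_real (LINT x|N. (norm (f x))\<^sup>2)"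
proof -
  have "(LINT x|N. f x * cnj (f x)) = (LINT x|N. complex_of_real ((norm (f x))\<^sup>2))"
    by (rule Bochner_Integration.integral_cong) (auto simp: complex_norm_square[symmetric])
  then show ?thesis
    by (simp only: integral_complex_of_real)
qed

lemma pairing_cong_AE:
  assumes "square_integrable N f" "square_integrable N f'" "square_integrable N g" "AE x in N. f x = f' x"
  shows "(LINT x|N. f x * cnj (g x)) = (LINT x|N. f' x * cnj (g x))"
proof (rule integral_cong_AE)
  show "(\<lambda>x. f x * cnj (g x)) \<in> borel_measurable N" "(\<lambda>x. f' x * cnj (g x)) \<in> borel_measurable N"
    using integrable_mult_cnj assms borel_measurable_integrable by blast+
  show "AE x in N. f x * cnj (g x) = f' x * cnj (g x)"
    using assms(4) by eventually_elim simp
qed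

section \<open>Square-integrable functions on subintervals\<close>

lemma square_integrable_subset:
  fixes f :: "real \<Rightarrow> complex"
  assumes f: "square_integrable (lebesgue_on S) f" and S: "S \<in> sets lebesgue" "T \<in> sets lebesgue" "T \<subseteq> S"
  shows "square_integrable (lebesgue_on T) f"
    and "(LINT x|lebesgue_on T. (norm (f x))\<^sup>2) \<le> (LINT x|lebesgue_on S. (norm (f x))\<^sup>2)"
proof -
  have i: "set_integrable lebesgue S (\<lambda>x. (norm (f x))\<^sup>2)"
    using f S by (simp add: square_integrable_def set_integrable_iff_lebesgue_on)
  then have iT: "set_integrable lebesgue T (\<lambda>x. (norm (f x))\<^sup>2)"
    using S by (auto intro: set_integrable_subset)
  have "set_borel_measurable lebesgue S f"
    using f S by (simp add: square_integrable_def set_borel_measurable_def borel_measurable_restrict_space_iff)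
  then have "set_borel_measurable lebesgue T f"
    using S by (rule_tac set_borel_measurable_subset)
  then show "square_integrable (lebesgue_on T) f"
    using iT S square_integrable_on_iff unfolding square_integrable_on_def by blast
  show "(LINT x|lebesgue_on T. (norm (f x))\<^sup>2) \<le> (LINT x|lebesgue_on S. (norm (f x))\<^sup>2)"
    using i iT S(3) unfolding set_lebesgue_integral_eq_lebesgue_on[symmetric, OF S(1)] set_lebesgue_integral_eq_lebesgue_on[symmetric, OF S(2)]
    unfolding set_lebesgue_integral_def set_integrable_def by (intro integral_mono) (auto simp: indicator_def)
qed

lemma integral_norm_interval:
  fixes f :: "real \<Rightarrow> complex"
  assumes f: "square_integrable (lebesgue_on {x..y}) f" and "x \<le> y"
  shows "integrable (lebesgue_on {x..y}) (\<lambda>t. norm (f t))"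
    and "(LINT t|lebesgue_on {x..y}. norm (f t))\<^sup>2 \<le> (y - x) * (LINT t|lebesgue_on {x..y}. (norm (f t))\<^sup>2)"
proof -
  have fin: "finite_measure (lebesgue_on {x..y})"
    by (simp add: finite_measure_lebesgue_on)
  have one: "square_integrable (lebesgue_on {x..y}) (\<lambda>_. 1)"
    using finite_measure.integrable_const[OF fin] by (simp add: square_integrable_def)
  show "integrable (lebesgue_on {x..y}) (\<lambda>t. norm (f t))"
    using integrable_norm_mult[OF f one] by simp
  have "(LINT t|lebesgue_on {x..y}. (norm (1::complex))\<^sup>2) = y - x"
    using \<open>x \<le> y\<close> by (simp add: measure_restrict_space)
  then show "(LINT t|lebesgue_on {x..y}. norm (f t))\<^sup>2 \<le> (y - x) * (LINT t|lebesgue_on {x..y}. (norm (f t))\<^sup>2)"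
    using integral_norm_mult_le[OF f one] by (simp add: mult.commute)
qed

lemma integrable_interval_if_square:
  fixes f :: "real \<Rightarrow> complex"
  assumes f: "square_integrable (lebesgue_on {x..y}) f" and "x \<le> y"
  shows "integrable (lebesgue_on {x..y}) f"
proof -
  have "f \<in> borel_measurable (lebesgue_on {x..y})"
    using f by (simp add: square_integrable_def)
  from integrable_norm_iff[OF this] show ?thesis
    using integral_norm_interval(1)[OF assms] by simp
qed

section \<open>Hermitian forms\<close>

lemma eventually_reciprocal_less:
  assumes e: "0 < e"
  shows "\<exists>N. \<forall>n\<ge>N. 1 / (real n + 1) < e"
proof -
  obtain N where "1 / (real N + 1) < e"
    using reals_Archimedean[OF e] by (auto simp: inverse_eq_divide add.commute)
  moreover have "1 / (real n + 1) \<le> 1 / (real N + 1)" if "N \<le> n" for n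
    using that by (intro divide_left_mono) auto
  ultimately show ?thesis
    using order_le_less_trans by blast
qed

definition lincomb :: "complex \<Rightarrow> ('e \<Rightarrow> real \<Rightarrow> complex) \<Rightarrow> complex \<Rightarrow> ('e \<Rightarrow> real \<Rightarrow> complex) \<Rightarrow> 'e \<Rightarrow> real \<Rightarrow> complex" where
  "lincomb a u b v = (\<lambda>e x. a * u e x + b * v e x)"

locale hermitian_form =
  fixes X :: "('e \<Rightarrow> real \<Rightarrow> complex) set"
    and B :: "('e \<Rightarrow> real \<Rightarrow> complex) \<Rightarrow> ('e \<Rightarrow> real \<Rightarrow> complex) \<Rightarrow> complex"
  assumes lincomb_closed: "\<And>a b u v. u \<in> X \<Longrightarrow> v \<in> X \<Longrightarrow> lincomb a u b v \<in> X"
    and linear: "\<And>a b u v w. u \<in> X \<Longrightarrow> v \<in> X \<Longrightarrow> w \<in> X \<Longrightarrow> B (lincomb a u b v) w = a * B u w + b * B v w"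
    and hermitian: "\<And>u v. u \<in> X \<Longrightarrow> v \<in> X \<Longrightarrow> B v u = cnj (B u v)"
    and nonneg: "\<And>u. u \<in> X \<Longrightarrow> 0 \<le> Re (B u u)"
begin

lemma antilinear:
  assumes "u \<in> X" "v \<in> X" "w \<in> X"
  shows "B w (lincomb a u b v) = cnj a * B w u + cnj b * B w v"
proof -
  have "B w (lincomb a u b v) = cnj (B (lincomb a u b v) w)"
    using assms lincomb_closed by (intro hermitian) auto
  also have "\<dots> = cnj a * cnj (B u w) + cnj b * cnj (B v w)"
    using assms by (simp add: linear)
  finally show ?thesis
    using assms by (simp add: hermitian[of _ w])
qed

lemma expand:
  assumes "u \<in> X" "v \<in> X"
  shows "Re (B (lincomb a u b v) (lincomb a u b v))
    = (norm a)\<^sup>2 * Re (B u u) + 2 * Re (a * cnj b * B u v) + (norm b)\<^sup>2 * Re (B v v)"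
proof -
  have "B (lincomb a u b v) (lincomb a u b v)
      = (a * cnj a) * B u u + (a * cnj b * B u v + cnj (a * cnj b * B u v)) + (b * cnj b) * B v v"
    using assms by (simp add: linear antilinear lincomb_closed hermitian[of u v] algebra_simps)
  moreover have "a * cnj a = of_real ((norm a)\<^sup>2)" "b * cnj b = of_real ((norm b)\<^sup>2)"
    by (simp_all add: complex_norm_square[symmetric])
  ultimately have "B (lincomb a u b v) (lincomb a u b v)
      = of_real ((norm a)\<^sup>2) * B u u + (a * cnj b * B u v + cnj (a * cnj b * B u v)) + of_real ((norm b)\<^sup>2) * B v v"
    by (simp only:)
  then show ?thesis
    by (simp only: complex_add_cnj plus_complex.sel Re_complex_of_real)
      (simp flip: of_real_power)
qed

text \<open>
  Along real combinations the diagonal is a quadratic polynomial. Both the parallelogram law and the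
  first variations below are read off from this.
\<close>

lemma expand_real:
  assumes "u \<in> X" "v \<in> X"
  shows "Re (B (lincomb (of_real a) u (of_real b) v) (lincomb (of_real a) u (of_real b) v))
    = a\<^sup>2 * Re (B u u) + 2 * a * b * Re (B u v) + b\<^sup>2 * Re (B v v)"
  using expand[OF assms, of "of_real a" "of_real b"]
  by (simp flip: of_real_mult)

lemma Cauchy_Schwarz_Re:
  assumes "u \<in> X" "v \<in> X"
  shows "(Re (B u v))\<^sup>2 \<le> Re (B u u) * Re (B v v)"
proof (rule quadratic_nonneg_imp_discriminant)
  fix s :: real
  show "0 \<le> Re (B u u) + 2 * s * Re (B u v) + s\<^sup>2 * Re (B v v)"
    using expand_real[OF assms, of 1 s] nonneg[OF lincomb_closed[OF assms], of "of_real 1" "of_real s"]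
    by (simp only: power_one mult_1 mult_1_right)
qed

lemma Cauchy_Schwarz:
  assumes "u \<in> X" "v \<in> X"
  shows "(norm (B u v))\<^sup>2 \<le> Re (B u u) * Re (B v v)"
proof -
  \<comment> \<open>A phase that makes \<open>B u v\<close> real reduces the claim to the real case.\<close>
  define a where "a = cnj (sgn (B u v))"
  have a: "a * B u v = of_real (norm (B u v))" "norm a \<le> 1"
  proof -
    show "a * B u v = of_real (norm (B u v))"
    proof (cases "B u v = 0")
      case False
      have "a * B u v = (B u v * cnj (B u v)) / of_real (norm (B u v))"
        by (simp add: a_def sgn_div_norm scaleR_conv_of_real field_simps)
      then show ?thesis
        using False by (simp add: complex_norm_square[symmetric] power2_eq_square)
    qed (simp add: a_def)
    show "norm a \<le> 1"
      by (simp add: a_def norm_sgn)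
  qed
  let ?w = "lincomb a u 0 u"
  have "Re (B ?w v) = norm (B u v)"
    using assms a by (simp add: linear)
  moreover have "Re (B ?w ?w) = (norm a)\<^sup>2 * Re (B u u)"
    using expand[of u u a 0] assms by simp
  moreover have "(norm a)\<^sup>2 * Re (B u u) \<le> 1 * Re (B u u)"
    using a(2) nonneg assms by (intro mult_right_mono power_le_one) auto
  moreover have "(norm a)\<^sup>2 * Re (B u u) * Re (B v v) \<le> Re (B u u) * Re (B v v)"
    using calculation(3) nonneg[OF assms(2)] by (intro mult_right_mono) auto
  ultimately show ?thesis
    using Cauchy_Schwarz_Re[of ?w v] assms lincomb_closed by force
qed

text \<open>
  The Riesz representation theorem without completeness. Minimize \<open>J(u) = B(u,u) - 2 Re l(u)\<close>. By the
  parallelogram law a minimizing sequence is Cauchy, and along it the first variation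
  \<open>B(U\<^sub>n,v) - l(v)\<close> of \<open>J\<close> tends to zero in every direction. Whatever completion is at hand then
  provides the representing element.
\<close>

lemma minimizing_sequence:
  assumes "u0 \<in> X"
    and anti: "\<And>a b u v. u \<in> X \<Longrightarrow> v \<in> X \<Longrightarrow> l (lincomb a u b v) = cnj a * l u + cnj b * l v"
    and bounded: "0 \<le> C" "\<And>u. u \<in> X \<Longrightarrow> (norm (l u :: complex))\<^sup>2 \<le> C * Re (B u u)"
  obtains U :: "nat \<Rightarrow> 'e \<Rightarrow> real \<Rightarrow> complex" where "\<And>n. U n \<in> X"
    "\<And>e. 0 < e \<Longrightarrow> \<exists>N. \<forall>m\<ge>N. \<forall>n\<ge>N. Re (B (lincomb 1 (U m) (-1) (U n)) (lincomb 1 (U m) (-1) (U n))) < e"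
    "\<And>v. v \<in> X \<Longrightarrow> (\<lambda>n. B (U n) v) \<longlonglongrightarrow> l v"
proof -
  define J where "J u = Re (B u u) - 2 * Re (l u)" for u
  have J_ge: "- C \<le> J u" if "u \<in> X" for u
  proof -
    let ?q = "Re (B u u)"
    have "(2 * Re (l u))\<^sup>2 \<le> 4 * (norm (l u))\<^sup>2"
      using abs_Re_le_cmod[of "l u"] by (simp add: abs_le_square_iff[symmetric] power_mult_distrib)
    also have "\<dots> \<le> 4 * (C * ?q)"
      using bounded(2)[OF that] by simp
    also have "\<dots> \<le> (?q + C)\<^sup>2"
      using sum_squares_bound[of ?q C] by (simp add: power2_sum algebra_simps)
    finally have "2 * Re (l u) \<le> ?q + C"
      by (rule power2_le_imp_le) (use nonneg[OF that] bounded(1) in simp)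
    then show ?thesis
      by (simp add: J_def)
  qed
  define I where "I = Inf (J ` X)"
  have bdd: "bdd_below (J ` X)"
    using J_ge by (intro bdd_belowI2) auto
  have I_le: "I \<le> J u" if "u \<in> X" for u
    unfolding I_def by (rule cInf_lower) (use that bdd in auto)
  have "\<exists>u\<in>X. J u < I + 1 / (real n + 1)" for n
  proof -
    have "Inf (J ` X) < I + 1 / (real n + 1)"
      by (simp add: I_def)
    then show ?thesis
      using cInf_lessD[of "J ` X"] assms(1) by auto
  qed
  then obtain U where U: "\<And>n. U n \<in> X" "\<And>n. J (U n) < I + 1 / (real n + 1)"
    by metis
  have l_re: "Re (l (lincomb (of_real a) u (of_real b) v)) = a * Re (l u) + b * Re (l v)" if "u \<in> X" "v \<in> X" for a b u v
    using anti[OF that, of "of_real a" "of_real b"] by simp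
  have mid: "Re (B (lincomb 1 u (-1) v) (lincomb 1 u (-1) v)) \<le> 2 * (J u - I) + 2 * (J v - I)"
    if "u \<in> X" "v \<in> X" for u v
  proof -
    have "I \<le> J (lincomb (of_real (1/2)) u (of_real (1/2)) v)"
      using that lincomb_closed by (intro I_le) auto
    also have "\<dots> = (1/2)\<^sup>2 * Re (B u u) + 2 * (1/2) * (1/2) * Re (B u v) + (1/2)\<^sup>2 * Re (B v v)
        - 2 * (1/2 * Re (l u) + 1/2 * Re (l v))"
      unfolding J_def expand_real[OF that] l_re[OF that] ..
    finally show ?thesis
      using expand_real[OF that, of 1 "-1"] by (simp add: J_def power2_eq_square)
  qed
  have conv_re: "(\<lambda>n. Re (B (U n) v - l v)) \<longlonglongrightarrow> 0" if v: "v \<in> X" for v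
  proof -
    have sq: "(Re (B (U n) v - l v))\<^sup>2 \<le> 1 / (real n + 1) * Re (B v v)" for n
    proof -
      have "(Re (B (U n) v - l v))\<^sup>2 \<le> (J (U n) - I) * Re (B v v)"
      proof (rule quadratic_nonneg_imp_discriminant)
        fix s :: real
        have "I \<le> J (lincomb (of_real 1) (U n) (of_real s) v)"
          using v U lincomb_closed by (intro I_le) auto
        then show "0 \<le> J (U n) - I + 2 * s * Re (B (U n) v - l v) + s\<^sup>2 * Re (B v v)"
          unfolding J_def expand_real[OF U(1) v] l_re[OF U(1) v] by (simp add: algebra_simps)
      qed
      also have "\<dots> \<le> 1 / (real n + 1) * Re (B v v)"
        using U(2)[of n] nonneg[OF v] by (intro mult_right_mono) auto
      finally show ?thesis .
    qed
    have "(\<lambda>n. (Re (B (U n) v - l v))\<^sup>2) \<longlonglongrightarrow> 0"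
    proof (rule Lim_null_comparison)
      show "\<forall>\<^sub>F n in sequentially. norm ((Re (B (U n) v - l v))\<^sup>2) \<le> 1 / (real n + 1) * Re (B v v)"
        using sq by simp
      have "(\<lambda>n. 1 / (real n + 1)) \<longlonglongrightarrow> 0"
        using LIMSEQ_inverse_real_of_nat by (simp add: inverse_eq_divide add.commute)
      then show "(\<lambda>n. 1 / (real n + 1) * Re (B v v)) \<longlonglongrightarrow> 0"
        by (rule tendsto_mult_left_zero)
    qed
    then have "(\<lambda>n. sqrt ((Re (B (U n) v - l v))\<^sup>2)) \<longlonglongrightarrow> sqrt 0"
      by (rule tendsto_real_sqrt)
    then show ?thesis
      by (simp only: real_sqrt_abs real_sqrt_zero tendsto_rabs_zero_iff)
  qed
  have conv: "(\<lambda>n. B (U n) v) \<longlonglongrightarrow> l v" if v: "v \<in> X" for v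
  proof -
    \<comment> \<open>The imaginary part in direction \<open>v\<close> is the real part in direction \<open>i v\<close>.\<close>
    let ?iv = "lincomb \<i> v 0 v"
    have iv: "?iv \<in> X"
      using v lincomb_closed by blast
    have "B (U n) ?iv - l ?iv = - \<i> * (B (U n) v - l v)" for n
      using v U by (simp add: antilinear anti algebra_simps)
    then have "Re (B (U n) ?iv - l ?iv) = Im (B (U n) v - l v)" for n
      by simp
    then have "(\<lambda>n. Im (B (U n) v - l v)) \<longlonglongrightarrow> 0"
      using conv_re[OF iv] by simp
    then have "(\<lambda>n. B (U n) v - l v) \<longlonglongrightarrow> 0"
      using conv_re[OF v] by (simp add: tendsto_complex_iff)
    then show ?thesis
      by (simp add: LIM_zero_iff)
  qed
  show ?thesis
  proof (rule that[OF U(1) _ conv])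
    fix e :: real assume "0 < e"
    then obtain N where N: "\<And>n. N \<le> n \<Longrightarrow> 1 / (real n + 1) < e / 4"
      using eventually_reciprocal_less[of "e/4"] by auto
    have "Re (B (lincomb 1 (U m) (-1) (U n)) (lincomb 1 (U m) (-1) (U n))) < e" if "N \<le> m" "N \<le> n" for m n
    proof -
      have "J (U m) - I < e / 4" "J (U n) - I < e / 4"
        using U(2)[of m] U(2)[of n] N[OF that(1)] N[OF that(2)] by simp_all
      then show ?thesis
        using mid[OF U(1) U(1), of m n] by simp
    qed
    then show "\<exists>N. \<forall>m\<ge>N. \<forall>n\<ge>N. Re (B (lincomb 1 (U m) (-1) (U n)) (lincomb 1 (U m) (-1) (U n))) < e"
      by blast
  qed auto
qed

lemma tendsto_form:
  assumes U: "\<And>n. U n \<in> X" and u: "u \<in> X" and v: "v \<in> X"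
    and lim: "(\<lambda>n. Re (B (lincomb 1 (U n) (-1) u) (lincomb 1 (U n) (-1) u))) \<longlonglongrightarrow> 0"
  shows "(\<lambda>n. B (U n) v) \<longlonglongrightarrow> B u v"
proof (rule LIM_zero_cancel)
  let ?w = "\<lambda>n. lincomb 1 (U n) (-1) u"
  have w: "?w n \<in> X" for n
    by (rule lincomb_closed[OF U u])
  have "B (U n) v - B u v = B (?w n) v" for n
    by (simp add: linear[OF U u v])
  moreover have "(\<lambda>n. B (?w n) v) \<longlonglongrightarrow> 0"
  proof -
    have "(\<lambda>n. (norm (B (?w n) v))\<^sup>2) \<longlonglongrightarrow> 0"
    proof (rule Lim_null_comparison[OF always_eventually], rule allI)
      show "norm ((norm (B (?w n) v))\<^sup>2) \<le> Re (B (?w n) (?w n)) * Re (B v v)" for n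
        using Cauchy_Schwarz[OF w v] by simp
      show "(\<lambda>n. Re (B (?w n) (?w n)) * Re (B v v)) \<longlonglongrightarrow> 0"
        using tendsto_mult_left_zero[OF lim] .
    qed
    then have "(\<lambda>n. sqrt ((norm (B (?w n) v))\<^sup>2)) \<longlonglongrightarrow> sqrt 0"
      by (rule tendsto_real_sqrt)
    then show ?thesis
      by (simp add: tendsto_norm_zero_iff)
  qed
  ultimately show "(\<lambda>n. B (U n) v - B u v) \<longlonglongrightarrow> 0"
    by simp
qed

lemma tendsto_form_diag:
  assumes U: "\<And>n. U n \<in> X" and u: "u \<in> X"
    and lim: "(\<lambda>n. Re (B (lincomb 1 (U n) (-1) u) (lincomb 1 (U n) (-1) u))) \<longlonglongrightarrow> 0"
  shows "(\<lambda>n. Re (B (U n) (U n))) \<longlonglongrightarrow> Re (B u u)"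
proof -
  have eq: "Re (B (U n) (U n)) = Re (B (lincomb 1 (U n) (-1) u) (lincomb 1 (U n) (-1) u)) + 2 * Re (B (U n) u) - Re (B u u)" for n
    using expand_real[OF U[of n] u, of 1 "-1"] by simp
  have "(\<lambda>n. Re (B (lincomb 1 (U n) (-1) u) (lincomb 1 (U n) (-1) u)) + 2 * Re (B (U n) u) - Re (B u u))
    \<longlonglongrightarrow> 0 + 2 * Re (B u u) - Re (B u u)"
    by (intro tendsto_intros lim tendsto_form U u)
  then show ?thesis
    unfolding eq by simp
qed

end

section \<open>Algebra of weak derivatives\<close>

lemma test_function_cutoff:
  assumes "test_function U \<phi>"
  shows "\<exists>K. compact K \<and> K \<subseteq> U \<and> (\<forall>x. x \<notin> K \<longrightarrow> \<phi> x = 0) \<and> (\<forall>x. x \<notin> K \<longrightarrow> deriv \<phi> x = 0)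
    \<and> continuous_on UNIV \<phi> \<and> continuous_on UNIV (deriv \<phi>)"
proof -
  define K where "K = closure {x. \<phi> x \<noteq> 0}"
  have closed: "closed K"
    by (simp add: K_def)
  have zero: "\<phi> x = 0" if "x \<notin> K" for x
    using that closure_subset[of "{x. \<phi> x \<noteq> 0}"] unfolding K_def by auto
  have dzero: "deriv \<phi> x = 0" if x: "x \<notin> K" for x
  proof -
    have "((\<lambda>_. 0) has_real_derivative 0) (at x)"
      by simp
    then have "(\<phi> has_real_derivative 0) (at x)"
      by (rule has_field_derivative_transform_within_open[where S = "- K"]) (use x zero in \<open>auto simp: open_Compl closed\<close>)
    then show ?thesis
      by (rule DERIV_imp_deriv)
  qed
  have "(deriv ^^ n) \<phi> differentiable (at x)" for n x
    using assms by (simp add: test_function_def)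
  from this[of 0] this[of 1] have cont: "continuous_on UNIV \<phi>" "continuous_on UNIV (deriv \<phi>)"
    by (auto intro!: continuous_at_imp_continuous_on differentiable_imp_continuous_within)
  have "compact K" "K \<subseteq> U"
    using assms by (simp_all add: test_function_def K_def)
  with zero dzero cont show ?thesis
    by (intro exI[of _ K] conjI allI impI)
qed

text \<open>
  Weak derivatives are only locally integrable, so every integral against a test function is reduced
  to a compact set that carries the test function.
\<close>

lemma cutoff_integrable:
  fixes \<psi> :: "real \<Rightarrow> real" and w :: "real \<Rightarrow> complex"
  assumes K: "compact K" "K \<subseteq> interior S" and \<psi>: "continuous_on UNIV \<psi>" "\<And>x. x \<notin> K \<Longrightarrow> \<psi> x = 0"
    and w: "set_integrable lebesgue K w"
  shows "set_integrable lebesgue S (\<lambda>x. \<psi> x *\<^sub>R w x)"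
    and "norm (LINT x:S|lebesgue. \<psi> x *\<^sub>R w x) \<le> Sup (insert 0 ((\<lambda>x. \<bar>\<psi> x\<bar>) ` K)) * (LINT x:K|lebesgue. norm (w x))"
proof -
  let ?B = "Sup (insert 0 ((\<lambda>x. \<bar>\<psi> x\<bar>) ` K))"
  have "compact ((\<lambda>x. \<bar>\<psi> x\<bar>) ` K)"
    by (intro compact_continuous_image continuous_intros continuous_on_subset[OF \<psi>(1)] K) auto
  then have bdd: "bdd_above (insert 0 ((\<lambda>x. \<bar>\<psi> x\<bar>) ` K))"
    by (simp add: bounded_imp_bdd_above compact_imp_bounded)
  have B: "\<bar>\<psi> x\<bar> \<le> ?B" for x
    using bdd \<psi>(2) by (cases "x \<in> K") (auto intro: cSup_upper)
  have wK: "integrable lebesgue (\<lambda>x. indicator K x *\<^sub>R w x)"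
    using w by (simp add: set_integrable_def)
  have eq: "indicator S x *\<^sub>R (\<psi> x *\<^sub>R w x) = \<psi> x *\<^sub>R (indicator K x *\<^sub>R w x)" for x
  proof (cases "x \<in> K")
    case True
    then have "x \<in> S"
      using K(2) interior_subset by blast
    with True show ?thesis
      by simp
  qed (simp add: \<psi>(2))
  have bound: "norm (\<psi> x *\<^sub>R (indicator K x *\<^sub>R w x)) \<le> ?B * norm (indicator K x *\<^sub>R w x)" for x
    unfolding norm_scaleR[of "\<psi> x"] by (rule mult_right_mono[OF B norm_ge_zero])
  have meas: "\<psi> \<in> borel_measurable lebesgue"
    using borel_measurable_continuous_onI[OF \<psi>(1)] by (simp add: measurable_completion)
  have int: "integrable lebesgue (\<lambda>x. \<psi> x *\<^sub>R (indicator K x *\<^sub>R w x))"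
  proof (rule Bochner_Integration.integrable_bound)
    show "integrable lebesgue (\<lambda>x. ?B * norm (indicator K x *\<^sub>R w x))"
      using integrable_norm[OF wK] by (rule integrable_mult_right)
    show "(\<lambda>x. \<psi> x *\<^sub>R (indicator K x *\<^sub>R w x)) \<in> borel_measurable lebesgue"
      by (rule borel_measurable_scaleR[OF meas borel_measurable_integrable[OF wK]])
    show "AE x in lebesgue. norm (\<psi> x *\<^sub>R (indicator K x *\<^sub>R w x)) \<le> norm (?B * norm (indicator K x *\<^sub>R w x))"
      by (intro AE_I2) (metis abs_ge_self bound order_trans real_norm_def)
  qed
  then show "set_integrable lebesgue S (\<lambda>x. \<psi> x *\<^sub>R w x)"
    unfolding set_integrable_def eq .
  have "norm (LINT x:S|lebesgue. \<psi> x *\<^sub>R w x) \<le> (LINT x|lebesgue. norm (\<psi> x *\<^sub>R (indicator K x *\<^sub>R w x)))"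
    unfolding set_lebesgue_integral_def eq by (rule integral_norm_bound)
  also have "\<dots> \<le> (LINT x|lebesgue. ?B * norm (indicator K x *\<^sub>R w x))"
    by (rule integral_mono[OF integrable_norm[OF int] integrable_mult_right[OF integrable_norm[OF wK]] bound])
  also have "\<dots> = ?B * (LINT x:K|lebesgue. norm (w x))"
    by (simp add: set_lebesgue_integral_def)
  finally show "norm (LINT x:S|lebesgue. \<psi> x *\<^sub>R w x) \<le> ?B * (LINT x:K|lebesgue. norm (w x))" .
qed

lemma has_weak_deriv_lincomb:
  assumes u: "has_weak_deriv S u w" and v: "has_weak_deriv S v z"
  shows "has_weak_deriv S (\<lambda>x. a * u x + b * v x) (\<lambda>x. a * w x + b * z x)"
  unfolding has_weak_deriv_def
proof (intro conjI allI impI)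
  fix C assume "compact C \<and> C \<subseteq> interior S"
  then show "set_integrable lebesgue C (\<lambda>x. a * u x + b * v x)" "set_integrable lebesgue C (\<lambda>x. a * w x + b * z x)"
    using u v by (auto simp: has_weak_deriv_def intro!: set_integral_add)
next
  fix \<phi> assume \<phi>: "test_function (interior S) \<phi>"
  obtain K where "compact K \<and> K \<subseteq> interior S \<and> (\<forall>x. x \<notin> K \<longrightarrow> \<phi> x = 0) \<and> (\<forall>x. x \<notin> K \<longrightarrow> deriv \<phi> x = 0)
    \<and> continuous_on UNIV \<phi> \<and> continuous_on UNIV (deriv \<phi>)"
    using test_function_cutoff[OF \<phi>] by (rule exE)
  then have K: "compact K" "K \<subseteq> interior S" "\<And>x. x \<notin> K \<Longrightarrow> \<phi> x = 0" "\<And>x. x \<notin> K \<Longrightarrow> deriv \<phi> x = 0"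
    "continuous_on UNIV \<phi>" "continuous_on UNIV (deriv \<phi>)"
    by blast+
  have Ki: "set_integrable lebesgue K u" "set_integrable lebesgue K w" "set_integrable lebesgue K v" "set_integrable lebesgue K z"
    using u v K by (auto simp: has_weak_deriv_def)
  have lin: "(LINT x:S|lebesgue. \<psi> x *\<^sub>R (a * f x + b * g x))
      = a * (LINT x:S|lebesgue. \<psi> x *\<^sub>R f x) + b * (LINT x:S|lebesgue. \<psi> x *\<^sub>R g x)"
    if "set_integrable lebesgue S (\<lambda>x. \<psi> x *\<^sub>R f x)" "set_integrable lebesgue S (\<lambda>x. \<psi> x *\<^sub>R g x)"
    for \<psi> :: "real \<Rightarrow> real" and f g :: "real \<Rightarrow> complex"
  proof -
    have "(LINT x:S|lebesgue. \<psi> x *\<^sub>R (a * f x + b * g x))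
        = (LINT x:S|lebesgue. a * (\<psi> x *\<^sub>R f x) + b * (\<psi> x *\<^sub>R g x))"
      unfolding set_lebesgue_integral_def
      by (intro Bochner_Integration.integral_cong refl) (simp add: scaleR_conv_of_real algebra_simps)
    also have "\<dots> = a * (LINT x:S|lebesgue. \<psi> x *\<^sub>R f x) + b * (LINT x:S|lebesgue. \<psi> x *\<^sub>R g x)"
      by (simp only: set_integral_add(2)[OF set_integrable_mult_right[OF that(1)] set_integrable_mult_right[OF that(2)]]
          set_integral_mult_right)
    finally show ?thesis .
  qed
  have "(LINT x:S|lebesgue. deriv \<phi> x *\<^sub>R (a * u x + b * v x))
      = a * (LINT x:S|lebesgue. deriv \<phi> x *\<^sub>R u x) + b * (LINT x:S|lebesgue. deriv \<phi> x *\<^sub>R v x)"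
    by (intro lin cutoff_integrable(1)[OF K(1,2,6,4)] Ki)
  also have "\<dots> = - (a * (LINT x:S|lebesgue. \<phi> x *\<^sub>R w x) + b * (LINT x:S|lebesgue. \<phi> x *\<^sub>R z x))"
    using u v \<phi> by (simp add: has_weak_deriv_def)
  also have "\<dots> = - (LINT x:S|lebesgue. \<phi> x *\<^sub>R (a * w x + b * z x))"
    by (subst lin) (auto intro!: cutoff_integrable(1)[OF K(1,2,5,3)] Ki)
  finally show "(LINT x:S|lebesgue. deriv \<phi> x *\<^sub>R (a * u x + b * v x))
      = - (LINT x:S|lebesgue. \<phi> x *\<^sub>R (a * w x + b * z x))" .
qed

text \<open>
  By linearity, weak derivatives are unique up to null sets, which makes the unspecified choice in
  \<open>weak_deriv\<close> harmless under integrals.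
\<close>

lemma weak_deriv_of_zero:
  assumes w: "has_weak_deriv S u w" and u: "AE x in lebesgue. x \<in> S \<longrightarrow> u x = 0"
  shows "AE x in lebesgue. x \<in> interior S \<longrightarrow> w x = 0"
proof (rule fundamental_lemma)
  show "set_integrable lebesgue C w" if "compact C" "C \<subseteq> interior S" for C
    using w that by (auto simp: has_weak_deriv_def)
  fix \<phi> assume \<phi>: "test_function (interior S) \<phi>"
  have "(LINT x:S|lebesgue. deriv \<phi> x *\<^sub>R u x) = 0"
    unfolding set_lebesgue_integral_def
    by (rule integral_eq_zero_AE) (use u in \<open>eventually_elim, auto simp: indicator_def\<close>)
  then show "(LINT x:S|lebesgue. \<phi> x *\<^sub>R w x) = 0"
    using w \<phi> by (simp add: has_weak_deriv_def)
qed

lemma has_weak_deriv_unique: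
  assumes "has_weak_deriv S u w" "has_weak_deriv S u z"
  shows "AE x in lebesgue. x \<in> interior S \<longrightarrow> w x = z x"
  using weak_deriv_of_zero[OF has_weak_deriv_lincomb[OF assms, of 1 "-1"]] by simp

text \<open>
  The defining identity of a weak derivative passes to limits that are merely local in \<open>L\<^sup>1\<close>.
\<close>

lemma has_weak_deriv_limit:
  assumes n: "\<And>n. has_weak_deriv S (u n) (w n)"
    and int: "\<And>C. compact C \<Longrightarrow> C \<subseteq> interior S \<Longrightarrow> set_integrable lebesgue C u' \<and> set_integrable lebesgue C w'"
    and u: "\<And>C. compact C \<Longrightarrow> C \<subseteq> interior S \<Longrightarrow> (\<lambda>n. LINT x:C|lebesgue. norm (u n x - u' x)) \<longlonglongrightarrow> 0"
    and w: "\<And>C. compact C \<Longrightarrow> C \<subseteq> interior S \<Longrightarrow> (\<lambda>n. LINT x:C|lebesgue. norm (w n x - w' x)) \<longlonglongrightarrow> 0"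
  shows "has_weak_deriv S u' w'"
  unfolding has_weak_deriv_def
proof (intro conjI allI impI)
  fix C assume "compact C \<and> C \<subseteq> interior S"
  then show "set_integrable lebesgue C u'" "set_integrable lebesgue C w'"
    using int by auto
next
  fix \<phi> assume \<phi>: "test_function (interior S) \<phi>"
  obtain K where "compact K \<and> K \<subseteq> interior S \<and> (\<forall>x. x \<notin> K \<longrightarrow> \<phi> x = 0) \<and> (\<forall>x. x \<notin> K \<longrightarrow> deriv \<phi> x = 0)
    \<and> continuous_on UNIV \<phi> \<and> continuous_on UNIV (deriv \<phi>)"
    using test_function_cutoff[OF \<phi>] by (rule exE)
  then have K: "compact K" "K \<subseteq> interior S" "\<And>x. x \<notin> K \<Longrightarrow> \<phi> x = 0" "\<And>x. x \<notin> K \<Longrightarrow> deriv \<phi> x = 0"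
    "continuous_on UNIV \<phi>" "continuous_on UNIV (deriv \<phi>)"
    by blast+
  have lim: "(\<lambda>n. LINT x:S|lebesgue. \<psi> x *\<^sub>R f n x) \<longlonglongrightarrow> (LINT x:S|lebesgue. \<psi> x *\<^sub>R f' x)"
    if \<psi>: "continuous_on UNIV \<psi>" "\<And>x. x \<notin> K \<Longrightarrow> \<psi> x = 0"
      and f: "\<And>n. set_integrable lebesgue K (f n)" "set_integrable lebesgue K f'"
      and conv: "(\<lambda>n. LINT x:K|lebesgue. norm (f n x - f' x)) \<longlonglongrightarrow> 0"
    for \<psi> :: "real \<Rightarrow> real" and f :: "nat \<Rightarrow> real \<Rightarrow> complex" and f'
  proof (rule LIM_zero_cancel, rule Lim_null_comparison)
    let ?B = "Sup (insert 0 ((\<lambda>x. \<bar>\<psi> x\<bar>) ` K))"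
    show "\<forall>\<^sub>F n in sequentially. norm ((LINT x:S|lebesgue. \<psi> x *\<^sub>R f n x) - (LINT x:S|lebesgue. \<psi> x *\<^sub>R f' x))
        \<le> ?B * (LINT x:K|lebesgue. norm (f n x - f' x))"
    proof (rule always_eventually, rule allI)
      fix n
      have "(LINT x:S|lebesgue. \<psi> x *\<^sub>R f n x) - (LINT x:S|lebesgue. \<psi> x *\<^sub>R f' x)
          = (LINT x:S|lebesgue. \<psi> x *\<^sub>R (f n x - f' x))"
        unfolding scaleR_diff_right
        by (subst set_integral_diff(2)) (simp_all add: cutoff_integrable(1)[OF K(1,2) \<psi>] f)
      then show "norm ((LINT x:S|lebesgue. \<psi> x *\<^sub>R f n x) - (LINT x:S|lebesgue. \<psi> x *\<^sub>R f' x))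
        \<le> ?B * (LINT x:K|lebesgue. norm (f n x - f' x))"
        using cutoff_integrable(2)[OF K(1,2) \<psi> set_integral_diff(1)[OF f]] by simp
    qed
    show "(\<lambda>n. ?B * (LINT x:K|lebesgue. norm (f n x - f' x))) \<longlonglongrightarrow> 0"
      using tendsto_mult_right_zero[OF conv] .
  qed
  have Ki: "set_integrable lebesgue K (u n)" "set_integrable lebesgue K (w n)" for n
    using n K by (auto simp: has_weak_deriv_def)
  have "(\<lambda>n. LINT x:S|lebesgue. deriv \<phi> x *\<^sub>R u n x) \<longlonglongrightarrow> (LINT x:S|lebesgue. deriv \<phi> x *\<^sub>R u' x)"
    using int[OF K(1,2)] by (intro lim K Ki u) auto
  moreover have "(\<lambda>n. - (LINT x:S|lebesgue. \<phi> x *\<^sub>R w n x)) \<longlonglongrightarrow> - (LINT x:S|lebesgue. \<phi> x *\<^sub>R w' x)"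
    using int[OF K(1,2)] by (intro tendsto_minus lim K Ki w) auto
  moreover have "(LINT x:S|lebesgue. deriv \<phi> x *\<^sub>R u n x) = - (LINT x:S|lebesgue. \<phi> x *\<^sub>R w n x)" for n
    using n \<phi> by (simp add: has_weak_deriv_def)
  ultimately show "(LINT x:S|lebesgue. deriv \<phi> x *\<^sub>R u' x) = - (LINT x:S|lebesgue. \<phi> x *\<^sub>R w' x)"
    using LIMSEQ_unique by fastforce
qed

section \<open>The magnetic form\<close>

lemma edge_interval_sets: "edge_interval G e \<in> sets lebesgue"
  by (simp add: edge_interval_def)

lemma AE_edge_interior:
  "AE x in lebesgue. x \<in> edge_interval G e \<longrightarrow> x \<in> interior (edge_interval G e)"
proof -
  have "AE x in lebesgue. x \<notin> {0, len G e}"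
    using AE_not_in[of "{0, len G e}" lebesgue] null_sets_completionI[of "{0, len G e}" lborel] by auto
  then show ?thesis
    by eventually_elim (auto simp: edge_interval_def interior_real_atLeast split: if_splits)
qed

lemma AE_lebesgue_on_edge:
  assumes "AE x in lebesgue. x \<in> interior (edge_interval G e) \<longrightarrow> P x"
  shows "AE x in lebesgue_on (edge_interval G e). P x"
  unfolding AE_lebesgue_on[OF edge_interval_sets]
  using assms AE_edge_interior[of G e] by eventually_elim auto

lemma graph_integral_eq:
  "graph_integral G F f = (\<Sum>e\<in>F. LINT x|lebesgue_on (edge_interval G e). f e x)"
  unfolding graph_integral_def by (simp add: set_lebesgue_integral_eq_lebesgue_on edge_interval_sets)

locale magnetic_graph =
  fixes G :: "('v, 'e) metric_graph"
    and A V :: "'e \<Rightarrow> real \<Rightarrow> real"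
  assumes finite_graph: "finite_metric_graph G"
    and V_ge_1: "\<And>e x. e \<in> edges G \<Longrightarrow> x \<in> edge_interval G e \<Longrightarrow> 1 \<le> V e x"
    and A_loc: "L2_loc G A" and V_loc: "L1_loc G V"
begin

abbreviation I where "I \<equiv> edge_interval G"
abbreviation M where "M e \<equiv> lebesgue_on (edge_interval G e)"
abbreviation H where "H \<equiv> H1_mag G A V"
abbreviation D where "D \<equiv> D_mag G A"
abbreviation energy where "energy \<equiv> energy_normsq G A V"
abbreviation form where "form \<equiv> form_mag G A V"
abbreviation mass where "mass \<equiv> L2_normsq G"
abbreviation inner_L2 where "inner_L2 \<equiv> L2_inner G"
abbreviation lam1 where "lam1 \<equiv> lambda1 G A V"

lemma finite_edges: "finite (edges G)"
  using finite_graph by (simp add: finite_metric_graph_def)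

lemma finite_bedges: "finite (bedges G)"
  using finite_edges by (simp add: edges_def)

lemma bedges_subset: "bedges G \<subseteq> edges G"
  by (simp add: edges_def)

lemma len_pos: "e \<in> bedges G \<Longrightarrow> 0 < len G e"
  using finite_graph by (simp add: finite_metric_graph_def)

lemma V_measurable:
  assumes e: "e \<in> edges G"
  shows "V e \<in> borel_measurable (M e)"
proof -
  have "(\<lambda>x. indicator (I e \<inter> {0..real n}) x *\<^sub>R V e x) \<in> borel_measurable lebesgue" for n
  proof -
    have "set_integrable lebesgue (I e \<inter> {0..real n}) (V e)"
    proof -
      have "bounded (I e \<inter> {0..real n})" "I e \<inter> {0..real n} \<in> sets lebesgue"
        by (auto simp: bounded_Int edge_interval_sets)
      then show ?thesis
        using V_loc e unfolding L1_loc_def by blast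
    qed
    then show ?thesis
      unfolding set_integrable_def by (rule borel_measurable_integrable)
  qed
  moreover have "(\<lambda>n. indicator (I e \<inter> {0..real n}) x *\<^sub>R V e x) \<longlonglongrightarrow> indicator (I e) x *\<^sub>R V e x" for x
  proof (rule tendsto_eventually)
    obtain N where N: "x \<le> real N"
      using real_arch_simple by blast
    have "0 \<le> x" if "x \<in> I e"
      using that by (auto simp: edge_interval_def split: if_splits)
    then have "indicator (I e \<inter> {0..real n}) x *\<^sub>R V e x = indicator (I e) x *\<^sub>R V e x" if "N \<le> n" for n
      using N that by (auto simp: indicator_def)
    then show "\<forall>\<^sub>F n in sequentially. indicator (I e \<inter> {0..real n}) x *\<^sub>R V e x = indicator (I e) x *\<^sub>R V e x"
      unfolding eventually_sequentially by blast
  qed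
  ultimately have "(\<lambda>x. indicator (I e) x *\<^sub>R V e x) \<in> borel_measurable lebesgue"
    by (rule borel_measurable_LIMSEQ_metric)
  then show ?thesis
    by (subst borel_measurable_restrict_space_iff) (auto simp: edge_interval_sets)
qed

lemma H1_continuous: "u \<in> H \<Longrightarrow> e \<in> edges G \<Longrightarrow> continuous_on (I e) (u e)"
  by (auto simp: H1_mag_def continuous_on_graph_def)

lemma H1_weak_deriv: "u \<in> H \<Longrightarrow> e \<in> edges G \<Longrightarrow> has_weak_deriv (I e) (u e) (weak_deriv (I e) (u e))"
  unfolding weak_deriv_def by (rule someI_ex[of "has_weak_deriv (I e) (u e)"]) (simp add: H1_mag_def)

lemma H1_D: "u \<in> H \<Longrightarrow> e \<in> edges G \<Longrightarrow> square_integrable (M e) (D u e)"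
  by (auto simp: H1_mag_def square_integrable_on_iff edge_interval_sets)

text \<open>
  Multiplication by \<open>\<surd>V\<close> turns the \<open>V\<close>-part of the form into a plain \<open>L\<^sup>2\<close> product, so that
  everything known about \<open>L\<^sup>2\<close>, completeness included, applies to it.
\<close>

definition weighted :: "('e \<Rightarrow> real \<Rightarrow> complex) \<Rightarrow> 'e \<Rightarrow> real \<Rightarrow> complex" where
  "weighted u e x = complex_of_real (sqrt (V e x)) * u e x"

lemma V_nonneg: "e \<in> edges G \<Longrightarrow> x \<in> I e \<Longrightarrow> 0 \<le> V e x"
  using V_ge_1 order_trans zero_le_one by blast

lemma norm_weighted: "e \<in> edges G \<Longrightarrow> x \<in> I e \<Longrightarrow> (norm (weighted u e x))\<^sup>2 = V e x * (norm (u e x))\<^sup>2"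
  using V_nonneg by (simp add: weighted_def norm_mult power_mult_distrib)

lemma weighted_measurable:
  assumes "e \<in> edges G" "u e \<in> borel_measurable (M e)"
  shows "weighted u e \<in> borel_measurable (M e)"
proof -
  have "(\<lambda>x. complex_of_real (sqrt (V e x))) \<in> borel_measurable (M e)"
    by (rule measurable_compose[OF measurable_compose[OF V_measurable[OF assms(1)] borel_measurable_sqrt] borel_measurable_of_real])
  then have "(\<lambda>x. complex_of_real (sqrt (V e x)) * u e x) \<in> borel_measurable (M e)"
    using assms(2) by (rule borel_measurable_times)
  then show ?thesis
    by (simp add: weighted_def[abs_def])
qed

lemma H1_measurable:
  assumes "u \<in> H" "e \<in> edges G"
  shows "u e \<in> borel_measurable (M e)"
  using H1_continuous[OF assms] edge_interval_sets by (rule continuous_imp_measurable_on_sets_lebesgue)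

lemma square_integrable_weighted_iff:
  assumes "e \<in> edges G" "u e \<in> borel_measurable (M e)"
  shows "square_integrable (M e) (weighted u e) \<longleftrightarrow> set_integrable lebesgue (I e) (\<lambda>x. V e x * (norm (u e x))\<^sup>2)"
proof -
  have "integrable (M e) (\<lambda>x. (norm (weighted u e x))\<^sup>2) \<longleftrightarrow> integrable (M e) (\<lambda>x. V e x * (norm (u e x))\<^sup>2)"
    by (rule Bochner_Integration.integrable_cong) (auto simp: norm_weighted assms)
  then show ?thesis
    using weighted_measurable[of e u, OF assms] by (simp add: square_integrable_def set_integrable_iff_lebesgue_on edge_interval_sets)
qed

lemma H1_weighted: "u \<in> H \<Longrightarrow> e \<in> edges G \<Longrightarrow> square_integrable (M e) (weighted u e)"
  by (subst square_integrable_weighted_iff) (auto simp: H1_measurable, auto simp: H1_mag_def)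

text \<open>
  As \<open>V \<ge> 1\<close>, the energy controls the norm of \<open>L\<^sup>2\<close>.
\<close>

lemma square_integrable_if_weighted:
  assumes "e \<in> edges G" "u e \<in> borel_measurable (M e)" "square_integrable (M e) (weighted u e)"
  shows "square_integrable (M e) (u e)" "(LINT x|M e. (norm (u e x))\<^sup>2) \<le> (LINT x|M e. (norm (weighted u e x))\<^sup>2)"
proof -
  have le: "(norm (u e x))\<^sup>2 \<le> (norm (weighted u e x))\<^sup>2" if "x \<in> I e" for x
    using V_ge_1[OF assms(1) that] norm_weighted[OF assms(1) that] by (simp add: mult_le_cancel_right1)
  have "integrable (M e) (\<lambda>x. (norm (u e x))\<^sup>2)"
  proof (rule Bochner_Integration.integrable_bound)
    show "integrable (M e) (\<lambda>x. (norm (weighted u e x))\<^sup>2)"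
      using assms(3) by (simp add: square_integrable_def)
    show "(\<lambda>x. (norm (u e x))\<^sup>2) \<in> borel_measurable (M e)"
      by (rule borel_measurable_power[OF measurable_compose[OF assms(2) borel_measurable_norm]])
    show "AE x in M e. norm ((norm (u e x))\<^sup>2) \<le> norm ((norm (weighted u e x))\<^sup>2)"
      using le by (intro AE_I2) simp
  qed
  with assms show "square_integrable (M e) (u e)" "(LINT x|M e. (norm (u e x))\<^sup>2) \<le> (LINT x|M e. (norm (weighted u e x))\<^sup>2)"
    using le by (auto simp: square_integrable_def intro!: integral_mono)
qed

lemma H1_square_integrable: "u \<in> H \<Longrightarrow> e \<in> edges G \<Longrightarrow> square_integrable (M e) (u e)"
  using square_integrable_if_weighted H1_measurable H1_weighted by blast

lemma H1_subset_L2: "u \<in> H \<Longrightarrow> u \<in> L2_space G"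
  using H1_square_integrable by (simp add: L2_space_def square_integrable_on_iff edge_interval_sets)

lemma L2_spaceD: "u \<in> L2_space G \<Longrightarrow> e \<in> edges G \<Longrightarrow> square_integrable (M e) (u e)"
  by (simp add: L2_space_def square_integrable_on_iff edge_interval_sets)

text \<open>
  \<open>D_mag\<close> is built from an unspecified weak derivative; any other one gives the same function almost
  everywhere.
\<close>

lemma D_of_weak_deriv:
  assumes "has_weak_deriv (I e) (u e) w"
  shows "AE x in M e. D u e x = - \<i> * w x - complex_of_real (A e x) * u e x"
proof -
  have "has_weak_deriv (I e) (u e) (weak_deriv (I e) (u e))"
    unfolding weak_deriv_def using someI[of "has_weak_deriv (I e) (u e)", OF assms] .
  then have "AE x in M e. weak_deriv (I e) (u e) x = w x"
    using assms by (intro AE_lebesgue_on_edge has_weak_deriv_unique)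
  then show ?thesis
    by eventually_elim (simp add: D_mag_def)
qed

lemma D_lincomb:
  assumes "u \<in> H" "v \<in> H" "e \<in> edges G"
  shows "AE x in M e. D (lincomb a u b v) e x = a * D u e x + b * D v e x"
proof -
  have "has_weak_deriv (I e) (lincomb a u b v e) (\<lambda>x. a * weak_deriv (I e) (u e) x + b * weak_deriv (I e) (v e) x)"
    unfolding lincomb_def by (intro has_weak_deriv_lincomb H1_weak_deriv assms)
  from D_of_weak_deriv[where u = "lincomb a u b v" and e = e, OF this] show ?thesis
    by eventually_elim (simp add: D_mag_def lincomb_def algebra_simps)
qed

lemma square_integrable_cong_AE:
  assumes f: "square_integrable (M e) f" and eq: "AE x in M e. g x = f x"
  shows "square_integrable (M e) g"
proof -
  have "(\<lambda>x. indicator (I e) x *\<^sub>R f x) \<in> borel_measurable lebesgue"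
    using f by (simp add: square_integrable_def borel_measurable_restrict_space_iff edge_interval_sets)
  moreover have "AE x in lebesgue. indicator (I e) x *\<^sub>R f x = indicator (I e) x *\<^sub>R g x"
    using eq unfolding AE_lebesgue_on[OF edge_interval_sets] by eventually_elim (auto simp: indicator_def)
  ultimately have "(\<lambda>x. indicator (I e) x *\<^sub>R g x) \<in> borel_measurable lebesgue"
    by (rule borel_measurable_AE)
  then have g: "g \<in> borel_measurable (M e)"
    by (simp add: borel_measurable_restrict_space_iff edge_interval_sets)
  have "integrable (M e) (\<lambda>x. (norm (g x))\<^sup>2) \<longleftrightarrow> integrable (M e) (\<lambda>x. (norm (f x))\<^sup>2)"
  proof (rule integrable_cong_AE)
    show "(\<lambda>x. (norm (g x))\<^sup>2) \<in> borel_measurable (M e)"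
      by (rule borel_measurable_power[OF measurable_compose[OF g borel_measurable_norm]])
    show "(\<lambda>x. (norm (f x))\<^sup>2) \<in> borel_measurable (M e)"
      using f unfolding square_integrable_def by (blast intro: borel_measurable_integrable)
    show "AE x in M e. (norm (g x))\<^sup>2 = (norm (f x))\<^sup>2"
      using eq by eventually_elim simp
  qed
  then show ?thesis
    using f g by (simp add: square_integrable_def)
qed

end

context magnetic_graph
begin

lemma form_eq:
  assumes u: "u \<in> H" and v: "v \<in> H"
  shows "form u v = (\<Sum>e\<in>edges G. (LINT x|M e. D u e x * cnj (D v e x)) + (LINT x|M e. weighted u e x * cnj (weighted v e x)))"
  unfolding form_mag_def graph_integral_eq
proof (rule sum.cong[OF refl])
  fix e assume e: "e \<in> edges G"
  have "(LINT x|M e. D u e x * cnj (D v e x) + complex_of_real (V e x) * u e x * cnj (v e x))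
      = (LINT x|M e. D u e x * cnj (D v e x) + weighted u e x * cnj (weighted v e x))"
  proof (rule Bochner_Integration.integral_cong[OF refl])
    fix x assume "x \<in> space (M e)"
    then have "sqrt (V e x) * sqrt (V e x) = V e x"
      using V_nonneg[OF e] by simp
    then have "complex_of_real (V e x) = complex_of_real (sqrt (V e x)) * complex_of_real (sqrt (V e x))"
      by (metis of_real_mult)
    then show "D u e x * cnj (D v e x) + complex_of_real (V e x) * u e x * cnj (v e x)
      = D u e x * cnj (D v e x) + weighted u e x * cnj (weighted v e x)"
      by (simp add: weighted_def)
  qed
  also have "\<dots> = (LINT x|M e. D u e x * cnj (D v e x)) + (LINT x|M e. weighted u e x * cnj (weighted v e x))"
    by (rule Bochner_Integration.integral_add[OF integrable_mult_cnj[OF H1_D[OF u e] H1_D[OF v e]]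
          integrable_mult_cnj[OF H1_weighted[OF u e] H1_weighted[OF v e]]])
  finally show "(LINT x|M e. D u e x * cnj (D v e x) + complex_of_real (V e x) * u e x * cnj (v e x))
      = (LINT x|M e. D u e x * cnj (D v e x)) + (LINT x|M e. weighted u e x * cnj (weighted v e x))" .
qed

lemma energy_eq:
  assumes u: "u \<in> H"
  shows "energy u = (\<Sum>e\<in>edges G. (LINT x|M e. (norm (D u e x))\<^sup>2) + (LINT x|M e. (norm (weighted u e x))\<^sup>2))"
  unfolding energy_normsq_def graph_integral_eq
proof (rule sum.cong[OF refl])
  fix e assume e: "e \<in> edges G"
  have "(LINT x|M e. (norm (D u e x))\<^sup>2 + V e x * (norm (u e x))\<^sup>2)
      = (LINT x|M e. (norm (D u e x))\<^sup>2 + (norm (weighted u e x))\<^sup>2)"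
    by (rule Bochner_Integration.integral_cong) (auto simp: norm_weighted e)
  also have "\<dots> = (LINT x|M e. (norm (D u e x))\<^sup>2) + (LINT x|M e. (norm (weighted u e x))\<^sup>2)"
    using H1_D[OF u e] H1_weighted[OF u e] by (simp add: square_integrable_def)
  finally show "(LINT x|M e. (norm (D u e x))\<^sup>2 + V e x * (norm (u e x))\<^sup>2)
      = (LINT x|M e. (norm (D u e x))\<^sup>2) + (LINT x|M e. (norm (weighted u e x))\<^sup>2)" .
qed

lemma L2_inner_eq: "inner_L2 f g = (\<Sum>e\<in>edges G. LINT x|M e. f e x * cnj (g e x))"
  by (simp add: L2_inner_def graph_integral_eq)

lemma L2_normsq_eq: "mass f = (\<Sum>e\<in>edges G. LINT x|M e. (norm (f e x))\<^sup>2)"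
  by (simp add: L2_normsq_def graph_integral_eq)

lemma L2_inner_self: "inner_L2 f f = complex_of_real (mass f)"
  by (simp add: L2_inner_eq L2_normsq_eq pairing_self)

lemma form_self: "u \<in> H \<Longrightarrow> form u u = complex_of_real (energy u)"
  by (simp add: form_eq energy_eq pairing_self)

lemma L2_normsq_nonneg: "0 \<le> mass f"
  by (simp add: L2_normsq_eq sum_nonneg)

lemma L2_le_energy: "u \<in> H \<Longrightarrow> mass u \<le> energy u"
proof -
  assume u: "u \<in> H"
  show ?thesis
    unfolding L2_normsq_eq energy_eq[OF u]
  proof (rule sum_mono)
    fix e assume e: "e \<in> edges G"
    have "0 \<le> (LINT x|M e. (norm (D u e x))\<^sup>2)"
      by simp
    then show "(LINT x|M e. (norm (u e x))\<^sup>2) \<le> (LINT x|M e. (norm (D u e x))\<^sup>2) + (LINT x|M e. (norm (weighted u e x))\<^sup>2)"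
      using square_integrable_if_weighted(2)[of e u, OF e H1_measurable[OF u e] H1_weighted[OF u e]] by linarith
  qed
qed

lemma energy_nonneg: "u \<in> H \<Longrightarrow> 0 \<le> energy u"
  using L2_le_energy L2_normsq_nonneg order_trans by blast

lemma weighted_lincomb: "weighted (lincomb a u b v) e x = a * weighted u e x + b * weighted v e x"
  by (simp add: weighted_def lincomb_def algebra_simps)

lemma H1_lincomb:
  assumes u: "u \<in> H" and v: "v \<in> H"
  shows "lincomb a u b v \<in> H"
proof -
  have cont: "continuous_on (I e) (lincomb a u b v e)" if e: "e \<in> edges G" for e
    unfolding lincomb_def by (intro continuous_intros H1_continuous u v e)
  obtain val1 where val1: "\<forall>e\<in>edges G. u e 0 = val1 (src G e)" "\<forall>e\<in>bedges G. u e (len G e) = val1 (tgt G e)"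
    using u unfolding H1_mag_def continuous_on_graph_def by blast
  obtain val2 where val2: "\<forall>e\<in>edges G. v e 0 = val2 (src G e)" "\<forall>e\<in>bedges G. v e (len G e) = val2 (tgt G e)"
    using v unfolding H1_mag_def continuous_on_graph_def by blast
  have "continuous_on_graph G (lincomb a u b v)"
    unfolding continuous_on_graph_def
    by (intro conjI ballI cont, assumption, rule exI[of _ "\<lambda>x. a * val1 x + b * val2 x"])
       (use val1 val2 in \<open>simp add: lincomb_def\<close>)
  moreover have "\<exists>w. has_weak_deriv (I e) (lincomb a u b v e) w" if e: "e \<in> edges G" for e
    unfolding lincomb_def using has_weak_deriv_lincomb[OF H1_weak_deriv[OF u e] H1_weak_deriv[OF v e]] by blast
  moreover have "square_integrable_on (I e) (D (lincomb a u b v) e)" if e: "e \<in> edges G" for e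
    unfolding square_integrable_on_iff[OF edge_interval_sets]
    by (rule square_integrable_cong_AE[OF square_integrable_lincomb[OF H1_D[OF u e] H1_D[OF v e]] D_lincomb[OF u v e]])
  moreover have "set_integrable lebesgue (I e) (\<lambda>x. V e x * (norm (lincomb a u b v e x))\<^sup>2)" if e: "e \<in> edges G" for e
  proof -
    have "square_integrable (M e) (weighted (lincomb a u b v) e)"
      using square_integrable_lincomb[OF H1_weighted[OF u e] H1_weighted[OF v e]] by (simp add: weighted_lincomb[abs_def])
    moreover have "lincomb a u b v e \<in> borel_measurable (M e)"
      using cont[OF e] edge_interval_sets by (rule continuous_imp_measurable_on_sets_lebesgue)
    ultimately show ?thesis
      using square_integrable_weighted_iff[of e "lincomb a u b v", OF e] by blast
  qed
  ultimately show ?thesis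
    by (simp add: H1_mag_def)
qed

lemma L2_lincomb: "u \<in> L2_space G \<Longrightarrow> v \<in> L2_space G \<Longrightarrow> lincomb a u b v \<in> L2_space G"
  by (auto simp: L2_space_def square_integrable_on_iff edge_interval_sets lincomb_def intro!: square_integrable_lincomb)

sublocale L2: hermitian_form "L2_space G" "inner_L2"
proof
  fix a b u v w assume "u \<in> L2_space G" "v \<in> L2_space G" "w \<in> L2_space G"
  then show "inner_L2 (lincomb a u b v) w = a * inner_L2 u w + b * inner_L2 v w"
    by (simp add: L2_inner_eq lincomb_def pairing_lincomb L2_spaceD sum.distrib sum_distrib_left)
next
  fix u v show "inner_L2 v u = cnj (inner_L2 u v)"
    unfolding L2_inner_eq cnj_sum by (rule sum.cong[OF refl pairing_commute])
next
  fix u show "0 \<le> Re (inner_L2 u u)"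
    by (simp add: L2_inner_self L2_normsq_nonneg)
qed (rule L2_lincomb)

sublocale H1: hermitian_form H "form"
proof
  fix a b u v w assume u: "u \<in> H" and v: "v \<in> H" and w: "w \<in> H"
  have "(LINT x|M e. D (lincomb a u b v) e x * cnj (D w e x))
      = a * (LINT x|M e. D u e x * cnj (D w e x)) + b * (LINT x|M e. D v e x * cnj (D w e x))" if e: "e \<in> edges G" for e
  proof -
    have "(LINT x|M e. D (lincomb a u b v) e x * cnj (D w e x)) = (LINT x|M e. (a * D u e x + b * D v e x) * cnj (D w e x))"
      by (intro pairing_cong_AE D_lincomb square_integrable_lincomb H1_D H1_lincomb u v w e)
    then show ?thesis
      using pairing_lincomb[OF H1_D[OF u e] H1_D[OF v e] H1_D[OF w e]] by simp
  qed
  moreover have "(LINT x|M e. weighted (lincomb a u b v) e x * cnj (weighted w e x))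
      = a * (LINT x|M e. weighted u e x * cnj (weighted w e x)) + b * (LINT x|M e. weighted v e x * cnj (weighted w e x))" if e: "e \<in> edges G" for e
    unfolding weighted_lincomb by (rule pairing_lincomb[OF H1_weighted[OF u e] H1_weighted[OF v e] H1_weighted[OF w e]])
  ultimately show "form (lincomb a u b v) w = a * form u w + b * form v w"
    by (simp add: form_eq u v w H1_lincomb sum.distrib sum_distrib_left algebra_simps)
next
  fix u v assume "u \<in> H" "v \<in> H"
  then show "form v u = cnj (form u v)"
    unfolding form_eq[OF \<open>u \<in> H\<close> \<open>v \<in> H\<close>] form_eq[OF \<open>v \<in> H\<close> \<open>u \<in> H\<close>] cnj_sum complex_cnj_add
    by (simp only: pairing_commute[symmetric])
next
  fix u assume "u \<in> H"
  then show "0 \<le> Re (form u u)"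
    by (simp add: form_self energy_nonneg)
qed (rule H1_lincomb)

section \<open>Pointwise estimates\<close>

lemma edge_D_le_energy:
  assumes "u \<in> H" "e \<in> edges G"
  shows "(LINT x|M e. (norm (D u e x))\<^sup>2) \<le> energy u"
proof -
  let ?f = "\<lambda>e. (LINT x|M e. (norm (D u e x))\<^sup>2) + (LINT x|M e. (norm (weighted u e x))\<^sup>2)"
  have "?f e \<le> sum ?f (edges G)"
    by (rule member_le_sum) (use assms finite_edges in auto)
  moreover have "0 \<le> (LINT x|M e. (norm (weighted u e x))\<^sup>2)"
    by simp
  ultimately show ?thesis
    using energy_eq[OF assms(1)] by linarith
qed

lemma edge_L2_le:
  assumes "e \<in> edges G"
  shows "(LINT x|M e. (norm (f e x))\<^sup>2) \<le> mass f"
  unfolding L2_normsq_eq by (rule member_le_sum) (use assms finite_edges in auto)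

definition A_mass :: "'e \<Rightarrow> real \<Rightarrow> real" where
  "A_mass e b = (LINT t|lebesgue_on {0..b}. (norm (complex_of_real (A e t)))\<^sup>2)"

lemma A_mass_nonneg: "0 \<le> A_mass e b"
  by (simp add: A_mass_def)

lemma A_square_integrable:
  assumes "e \<in> edges G" "{0..b} \<subseteq> I e" "0 \<le> x" "y \<le> b"
  shows "square_integrable (lebesgue_on {x..y}) (\<lambda>t. complex_of_real (A e t))"
    and "(LINT t|lebesgue_on {x..y}. (norm (complex_of_real (A e t)))\<^sup>2) \<le> A_mass e b"
proof -
  have "square_integrable_on {0..b} (A e)"
    using A_loc assms unfolding L2_loc_def by (metis bounded_closed_interval lmeasurable_cbox fmeasurableD box_real(2))
  then have A: "square_integrable (lebesgue_on {0..b}) (\<lambda>t. complex_of_real (A e t))"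
  proof -
    assume *: "square_integrable_on {0..b} (A e)"
    have "A e \<in> borel_measurable (lebesgue_on {0..b})"
      using * by (simp add: square_integrable_on_def set_borel_measurable_def borel_measurable_restrict_space_iff)
    from measurable_compose[OF this borel_measurable_of_real] show ?thesis
      using * by (simp add: square_integrable_on_def square_integrable_def set_integrable_iff_lebesgue_on)
  qed
  have sub: "{x..y} \<subseteq> {0..b}"
    using assms by auto
  show "square_integrable (lebesgue_on {x..y}) (\<lambda>t. complex_of_real (A e t))"
    by (rule square_integrable_subset(1)[OF A _ _ sub]) auto
  show "(LINT t|lebesgue_on {x..y}. (norm (complex_of_real (A e t)))\<^sup>2) \<le> A_mass e b"
    unfolding A_mass_def by (rule square_integrable_subset(2)[OF A _ _ sub]) auto
qed

text \<open>
  Since \<open>w = i (D u + A u)\<close> is a weak derivative of \<open>u\<close>, the increment is at most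
  \<open>\<integral> |D u| + |A| |u|\<close>, and the Cauchy-Schwarz inequality bounds both integrals over a short interval
  by the square root of its length.
\<close>

lemma increment_bound:
  assumes u: "u \<in> H" and e: "e \<in> edges G" and b: "{0..b} \<subseteq> I e" and xy: "0 \<le> x" "x \<le> y" "y \<le> b"
    and S: "\<And>t. t \<in> {x..y} \<Longrightarrow> norm (u e t) \<le> S"
  shows "norm (u e y - u e x) \<le> sqrt ((y - x) * energy u) + S * sqrt ((y - x) * A_mass e b)"
proof -
  let ?N = "lebesgue_on {x..y}"
  have sub: "{x..y} \<subseteq> I e"
    using b xy by auto
  have Dsq: "square_integrable ?N (D u e)"
    by (rule square_integrable_subset(1)[OF H1_D[OF u e] edge_interval_sets _ sub]) auto
  have usq: "square_integrable ?N (u e)"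
    by (rule square_integrable_subset(1)[OF H1_square_integrable[OF u e] edge_interval_sets _ sub]) auto
  note Asq = A_square_integrable[OF e b xy(1,3)]
  have "(LINT t|?N. (norm (D u e t))\<^sup>2) \<le> (LINT t|M e. (norm (D u e t))\<^sup>2)"
    by (rule square_integrable_subset(2)[OF H1_D[OF u e] edge_interval_sets _ sub]) auto
  then have "(LINT t|?N. norm (D u e t))\<^sup>2 \<le> (y - x) * energy u"
    using integral_norm_interval(2)[OF Dsq xy(2)] edge_D_le_energy[OF u e] xy
    by (meson diff_ge_0_iff_ge mult_left_mono order_trans)
  then have D1: "(LINT t|?N. norm (D u e t)) \<le> sqrt ((y - x) * energy u)"
    by (rule real_le_rsqrt)
  have "(LINT t|?N. norm (complex_of_real (A e t)))\<^sup>2 \<le> (y - x) * A_mass e b"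
    using integral_norm_interval(2)[OF Asq(1) xy(2)] Asq(2) xy
    by (meson diff_ge_0_iff_ge mult_left_mono order_trans)
  then have A1: "(LINT t|?N. norm (complex_of_real (A e t))) \<le> sqrt ((y - x) * A_mass e b)"
    by (rule real_le_rsqrt)
  define w where "w = weak_deriv (I e) (u e)"
  have w_eq: "w t = \<i> * D u e t + \<i> * (complex_of_real (A e t) * u e t)" for t
    by (simp add: w_def D_mag_def algebra_simps)
  have Aint: "integrable ?N (\<lambda>t. norm (complex_of_real (A e t)))"
    by (rule integral_norm_interval(1)[OF Asq(1) xy(2)])
  have Auint: "integrable ?N (\<lambda>t. norm (complex_of_real (A e t)) * norm (u e t))"
    by (rule integrable_norm_mult[OF Asq(1) usq])
  have Dint: "integrable ?N (\<lambda>t. norm (D u e t))"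
    by (rule integral_norm_interval(1)[OF Dsq xy(2)])
  have wint: "integrable ?N w"
  proof (rule Bochner_Integration.integrable_bound)
    show "integrable ?N (\<lambda>t. norm (D u e t) + norm (complex_of_real (A e t)) * norm (u e t))"
      using Dint Auint by simp
    show "w \<in> borel_measurable ?N"
      unfolding w_eq[abs_def] using Dsq Asq(1) usq unfolding square_integrable_def
      by (intro borel_measurable_add borel_measurable_times) auto
    show "AE t in ?N. norm (w t) \<le> norm (norm (D u e t) + norm (complex_of_real (A e t)) * norm (u e t))"
      unfolding w_eq using norm_triangle_ineq[of "\<i> * D u e _" "\<i> * (complex_of_real (A e _) * u e _)"]
      by (intro AE_I2) (simp add: norm_mult)
  qed
  have "u e y - u e x = (LINT t:{x..y}|lebesgue. w t)"
    using xy sub wint unfolding w_def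
    by (intro weak_deriv_integral[OF H1_weak_deriv[OF u e] H1_continuous[OF u e], where a = x and b = y])
       (auto simp: set_integrable_iff_lebesgue_on)
  also have "\<dots> = (LINT t|?N. w t)"
    by (simp add: set_lebesgue_integral_eq_lebesgue_on)
  finally have "norm (u e y - u e x) \<le> (LINT t|?N. norm (w t))"
    by simp
  also have "\<dots> \<le> (LINT t|?N. norm (D u e t) + S * norm (complex_of_real (A e t)))"
  proof (rule integral_mono)
    show "integrable ?N (\<lambda>t. norm (w t))"
      using wint by simp
    show "integrable ?N (\<lambda>t. norm (D u e t) + S * norm (complex_of_real (A e t)))"
      using Dint Aint by simp
    fix t assume "t \<in> space ?N"
    then have "norm (complex_of_real (A e t)) * norm (u e t) \<le> norm (complex_of_real (A e t)) * S"
      using S by (intro mult_left_mono) auto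
    moreover have "norm (w t) \<le> norm (D u e t) + norm (complex_of_real (A e t)) * norm (u e t)"
      unfolding w_eq using norm_triangle_ineq[of "\<i> * D u e t" "\<i> * (complex_of_real (A e t) * u e t)"]
      by (simp add: norm_mult)
    ultimately show "norm (w t) \<le> norm (D u e t) + S * norm (complex_of_real (A e t))"
      by (simp add: mult.commute)
  qed
  also have "\<dots> = (LINT t|?N. norm (D u e t)) + S * (LINT t|?N. norm (complex_of_real (A e t)))"
    using Dint Aint by simp
  also have "\<dots> \<le> sqrt ((y - x) * energy u) + S * sqrt ((y - x) * A_mass e b)"
  proof -
    have "0 \<le> S"
      using S[of x] xy by (smt (verit) atLeastAtMost_iff norm_ge_zero)
    then show ?thesis
      using D1 A1 by (intro add_mono mult_left_mono) auto
  qed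
  finally show ?thesis .
qed

text \<open>
  On an interval of length \<open>s\<close> so short that \<open>\<integral> |A| \<le> 1/2\<close>, the maximum \<open>S\<close> and the minimum \<open>m\<close> of
  \<open>|u|\<close> satisfy \<open>S \<le> m + \<surd>(s Q(u)) + S/2\<close>; the last term is absorbed on the left, and \<open>s m\<^sup>2\<close> is
  at most the mass.
\<close>

lemma sup_bound_short:
  assumes u: "u \<in> H" and e: "e \<in> edges G" and b: "{0..b} \<subseteq> I e"
    and s: "0 < s" "s \<le> b" "s * A_mass e b \<le> 1/4" and x: "x \<in> {0..b}"
  shows "(norm (u e x))\<^sup>2 \<le> 8 * (mass u / s + s * energy u)"
proof -
  let ?E = "energy u"
  \<comment> \<open>The interval of length \<open>s\<close> to the right of \<open>x\<close>, moved left where it would leave \<open>[0,b]\<close>.\<close>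
  define c where "c = min x (b - s)"
  let ?J = "{c..c + s}"
  have c: "0 \<le> c" "c + s \<le> b" "x \<in> ?J"
    using s x by (auto simp: c_def min_def)
  have J: "?J \<subseteq> I e"
    using b c by auto
  have cont: "continuous_on ?J (\<lambda>t. norm (u e t))"
    by (intro continuous_intros continuous_on_subset[OF H1_continuous[OF u e] J])
  have ne: "?J \<noteq> {}"
    using s by simp
  obtain z where z: "z \<in> ?J" "\<And>t. t \<in> ?J \<Longrightarrow> norm (u e t) \<le> norm (u e z)"
    using continuous_attains_sup[OF compact_Icc ne cont] by blast
  obtain y where y: "y \<in> ?J" "\<And>t. t \<in> ?J \<Longrightarrow> norm (u e y) \<le> norm (u e t)"
    using continuous_attains_inf[OF compact_Icc ne cont] by blast
  let ?S = "norm (u e z)"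
  have inc: "norm (u e z - u e y) \<le> sqrt (s * ?E) + ?S * (1/2)"
  proof -
    have "norm (u e z - u e y) \<le> sqrt (\<bar>z - y\<bar> * ?E) + ?S * sqrt (\<bar>z - y\<bar> * A_mass e b)"
    proof (cases "y \<le> z")
      case True
      then show ?thesis
        using increment_bound[OF u e b, of y z ?S] y z c by auto
    next
      case False
      then show ?thesis
        using increment_bound[OF u e b, of z y ?S] y z c by (auto simp: norm_minus_commute)
    qed
    also have "\<dots> \<le> sqrt (s * ?E) + ?S * (1/2)"
    proof (intro add_mono mult_left_mono real_sqrt_le_mono mult_right_mono energy_nonneg u)
      show "\<bar>z - y\<bar> \<le> s"
        using y z by auto
      then have "\<bar>z - y\<bar> * A_mass e b \<le> s * A_mass e b"
        by (rule mult_right_mono[OF _ A_mass_nonneg])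
      then have "sqrt (\<bar>z - y\<bar> * A_mass e b) \<le> sqrt ((1/2)\<^sup>2)"
        using s(3) by (intro real_sqrt_le_mono) (simp add: power2_eq_square)
      then show "sqrt (\<bar>z - y\<bar> * A_mass e b) \<le> 1/2"
        by simp
    qed auto
    finally show ?thesis .
  qed
  let ?m = "norm (u e y)"
  have m: "?m\<^sup>2 \<le> mass u / s"
  proof -
    let ?N = "lebesgue_on ?J"
    have fin: "finite_measure ?N"
      by (simp add: finite_measure_lebesgue_on)
    have usq: "square_integrable ?N (u e)"
      by (rule square_integrable_subset(1)[OF H1_square_integrable[OF u e] edge_interval_sets _ J]) auto
    have "s * ?m\<^sup>2 = (LINT t|?N. ?m\<^sup>2)"
      using s by (simp add: measure_restrict_space)
    also have "\<dots> \<le> (LINT t|?N. (norm (u e t))\<^sup>2)"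
      using usq y by (intro integral_mono finite_measure.integrable_const[OF fin])
        (auto simp: square_integrable_def intro!: power_mono)
    also have "\<dots> \<le> (LINT t|M e. (norm (u e t))\<^sup>2)"
      by (rule square_integrable_subset(2)[OF H1_square_integrable[OF u e] edge_interval_sets _ J]) auto
    also have "\<dots> \<le> mass u"
      by (rule edge_L2_le[OF e])
    finally show ?thesis
      using s by (simp add: field_simps)
  qed
  have "?S \<le> ?m + norm (u e z - u e y)"
    using norm_triangle_ineq[of "u e y" "u e z - u e y"] by simp
  then have "?S \<le> 2 * (?m + sqrt (s * ?E))"
    using inc by simp
  then have "?S\<^sup>2 \<le> (2 * (?m + sqrt (s * ?E)))\<^sup>2"
    by (rule power_mono) simp
  also have "\<dots> = 4 * (?m + sqrt (s * ?E))\<^sup>2"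
    unfolding power_mult_distrib by simp
  also have "\<dots> \<le> 4 * (2 * (?m\<^sup>2 + (sqrt (s * ?E))\<^sup>2))"
    using sum_squares_bound[of ?m "sqrt (s * ?E)"] by (simp add: power2_sum)
  also have "(sqrt (s * ?E))\<^sup>2 = s * ?E"
    using s energy_nonneg[OF u] by simp
  finally have "?S\<^sup>2 \<le> 8 * (mass u / s + s * ?E)"
    using m by simp
  moreover have "(norm (u e x))\<^sup>2 \<le> ?S\<^sup>2"
    using z(2)[OF c(3)] by (intro power_mono) auto
  ultimately show ?thesis
    by linarith
qed

text \<open>
  A Gagliardo-Nirenberg inequality. Choosing the length \<open>s\<close> of the short interval proportional to
  \<open>\<surd>(P/Q)\<close>, with \<open>P\<close> the mass and \<open>Q\<close> the energy, balances the two terms of the previous estimate.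
  This length is admissible because \<open>P \<le> Q\<close>.
\<close>

lemma sup_bound:
  assumes e: "e \<in> edges G" and b: "0 < b" "{0..b} \<subseteq> I e"
  shows "\<exists>C\<ge>0. \<forall>u\<in>H. \<forall>x\<in>{0..b}. norm (u e x) ^ 4 \<le> C * (mass u * energy u)"
proof -
  \<comment> \<open>Up to this length, the integral of \<open>|A|\<close> over an interval is at most \<open>1/2\<close>.\<close>
  define \<delta> where "\<delta> = min b (1 / (4 * (A_mass e b + 1)))"
  have \<delta>: "0 < \<delta>" "\<delta> \<le> b"
    using b A_mass_nonneg[of e b] by (auto simp: \<delta>_def)
  have \<delta>A: "\<delta> * A_mass e b \<le> 1/4"
  proof -
    have "\<delta> * A_mass e b \<le> 1 / (4 * (A_mass e b + 1)) * A_mass e b"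
      by (intro mult_right_mono A_mass_nonneg) (simp add: \<delta>_def)
    also have "\<dots> \<le> 1/4"
      using A_mass_nonneg[of e b] by (simp add: field_simps)
    finally show ?thesis .
  qed
  define C where "C = (8 * (1 / \<delta> + \<delta>))\<^sup>2"
  have main: "norm (u e x) ^ 4 \<le> C * ((mass u + \<epsilon>) * (energy u + \<epsilon>))"
    if u: "u \<in> H" and x: "x \<in> {0..b}" and \<epsilon>: "0 < \<epsilon>" for u x \<epsilon>
  proof -
    \<comment> \<open>The shift by \<open>\<epsilon>\<close> keeps \<open>P\<close> and \<open>Q\<close> positive, so that their quotient makes sense.\<close>
    define P where "P = mass u + \<epsilon>"
    define Q where "Q = energy u + \<epsilon>"
    have PQ: "0 < P" "P \<le> Q" "0 < Q"
      using \<epsilon> L2_normsq_nonneg[of u] L2_le_energy[OF u] by (auto simp: P_def Q_def)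
    define s where "s = \<delta> * sqrt (P / Q)"
    have s: "0 < s" "s \<le> \<delta>"
      using PQ \<delta> by (auto simp: s_def mult_le_cancel_left1)
    have "s * A_mass e b \<le> 1/4"
      using s \<delta>A mult_right_mono[OF s(2) A_mass_nonneg[of e b]] by linarith
    then have "(norm (u e x))\<^sup>2 \<le> 8 * (mass u / s + s * energy u)"
      using s \<delta> by (intro sup_bound_short[OF u e b(2)] x) auto
    also have "\<dots> \<le> 8 * (P / s + s * Q)"
      using s \<epsilon> by (intro mult_left_mono add_mono divide_right_mono) (auto simp: P_def Q_def)
    also have "P / s = (1 / \<delta>) * sqrt (P * Q)"
    proof -
      have "sqrt (P * Q) * sqrt (P / Q) = sqrt (P\<^sup>2)"
        using PQ by (simp add: real_sqrt_mult[symmetric] power2_eq_square)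
      then have "sqrt (P * Q) * sqrt (P / Q) = P"
        using PQ by simp
      then show ?thesis
        using \<delta> PQ by (simp add: s_def field_simps)
    qed
    also have "s * Q = \<delta> * sqrt (P * Q)"
    proof -
      have "sqrt (P / Q) * sqrt (Q\<^sup>2) = sqrt (P * Q)"
        unfolding real_sqrt_mult[symmetric] using PQ by (simp add: power2_eq_square)
      then show ?thesis
        using PQ by (simp add: s_def)
    qed
    finally have "(norm (u e x))\<^sup>2 \<le> 8 * (1 / \<delta> + \<delta>) * sqrt (P * Q)"
      by (simp add: algebra_simps)
    then have "((norm (u e x))\<^sup>2)\<^sup>2 \<le> (8 * (1 / \<delta> + \<delta>) * sqrt (P * Q))\<^sup>2"
      by (rule power_mono) simp
    also have "\<dots> = C * (P * Q)"
      using PQ by (simp add: C_def power_mult_distrib)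
    finally show ?thesis
      by (simp add: P_def Q_def flip: power_mult)
  qed
  have "norm (u e x) ^ 4 \<le> C * (mass u * energy u)" if u: "u \<in> H" and x: "x \<in> {0..b}" for u x
  proof (rule tendsto_lowerbound)
    show "((\<lambda>\<epsilon>. C * ((mass u + \<epsilon>) * (energy u + \<epsilon>))) \<longlongrightarrow> C * (mass u * energy u)) (at_right 0)"
      by (auto intro!: tendsto_eq_intros)
    show "\<forall>\<^sub>F \<epsilon> in at_right 0. norm (u e x) ^ 4 \<le> C * ((mass u + \<epsilon>) * (energy u + \<epsilon>))"
      using main[OF u x] by (auto simp: eventually_at_right_field intro: exI[of _ 1])
  qed simp
  then show ?thesis
    by (intro exI[of _ C]) (auto simp: C_def)
qed

lemma core_sup_bound:
  "\<exists>C\<ge>0. \<forall>u\<in>H. \<forall>e\<in>bedges G. \<forall>x\<in>I e. norm (u e x) ^ 4 \<le> C * (mass u * energy u)"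
proof -
  have "\<forall>e\<in>bedges G. \<exists>C\<ge>0. \<forall>u\<in>H. \<forall>x\<in>I e. norm (u e x) ^ 4 \<le> C * (mass u * energy u)"
  proof
    fix e assume e: "e \<in> bedges G"
    then have "I e = {0..len G e}"
      by (simp add: edge_interval_def)
    then show "\<exists>C\<ge>0. \<forall>u\<in>H. \<forall>x\<in>I e. norm (u e x) ^ 4 \<le> C * (mass u * energy u)"
      using sup_bound[of e "len G e"] e bedges_subset len_pos[OF e] by auto
  qed
  then obtain C where C: "\<And>e. e \<in> bedges G \<Longrightarrow> 0 \<le> C e"
    "\<And>e u x. e \<in> bedges G \<Longrightarrow> u \<in> H \<Longrightarrow> x \<in> I e \<Longrightarrow> norm (u e x) ^ 4 \<le> C e * (mass u * energy u)"
    by metis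
  have "norm (u e x) ^ 4 \<le> sum C (bedges G) * (mass u * energy u)"
    if "u \<in> H" "e \<in> bedges G" "x \<in> I e" for u e x
  proof -
    have "C e \<le> sum C (bedges G)"
      by (rule member_le_sum) (use that C(1) finite_bedges in auto)
    then have "C e * (mass u * energy u) \<le> sum C (bedges G) * (mass u * energy u)"
      using that by (intro mult_right_mono mult_nonneg_nonneg L2_normsq_nonneg energy_nonneg)
    then show ?thesis
      using C(2)[OF that(2,1,3)] by linarith
  qed
  then show ?thesis
    using C(1) by (intro exI[of _ "sum C (bedges G)"]) (auto intro: sum_nonneg)
qed

end

section \<open>Compactness on the core\<close>

text \<open>
  Induction over the finite index set, passing to one more subsequence at each step.
\<close>

lemma Arzela_Ascoli_finite_family:
  fixes f :: "nat \<Rightarrow> 'i \<Rightarrow> real \<Rightarrow> complex"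
  assumes "finite F" and comp: "\<And>i. i \<in> F \<Longrightarrow> compact (S i)"
    and bound: "\<And>n i x. i \<in> F \<Longrightarrow> x \<in> S i \<Longrightarrow> norm (f n i x) \<le> B"
    and equi: "\<And>i x \<epsilon>. i \<in> F \<Longrightarrow> x \<in> S i \<Longrightarrow> 0 < \<epsilon> \<Longrightarrow>
      \<exists>d>0. \<forall>n y. y \<in> S i \<and> norm (x - y) < d \<longrightarrow> norm (f n i x - f n i y) < \<epsilon>"
  shows "\<exists>k. strict_mono (k :: nat \<Rightarrow> nat) \<and>
    (\<forall>\<epsilon>>0. \<exists>N. \<forall>m\<ge>N. \<forall>n\<ge>N. \<forall>i\<in>F. \<forall>x\<in>S i. norm (f (k m) i x - f (k n) i x) < \<epsilon>)"
  using assms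
proof (induction F rule: finite_induct)
  case empty
  then show ?case
    using strict_mono_id by auto
next
  case (insert j F)
  have "\<exists>k. strict_mono (k :: nat \<Rightarrow> nat) \<and>
    (\<forall>\<epsilon>>0. \<exists>N. \<forall>m\<ge>N. \<forall>n\<ge>N. \<forall>i\<in>F. \<forall>x\<in>S i. norm (f (k m) i x - f (k n) i x) < \<epsilon>)"
    using insert.prems by (intro insert.IH) auto
  then obtain k where k: "strict_mono (k :: nat \<Rightarrow> nat)"
    "\<And>\<epsilon>. 0 < \<epsilon> \<Longrightarrow> \<exists>N. \<forall>m\<ge>N. \<forall>n\<ge>N. \<forall>i\<in>F. \<forall>x\<in>S i. norm (f (k m) i x - f (k n) i x) < \<epsilon>"
    by blast
  obtain g r where r: "strict_mono (r :: nat \<Rightarrow> nat)"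
    "\<And>\<epsilon>. 0 < \<epsilon> \<Longrightarrow> \<exists>N. \<forall>n x. n \<ge> N \<and> x \<in> S j \<longrightarrow> norm (f (k (r n)) j x - g x) < \<epsilon>"
  proof (rule Arzela_Ascoli[of "S j" "\<lambda>n. f (k n) j" B])
    show "compact (S j)"
      using insert.prems(1) by simp
    show "norm (f (k n) j x) \<le> B" if "x \<in> S j" for n x
      using insert.prems(2) that by simp
    show "\<exists>d>0. \<forall>n y. y \<in> S j \<and> norm (x - y) < d \<longrightarrow> norm (f (k n) j x - f (k n) j y) < \<epsilon>"
      if "x \<in> S j" "0 < \<epsilon>" for x \<epsilon>
      using insert.prems(3)[of j x \<epsilon>] that by auto
  qed (rule that)
  have "\<exists>N. \<forall>m\<ge>N. \<forall>n\<ge>N. \<forall>i\<in>insert j F. \<forall>x\<in>S i. norm (f ((k \<circ> r) m) i x - f ((k \<circ> r) n) i x) < \<epsilon>"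
    if \<epsilon>: "0 < \<epsilon>" for \<epsilon>
  proof -
    obtain N1 where N1: "\<And>m n i x. N1 \<le> m \<Longrightarrow> N1 \<le> n \<Longrightarrow> i \<in> F \<Longrightarrow> x \<in> S i \<Longrightarrow> norm (f (k m) i x - f (k n) i x) < \<epsilon>"
      using k(2)[OF \<epsilon>] by blast
    obtain N2 where N2: "\<And>n x. N2 \<le> n \<Longrightarrow> x \<in> S j \<Longrightarrow> norm (f (k (r n)) j x - g x) < \<epsilon> / 2"
      using r(2)[OF half_gt_zero[OF \<epsilon>]] by blast
    have "norm (f (k (r m)) i x - f (k (r n)) i x) < \<epsilon>"
      if mn: "max N1 N2 \<le> m" "max N1 N2 \<le> n" and i: "i \<in> insert j F" "x \<in> S i" for m n i x
    proof (cases "i = j")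
      case True
      have "dist (f (k (r m)) j x) (g x) < \<epsilon> / 2" "dist (f (k (r n)) j x) (g x) < \<epsilon> / 2"
        using N2 mn i True by (auto simp: dist_norm)
      then have "dist (f (k (r m)) j x) (f (k (r n)) j x) < \<epsilon>"
        by (rule dist_triangle_half_r[OF _ _, of "g x", unfolded dist_commute[of "g x"]])
      then show ?thesis
        using True by (simp add: dist_norm)
    next
      case False
      then show ?thesis
        using N1[of "r m" "r n" i x] mn i seq_suble[OF r(1), of m] seq_suble[OF r(1), of n] by auto
    qed
    then show ?thesis
      by (intro exI[of _ "max N1 N2"]) auto
  qed
  then show ?case
    using strict_mono_o[OF k(1) r(1)] by blast
qed

context magnetic_graph
begin

lemma core_uniform_bound:
  assumes "0 \<le> Q"
  shows "\<exists>B\<ge>1. \<forall>u\<in>H. energy u \<le> Q \<longrightarrow> (\<forall>e\<in>bedges G. \<forall>x\<in>I e. norm (u e x) \<le> B)"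
proof -
  obtain C where C: "0 \<le> C"
    "\<And>u e x. u \<in> H \<Longrightarrow> e \<in> bedges G \<Longrightarrow> x \<in> I e \<Longrightarrow> norm (u e x) ^ 4 \<le> C * (mass u * energy u)"
    using core_sup_bound by blast
  \<comment> \<open>Values above \<open>1\<close> are below their fourth powers.\<close>
  define B where "B = 1 + C * (Q * Q)"
  have B1: "1 \<le> B"
    using C(1) assms by (simp add: B_def)
  have "norm (u e x) \<le> B" if u: "u \<in> H" and Q: "energy u \<le> Q" and ex: "e \<in> bedges G" "x \<in> I e" for u e x
  proof (cases "norm (u e x) \<le> 1")
    case False
    then have "norm (u e x) ^ 1 \<le> norm (u e x) ^ 4"
      by (intro power_increasing) auto
    also have "\<dots> \<le> C * (mass u * energy u)"
      by (rule C(2)[OF u ex])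
    also have "\<dots> \<le> C * (Q * Q)"
      using C(1) assms Q L2_le_energy[OF u] energy_nonneg[OF u]
      by (intro mult_left_mono mult_mono) auto
    finally show ?thesis
      by (simp add: B_def)
  qed (use B1 in linarith)
  then show ?thesis
    using B1 by blast
qed

text \<open>
  A bounded energy gives a uniform bound on the core and, by the increment estimate, equicontinuity
  with modulus a multiple of the square root.
\<close>

lemma core_compactness:
  assumes U: "\<And>n. U n \<in> H" and Q: "\<And>n. energy (U n) \<le> Q"
  shows "\<exists>k. strict_mono (k :: nat \<Rightarrow> nat) \<and>
    (\<forall>\<epsilon>>0. \<exists>N. \<forall>m\<ge>N. \<forall>n\<ge>N. \<forall>e\<in>bedges G. \<forall>x\<in>I e. norm (U (k m) e x - U (k n) e x) < \<epsilon>)"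
proof -
  have Q0: "0 \<le> Q"
    using Q[of 0] energy_nonneg[OF U[of 0]] by linarith
  obtain B where B1: "1 \<le> B" and
    "\<And>u e x. u \<in> H \<Longrightarrow> energy u \<le> Q \<Longrightarrow> e \<in> bedges G \<Longrightarrow> x \<in> I e \<Longrightarrow> norm (u e x) \<le> B"
    using core_uniform_bound[OF Q0] by blast
  then have bound: "norm (U n e x) \<le> B" if "e \<in> bedges G" "x \<in> I e" for n e x
    using U Q that by blast
  show ?thesis
  proof (rule Arzela_Ascoli_finite_family[where S = I and B = B])
    show "finite (bedges G)"
      by (rule finite_bedges)
    show "compact (I e)" if "e \<in> bedges G" for e
      using that by (simp add: edge_interval_def)
    show "norm (U n e x) \<le> B" if "e \<in> bedges G" "x \<in> I e" for n e x
      using bound that by blast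
  next
    fix e x \<epsilon> assume e: "e \<in> bedges G" and x: "x \<in> I e" and \<epsilon>: "0 < (\<epsilon>::real)"
    have Ie: "I e = {0..len G e}"
      using e by (simp add: edge_interval_def)
    have ee: "e \<in> edges G"
      using e bedges_subset by blast
    define L where "L = sqrt Q + B * sqrt (A_mass e (len G e)) + 1"
    have L: "1 \<le> L"
      using Q0 B1 A_mass_nonneg[of e "len G e"] by (simp add: L_def)
    have inc: "norm (U n e t - U n e s) \<le> L * sqrt (t - s)" if st: "s \<in> I e" "t \<in> I e" "s \<le> t" for n s t
    proof -
      have "norm (U n e t - U n e s) \<le> sqrt ((t - s) * energy (U n)) + B * sqrt ((t - s) * A_mass e (len G e))"
        by (rule increment_bound[OF U ee]) (use st Ie bound[OF e] in auto)
      also have "\<dots> \<le> sqrt ((t - s) * Q) + B * sqrt ((t - s) * A_mass e (len G e))"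
        using Q st by (intro add_right_mono real_sqrt_le_mono mult_left_mono) auto
      also have "\<dots> = (L - 1) * sqrt (t - s)"
        by (simp only: L_def real_sqrt_mult) (simp add: distrib_right)
      also have "\<dots> \<le> L * sqrt (t - s)"
        using st by (intro mult_right_mono) auto
      finally show ?thesis .
    qed
    have "norm (U n e x - U n e y) < \<epsilon>" if y: "y \<in> I e" "norm (x - y) < (\<epsilon> / L)\<^sup>2" for n y
    proof -
      have "norm (U n e x - U n e y) \<le> L * sqrt \<bar>x - y\<bar>"
      proof (cases "x \<le> y")
        case True
        then show ?thesis
          using inc[OF x y(1)] by (simp add: norm_minus_commute)
      next
        case False
        then show ?thesis
          using inc[OF y(1) x] by simp
      qed
      also have "\<dots> < L * sqrt ((\<epsilon> / L)\<^sup>2)"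
        using y(2) L by (intro mult_strict_left_mono real_sqrt_less_mono) auto
      also have "\<dots> = \<epsilon>"
        using L \<epsilon> by simp
      finally show ?thesis .
    qed
    then show "\<exists>d>0. \<forall>n y. y \<in> I e \<and> norm (x - y) < d \<longrightarrow> norm (U n e x - U n e y) < \<epsilon>"
      using L \<epsilon> by (intro exI[of _ "(\<epsilon> / L)\<^sup>2"]) auto
  qed
qed

section \<open>Completeness of the magnetic Sobolev space\<close>

lemma edge_segment:
  assumes e: "e \<in> edges G" and C: "bounded C" "C \<subseteq> I e"
  shows "\<exists>b>0. C \<subseteq> {0..b} \<and> {0..b} \<subseteq> I e"
proof (cases "e \<in> bedges G")
  case True
  then show ?thesis
    using C len_pos[OF True] by (intro exI[of _ "len G e"]) (auto simp: edge_interval_def)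
next
  case False
  obtain a where "0 < a" "\<And>x. x \<in> C \<Longrightarrow> norm x \<le> a"
    using C(1) bounded_pos by metis
  then show ?thesis
    using C(2) False by (intro exI[of _ a]) (force simp: edge_interval_def)
qed

text \<open>
  The interpolation estimate makes a function of zero mass vanish at every point, not merely almost
  everywhere.
\<close>

lemma zero_if_L2_zero:
  assumes u: "u \<in> H" and 0: "mass u = 0" and e: "e \<in> edges G" and x: "x \<in> I e"
  shows "u e x = 0"
proof -
  obtain b where b: "0 < b" "x \<in> {0..b}" "{0..b} \<subseteq> I e"
    using edge_segment[OF e, of "{x}"] x by auto
  obtain C where "norm (u e x) ^ 4 \<le> C * (mass u * energy u)"
    using sup_bound[OF e b(1,3)] u b(2) by blast
  then show ?thesis
    using 0 by simp
qed

lemma nonzero_on_iff: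
  assumes u: "u \<in> H"
  shows "nonzero_on G (edges G) u \<longleftrightarrow> 0 < mass u"
proof
  assume "nonzero_on G (edges G) u"
  then have "mass u \<noteq> 0"
    using zero_if_L2_zero[OF u] by (auto simp: nonzero_on_def)
  then show "0 < mass u"
    using L2_normsq_nonneg[of u] by simp
next
  assume "0 < mass u"
  show "nonzero_on G (edges G) u"
  proof (rule ccontr)
    assume "\<not> nonzero_on G (edges G) u"
    then have "(LINT x|M e. (norm (u e x))\<^sup>2) = 0" if "e \<in> edges G" for e
      using that by (intro integral_eq_zero_AE AE_I2) (auto simp: nonzero_on_def)
    then show False
      using \<open>0 < mass u\<close> by (simp add: L2_normsq_eq)
  qed
qed

lemma continuous_on_edge:
  assumes e: "e \<in> edges G"
    and c: "\<And>b. 0 < b \<Longrightarrow> {0..b} \<subseteq> I e \<Longrightarrow> continuous_on {0..b} f"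
  shows "continuous_on (I e) (f :: real \<Rightarrow> complex)"
proof (cases "e \<in> bedges G")
  case True
  then show ?thesis
    using c[of "len G e"] len_pos[OF True] by (simp add: edge_interval_def)
next
  case False
  then have Ie: "I e = {0..}"
    by (simp add: edge_interval_def)
  show ?thesis
    unfolding continuous_on_eq_continuous_within
  proof
    fix x assume x: "x \<in> I e"
    then have "continuous (at x within {0..x + 1}) f"
      using c[of "x + 1"] Ie by (auto simp: continuous_on_eq_continuous_within)
    moreover have "at x within {0..x + 1} = at x within I e"
    proof (rule at_within_nhd[of x "{..<x + 1}"])
      show "{0..x + 1} \<inter> {..<x + 1} - {x} = I e \<inter> {..<x + 1} - {x}"
        unfolding Ie by (rule set_eqI) auto
    qed simp_all
    ultimately show "continuous (at x within I e) f"
      by simp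
  qed
qed

lemma edge_L2_diff_le:
  assumes u: "u \<in> H" and v: "v \<in> H" and e: "e \<in> edges G"
  shows "(LINT x|M e. (norm (D u e x - D v e x))\<^sup>2) \<le> energy (lincomb 1 u (-1) v)"
    and "(LINT x|M e. (norm (weighted u e x - weighted v e x))\<^sup>2) \<le> energy (lincomb 1 u (-1) v)"
proof -
  let ?w = "lincomb 1 u (-1) v"
  let ?f = "\<lambda>e. (LINT x|M e. (norm (D ?w e x))\<^sup>2) + (LINT x|M e. (norm (weighted ?w e x))\<^sup>2)"
  have w: "?w \<in> H"
    by (rule H1_lincomb[OF u v])
  have "?f e \<le> energy ?w"
    unfolding energy_eq[OF w] by (rule member_le_sum) (use e finite_edges in auto)
  moreover have "(LINT x|M e. (norm (D u e x - D v e x))\<^sup>2) = (LINT x|M e. (norm (D ?w e x))\<^sup>2)"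
  proof (rule integral_cong_AE)
    show "(\<lambda>x. (norm (D u e x - D v e x))\<^sup>2) \<in> borel_measurable (M e)"
      using square_integrable_lincomb[OF H1_D[OF u e] H1_D[OF v e], of 1 "-1"]
      by (auto dest!: norm_square_measurable)
    show "(\<lambda>x. (norm (D ?w e x))\<^sup>2) \<in> borel_measurable (M e)"
      using H1_D[OF w e] by (auto dest!: norm_square_measurable)
    show "AE x in M e. (norm (D u e x - D v e x))\<^sup>2 = (norm (D ?w e x))\<^sup>2"
      using D_lincomb[OF u v e, of 1 "-1"] by eventually_elim simp
  qed
  moreover have "(LINT x|M e. (norm (weighted u e x - weighted v e x))\<^sup>2) = (LINT x|M e. (norm (weighted ?w e x))\<^sup>2)"
    by (simp add: weighted_lincomb)
  moreover have "0 \<le> (LINT x|M e. (norm (D ?w e x))\<^sup>2)" "0 \<le> (LINT x|M e. (norm (weighted ?w e x))\<^sup>2)"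
    by simp_all
  ultimately show "(LINT x|M e. (norm (D u e x - D v e x))\<^sup>2) \<le> energy ?w"
    "(LINT x|M e. (norm (weighted u e x - weighted v e x))\<^sup>2) \<le> energy ?w"
    by linarith+
qed

text \<open>
  What the limits of \<open>D(U\<^sub>n)\<close> and \<open>\<surd>V U\<^sub>n\<close> in \<open>L\<^sup>2\<close> and the locally uniform limit \<open>u\<close> of \<open>U\<^sub>n\<close> give
  together: \<open>i (d + A u)\<close> is a weak derivative of \<open>u\<close>, so \<open>D u = d\<close> and the convergence holds in the
  energy norm. Matching values at the vertices survive pointwise limits.
\<close>

lemma limit_in_H1:
  assumes U: "\<And>n. U n \<in> H"
    and unif: "\<And>e b. e \<in> edges G \<Longrightarrow> 0 < b \<Longrightarrow> {0..b} \<subseteq> I e \<Longrightarrow> uniform_limit {0..b} (\<lambda>n. U n e) (u e) sequentially"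
    and d: "\<And>e. e \<in> edges G \<Longrightarrow> square_integrable (M e) (d e)"
      "\<And>e. e \<in> edges G \<Longrightarrow> (\<lambda>n. LINT x|M e. (norm (D (U n) e x - d e x))\<^sup>2) \<longlonglongrightarrow> 0"
    and wu: "\<And>e. e \<in> edges G \<Longrightarrow> square_integrable (M e) (weighted u e)"
      "\<And>e. e \<in> edges G \<Longrightarrow> (\<lambda>n. LINT x|M e. (norm (weighted (U n) e x - weighted u e x))\<^sup>2) \<longlonglongrightarrow> 0"
  shows "u \<in> H" "(\<lambda>n. energy (lincomb 1 (U n) (-1) u)) \<longlonglongrightarrow> 0"
proof -
  have cont: "continuous_on (I e) (u e)" if e: "e \<in> edges G" for e
  proof (rule continuous_on_edge[OF e])
    fix b :: real assume b: "0 < b" "{0..b} \<subseteq> I e"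
    have "continuous_on {0..b} (U n e)" for n
      by (rule continuous_on_subset[OF H1_continuous[OF U e] b(2)])
    then show "continuous_on {0..b} (u e)"
      by (intro uniform_limit_theorem[OF _ unif[OF e b]]) auto
  qed
  have pointwise: "(\<lambda>n. U n e x) \<longlonglongrightarrow> u e x" if e: "e \<in> edges G" and x: "x \<in> I e" for e x
  proof -
    obtain b where b: "0 < b" "x \<in> {0..b}" "{0..b} \<subseteq> I e"
      using edge_segment[OF e, of "{x}"] x by auto
    show ?thesis
      by (rule tendsto_uniform_limitI[OF unif[OF e b(1,3)] b(2)])
  qed
  have umeas: "u e \<in> borel_measurable (M e)" if e: "e \<in> edges G" for e
    using cont[OF e] edge_interval_sets by (rule continuous_imp_measurable_on_sets_lebesgue)
  have usq: "square_integrable (M e) (u e)" if e: "e \<in> edges G" for e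
    by (rule square_integrable_if_weighted(1)[of e u, OF e umeas[OF e] wu(1)[OF e]])
  have uconv: "(\<lambda>n. LINT x|M e. (norm (U n e x - u e x))\<^sup>2) \<longlonglongrightarrow> 0" if e: "e \<in> edges G" for e
  proof (rule Lim_null_comparison[OF always_eventually wu(2)[OF e]], rule allI)
    fix n
    let ?z = "\<lambda>e x. U n e x - u e x"
    have zw: "weighted ?z e = (\<lambda>x. weighted (U n) e x - weighted u e x)"
      by (rule ext) (simp add: weighted_def algebra_simps)
    have "?z e \<in> borel_measurable (M e)"
      using H1_measurable[OF U e] umeas[OF e] by (rule borel_measurable_diff)
    moreover have "square_integrable (M e) (weighted ?z e)"
      using square_integrable_lincomb[OF H1_weighted[OF U e, of n] wu(1)[OF e], of 1 "-1"] by (simp add: zw)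
    ultimately have "(LINT x|M e. (norm (?z e x))\<^sup>2) \<le> (LINT x|M e. (norm (weighted ?z e x))\<^sup>2)"
      by (rule square_integrable_if_weighted(2)[of e ?z, OF e])
    then show "norm (LINT x|M e. (norm (U n e x - u e x))\<^sup>2) \<le> (LINT x|M e. (norm (weighted (U n) e x - weighted u e x))\<^sup>2)"
      by (simp add: zw)
  qed
  define w where "w e x = \<i> * d e x + \<i> * (complex_of_real (A e x) * u e x)" for e x
  have wd: "has_weak_deriv (I e) (u e) (w e)" if e: "e \<in> edges G" for e
  proof (rule has_weak_deriv_limit[where u = "\<lambda>n. U n e" and w = "\<lambda>n. weak_deriv (I e) (U n e)"])
    show "has_weak_deriv (I e) (U n e) (weak_deriv (I e) (U n e))" for n
      by (rule H1_weak_deriv[OF U e])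
    fix C assume C: "compact C" "C \<subseteq> interior (I e)"
    obtain b where b: "0 < b" "C \<subseteq> {0..b}" "{0..b} \<subseteq> I e"
      using edge_segment[OF e compact_imp_bounded[OF C(1)]] C(2) interior_subset by blast
    let ?N = "lebesgue_on {0..b}"
    have Cset: "C \<in> sets lebesgue"
      using C(1) by (simp add: borel_compact sets_completionI_sets)
    have sqN: "square_integrable ?N f" "(LINT x|?N. (norm (f x))\<^sup>2) \<le> (LINT x|M e. (norm (f x))\<^sup>2)"
      if "square_integrable (M e) f" for f
      using square_integrable_subset[OF that edge_interval_sets _ b(3)] by auto
    have L1: "integrable ?N (\<lambda>x. norm (f x))" "(LINT x|?N. norm (f x)) \<le> sqrt (b * (LINT x|M e. (norm (f x))\<^sup>2))"
      if f: "square_integrable (M e) f" for f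
    proof -
      show "integrable ?N (\<lambda>x. norm (f x))"
        using integral_norm_interval(1)[OF sqN(1)[OF f]] b(1) by simp
      have "(LINT x|?N. norm (f x))\<^sup>2 \<le> (b - 0) * (LINT x|?N. (norm (f x))\<^sup>2)"
        using integral_norm_interval(2)[OF sqN(1)[OF f]] b(1) by simp
      also have "\<dots> \<le> b * (LINT x|M e. (norm (f x))\<^sup>2)"
        using sqN(2)[OF f] b(1) by simp
      finally show "(LINT x|?N. norm (f x)) \<le> sqrt (b * (LINT x|M e. (norm (f x))\<^sup>2))"
        by (rule real_le_rsqrt)
    qed
    note Asq = A_square_integrable[OF e b(3) order_refl order_refl]
    have L1A: "integrable ?N (\<lambda>x. norm (complex_of_real (A e x)) * norm (f x))"
      "(LINT x|?N. norm (complex_of_real (A e x)) * norm (f x)) \<le> sqrt (A_mass e b * (LINT x|M e. (norm (f x))\<^sup>2))"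
      if f: "square_integrable (M e) f" for f
    proof -
      show "integrable ?N (\<lambda>x. norm (complex_of_real (A e x)) * norm (f x))"
        by (rule integrable_norm_mult[OF Asq(1) sqN(1)[OF f]])
      have "(LINT x|?N. norm (complex_of_real (A e x)) * norm (f x))\<^sup>2 \<le> A_mass e b * (LINT x|?N. (norm (f x))\<^sup>2)"
        using integral_norm_mult_le[OF Asq(1) sqN(1)[OF f]] by (simp add: A_mass_def)
      also have "\<dots> \<le> A_mass e b * (LINT x|M e. (norm (f x))\<^sup>2)"
        by (rule mult_left_mono[OF sqN(2)[OF f] A_mass_nonneg])
      finally show "(LINT x|?N. norm (complex_of_real (A e x)) * norm (f x)) \<le> sqrt (A_mass e b * (LINT x|M e. (norm (f x))\<^sup>2))"
        by (rule real_le_rsqrt)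
    qed
    have meas: "f \<in> borel_measurable ?N" if "square_integrable (M e) f" for f
      using sqN(1)[OF that] by (simp add: square_integrable_def)
    have measA: "(\<lambda>x. complex_of_real (A e x)) \<in> borel_measurable ?N"
      using Asq(1) by (simp add: square_integrable_def)
    have lebesgue_Icc: "{0..b} \<in> sets lebesgue"
      by simp
    have toC: "set_integrable lebesgue C f" "(LINT x:C|lebesgue. norm (f x)) \<le> (LINT x|?N. norm (f x))"
      if f: "integrable ?N f" for f :: "real \<Rightarrow> complex"
    proof -
      have fN: "set_integrable lebesgue {0..b} f"
        using f by (simp add: set_integrable_iff_lebesgue_on)
      then show fC: "set_integrable lebesgue C f"
        using b(2) Cset by (auto intro: set_integrable_subset)
      have "set_integrable lebesgue {0..b} (\<lambda>x. norm (f x))" "set_integrable lebesgue C (\<lambda>x. norm (f x))"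
        using set_integrable_norm[OF fN] set_integrable_norm[OF fC] by auto
      then show "(LINT x:C|lebesgue. norm (f x)) \<le> (LINT x|?N. norm (f x))"
        using b(2) unfolding set_lebesgue_integral_eq_lebesgue_on[symmetric, of "{0..b}", OF lebesgue_Icc]
        unfolding set_lebesgue_integral_def set_integrable_def by (intro integral_mono) (auto simp: indicator_def)
    qed
    have int_if: "integrable ?N f" if "square_integrable (M e) f" for f
      using L1(1)[OF that] meas[OF that] integrable_norm_iff by blast
    have intA_if: "integrable ?N (\<lambda>x. \<i> * d' x + \<i> * (complex_of_real (A e x) * f x))"
      if d': "square_integrable (M e) d'" and f: "square_integrable (M e) f" for d' f
    proof -
      have "integrable ?N (\<lambda>x. complex_of_real (A e x) * f x)"
      proof (rule Bochner_Integration.integrable_bound[OF L1A(1)[OF f]])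
        show "(\<lambda>x. complex_of_real (A e x) * f x) \<in> borel_measurable ?N"
          using measA meas[OF f] by (rule borel_measurable_times)
      qed (simp add: norm_mult)
      then show ?thesis
        using int_if[OF d'] by simp
    qed
    show "set_integrable lebesgue C (u e) \<and> set_integrable lebesgue C (w e)"
      unfolding w_def[abs_def] by (intro conjI toC int_if intA_if usq d(1) e)
    have diff: "square_integrable (M e) (\<lambda>x. f x - g x)" if "square_integrable (M e) f" "square_integrable (M e) g" for f g
      using square_integrable_lincomb[OF that, of 1 "-1"] by simp
    have Usq: "square_integrable (M e) (\<lambda>x. U n e x - u e x)" for n
      by (intro diff usq H1_square_integrable U e)
    have Dsq: "square_integrable (M e) (\<lambda>x. D (U n) e x - d e x)" for n
      by (intro diff d(1) H1_D U e)
    show "(\<lambda>n. LINT x:C|lebesgue. norm (U n e x - u e x)) \<longlonglongrightarrow> 0"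
    proof (rule Lim_null_comparison[OF always_eventually], rule allI)
      fix n
      have "0 \<le> (LINT x:C|lebesgue. norm (U n e x - u e x))"
        by (simp add: set_lebesgue_integral_def)
      then show "norm (LINT x:C|lebesgue. norm (U n e x - u e x)) \<le> sqrt (b * (LINT x|M e. (norm (U n e x - u e x))\<^sup>2))"
        using toC(2)[OF int_if[OF Usq]] L1(2)[OF Usq, of n] by (simp, meson order_trans)
      show "(\<lambda>n. sqrt (b * (LINT x|M e. (norm (U n e x - u e x))\<^sup>2))) \<longlonglongrightarrow> 0"
        using tendsto_real_sqrt[OF tendsto_mult_right_zero[OF uconv[OF e]]] by simp
    qed
    show "(\<lambda>n. LINT x:C|lebesgue. norm (weak_deriv (I e) (U n e) x - w e x)) \<longlonglongrightarrow> 0"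
    proof (rule Lim_null_comparison[OF always_eventually], rule allI)
      fix n
      let ?z = "\<lambda>x. \<i> * (D (U n) e x - d e x) + \<i> * (complex_of_real (A e x) * (U n e x - u e x))"
      have eq: "weak_deriv (I e) (U n e) x - w e x = ?z x" for x
        by (simp add: w_def D_mag_def algebra_simps)
      have zi: "integrable ?N ?z"
        by (rule intA_if[OF Dsq Usq])
      have "0 \<le> (LINT x:C|lebesgue. norm (?z x))"
        by (simp add: set_lebesgue_integral_def)
      moreover have "(LINT x:C|lebesgue. norm (?z x)) \<le> (LINT x|?N. norm (?z x))"
        by (rule toC(2)[OF zi])
      moreover have "(LINT x|?N. norm (?z x))
          \<le> (LINT x|?N. norm (D (U n) e x - d e x) + norm (complex_of_real (A e x)) * norm (U n e x - u e x))"
      proof (rule integral_mono)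
        show "integrable ?N (\<lambda>x. norm (?z x))"
          using zi by (rule integrable_norm)
        show "integrable ?N (\<lambda>x. norm (D (U n) e x - d e x) + norm (complex_of_real (A e x)) * norm (U n e x - u e x))"
          using L1(1)[OF Dsq] L1A(1)[OF Usq] by (rule Bochner_Integration.integrable_add)
        show "norm (?z x) \<le> norm (D (U n) e x - d e x) + norm (complex_of_real (A e x)) * norm (U n e x - u e x)" for x
          using norm_triangle_ineq[of "\<i> * (D (U n) e x - d e x)" "\<i> * (complex_of_real (A e x) * (U n e x - u e x))"]
          by (simp add: norm_mult)
      qed
      moreover have "\<dots> = (LINT x|?N. norm (D (U n) e x - d e x)) + (LINT x|?N. norm (complex_of_real (A e x)) * norm (U n e x - u e x))"
        using L1(1)[OF Dsq] L1A(1)[OF Usq] by (rule Bochner_Integration.integral_add)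
      ultimately show "norm (LINT x:C|lebesgue. norm (weak_deriv (I e) (U n e) x - w e x))
        \<le> sqrt (b * (LINT x|M e. (norm (D (U n) e x - d e x))\<^sup>2)) + sqrt (A_mass e b * (LINT x|M e. (norm (U n e x - u e x))\<^sup>2))"
        unfolding eq real_norm_def using L1(2)[OF Dsq, of n] L1A(2)[OF Usq, of n] by linarith
      show "(\<lambda>n. sqrt (b * (LINT x|M e. (norm (D (U n) e x - d e x))\<^sup>2)) + sqrt (A_mass e b * (LINT x|M e. (norm (U n e x - u e x))\<^sup>2))) \<longlonglongrightarrow> 0"
        using tendsto_add[OF tendsto_real_sqrt[OF tendsto_mult_right_zero[OF d(2)[OF e], of b]]
          tendsto_real_sqrt[OF tendsto_mult_right_zero[OF uconv[OF e], of "A_mass e b"]]] by simp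
    qed
  qed
  have Du: "AE x in M e. D u e x = d e x" if e: "e \<in> edges G" for e
    using D_of_weak_deriv[where u = u and e = e, OF wd[OF e]] by eventually_elim (simp add: w_def algebra_simps)
  have "continuous_on_graph G u"
  proof -
    have "\<forall>n. \<exists>val. (\<forall>e\<in>edges G. U n e 0 = val (src G e)) \<and> (\<forall>e\<in>bedges G. U n e (len G e) = val (tgt G e))"
    proof
      fix n
      show "\<exists>val. (\<forall>e\<in>edges G. U n e 0 = val (src G e)) \<and> (\<forall>e\<in>bedges G. U n e (len G e) = val (tgt G e))"
        using U[of n] unfolding H1_mag_def continuous_on_graph_def mem_Collect_eq by (elim conjE)
    qed
    from choice[OF this] obtain val where
      "\<forall>n. (\<forall>e\<in>edges G. U n e 0 = val n (src G e)) \<and> (\<forall>e\<in>bedges G. U n e (len G e) = val n (tgt G e))" ..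
    then have val: "\<And>n e. e \<in> edges G \<Longrightarrow> U n e 0 = val n (src G e)"
      "\<And>n e. e \<in> bedges G \<Longrightarrow> U n e (len G e) = val n (tgt G e)"
      by blast+
    have "u e 0 = lim (\<lambda>n. val n (src G e))" if e: "e \<in> edges G" for e
    proof -
      have "0 \<in> I e"
        using len_pos[of e] by (auto simp: edge_interval_def)
      then have "(\<lambda>n. U n e 0) \<longlonglongrightarrow> u e 0"
        by (rule pointwise[OF e])
      then have "(\<lambda>n. val n (src G e)) \<longlonglongrightarrow> u e 0"
        by (simp only: val(1)[OF e])
      then show ?thesis
        by (simp add: limI)
    qed
    moreover have "u e (len G e) = lim (\<lambda>n. val n (tgt G e))" if e: "e \<in> bedges G" for e
    proof -
      have "len G e \<in> I e" "e \<in> edges G"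
        using len_pos[OF e] e bedges_subset by (auto simp: edge_interval_def)
      then have "(\<lambda>n. U n e (len G e)) \<longlonglongrightarrow> u e (len G e)"
        by (intro pointwise)
      then have "(\<lambda>n. val n (tgt G e)) \<longlonglongrightarrow> u e (len G e)"
        by (simp only: val(2)[OF e])
      then show ?thesis
        by (simp add: limI)
    qed
    ultimately have "\<exists>val. (\<forall>e\<in>edges G. u e 0 = val (src G e)) \<and> (\<forall>e\<in>bedges G. u e (len G e) = val (tgt G e))"
      by (intro exI[of _ "\<lambda>v. lim (\<lambda>n. val n v)"] conjI ballI)
    then show ?thesis
      unfolding continuous_on_graph_def using cont by blast
  qed
  moreover have "square_integrable_on (I e) (D u e)" if e: "e \<in> edges G" for e
    unfolding square_integrable_on_iff[OF edge_interval_sets]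
    by (rule square_integrable_cong_AE[OF d(1)[OF e] Du[OF e]])
  moreover have "set_integrable lebesgue (I e) (\<lambda>x. V e x * (norm (u e x))\<^sup>2)" if e: "e \<in> edges G" for e
    using square_integrable_weighted_iff[of e u, OF e umeas[OF e]] wu(1)[OF e] by simp
  ultimately show u: "u \<in> H"
    unfolding H1_mag_def using wd by blast
  have "energy (lincomb 1 (U n) (-1) u)
      = (\<Sum>e\<in>edges G. (LINT x|M e. (norm (D (U n) e x - d e x))\<^sup>2) + (LINT x|M e. (norm (weighted (U n) e x - weighted u e x))\<^sup>2))" for n
    unfolding energy_eq[OF H1_lincomb[OF U u]]
  proof (rule sum.cong[OF refl])
    fix e assume e: "e \<in> edges G"
    have "(LINT x|M e. (norm (D (lincomb 1 (U n) (-1) u) e x))\<^sup>2) = (LINT x|M e. (norm (D (U n) e x - d e x))\<^sup>2)"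
    proof (rule integral_cong_AE)
      show "(\<lambda>x. (norm (D (lincomb 1 (U n) (-1) u) e x))\<^sup>2) \<in> borel_measurable (M e)"
        using H1_D[OF H1_lincomb[OF U u] e] by (auto dest!: norm_square_measurable)
      show "(\<lambda>x. (norm (D (U n) e x - d e x))\<^sup>2) \<in> borel_measurable (M e)"
        using square_integrable_lincomb[OF H1_D[OF U e, of n] d(1)[OF e], of 1 "-1"]
        by (auto dest!: norm_square_measurable)
      show "AE x in M e. (norm (D (lincomb 1 (U n) (-1) u) e x))\<^sup>2 = (norm (D (U n) e x - d e x))\<^sup>2"
        using D_lincomb[OF U[of n] u e, of 1 "-1"] Du[OF e] by eventually_elim simp
    qed
    then show "(LINT x|M e. (norm (D (lincomb 1 (U n) (-1) u) e x))\<^sup>2) + (LINT x|M e. (norm (weighted (lincomb 1 (U n) (-1) u) e x))\<^sup>2)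
      = (LINT x|M e. (norm (D (U n) e x - d e x))\<^sup>2) + (LINT x|M e. (norm (weighted (U n) e x - weighted u e x))\<^sup>2)"
      by (simp add: weighted_lincomb)
  qed
  moreover have "(\<lambda>n. \<Sum>e\<in>edges G. (LINT x|M e. (norm (D (U n) e x - d e x))\<^sup>2) + (LINT x|M e. (norm (weighted (U n) e x - weighted u e x))\<^sup>2)) \<longlonglongrightarrow> (\<Sum>e\<in>edges G. 0 + 0)"
    by (intro tendsto_sum tendsto_add d(2) wu(2))
  ultimately show "(\<lambda>n. energy (lincomb 1 (U n) (-1) u)) \<longlonglongrightarrow> 0"
    by simp
qed

text \<open>
  The estimate \<open>sup_bound\<close> turns convergence in energy into locally uniform convergence, while the
  Riesz-Fischer theorem supplies the limits of \<open>D(U\<^sub>n)\<close> and \<open>\<surd>V U\<^sub>n\<close>. The latter is \<open>\<surd>V u\<close> because a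
  subsequence converges almost everywhere.
\<close>

lemma H1_complete:
  assumes U: "\<And>n. U n \<in> H"
    and cauchy: "\<And>\<epsilon>. 0 < \<epsilon> \<Longrightarrow> \<exists>N. \<forall>m\<ge>N. \<forall>n\<ge>N. energy (lincomb 1 (U m) (-1) (U n)) < \<epsilon>"
  shows "\<exists>u\<in>H. (\<lambda>n. energy (lincomb 1 (U n) (-1) u)) \<longlonglongrightarrow> 0"
proof -
  have cauchy_le: "\<exists>N. \<forall>m\<ge>N. \<forall>n\<ge>N. q m n < \<epsilon>"
    if "0 < \<epsilon>" and q: "\<And>m n. q m n \<le> energy (lincomb 1 (U m) (-1) (U n))" for q \<epsilon>
    using cauchy[OF \<open>0 < \<epsilon>\<close>] q by (meson order_le_less_trans)
  have "\<forall>e\<in>edges G. \<exists>d. square_integrable (M e) d \<and> (\<lambda>n. LINT x|M e. (norm (D (U n) e x - d x))\<^sup>2) \<longlonglongrightarrow> 0"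
  proof
    fix e assume e: "e \<in> edges G"
    obtain d r where "square_integrable (M e) d" "(\<lambda>n. LINT x|M e. (norm (D (U n) e x - d x))\<^sup>2) \<longlonglongrightarrow> 0"
      "strict_mono (r::nat \<Rightarrow> nat)" "AE x in M e. (\<lambda>n. D (U (r n)) e x) \<longlonglongrightarrow> d x"
      by (rule Riesz_Fischer[of "M e" "\<lambda>n. D (U n) e", OF H1_D[OF U e] cauchy_le[OF _ edge_L2_diff_le(1)[OF U U e]]])
    then show "\<exists>d. square_integrable (M e) d \<and> (\<lambda>n. LINT x|M e. (norm (D (U n) e x - d x))\<^sup>2) \<longlonglongrightarrow> 0"
      by blast
  qed
  from bchoice[OF this] obtain d where
    "\<forall>e\<in>edges G. square_integrable (M e) (d e) \<and> (\<lambda>n. LINT x|M e. (norm (D (U n) e x - d e x))\<^sup>2) \<longlonglongrightarrow> 0" ..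
  then have d: "\<And>e. e \<in> edges G \<Longrightarrow> square_integrable (M e) (d e)"
    "\<And>e. e \<in> edges G \<Longrightarrow> (\<lambda>n. LINT x|M e. (norm (D (U n) e x - d e x))\<^sup>2) \<longlonglongrightarrow> 0"
    by blast+
  define u where "u e x = lim (\<lambda>n. U n e x)" for e x
  have unif: "uniform_limit {0..b} (\<lambda>n. U n e) (u e) sequentially"
    if e: "e \<in> edges G" and b: "0 < b" "{0..b} \<subseteq> I e" for e b
  proof -
    obtain C where C: "0 \<le> C" "\<And>v x. v \<in> H \<Longrightarrow> x \<in> {0..b} \<Longrightarrow> norm (v e x) ^ 4 \<le> C * (mass v * energy v)"
      using sup_bound[OF e b] by blast
    have "uniformly_Cauchy_on {0..b} (\<lambda>n. U n e)"
      unfolding uniformly_Cauchy_on_def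
    proof (intro allI impI)
      fix \<epsilon> :: real assume \<epsilon>: "0 < \<epsilon>"
      \<comment> \<open>For \<open>E \<le> 1\<close> the bound \<open>C E\<^sup>2\<close> of the fourth power is at most \<open>C E\<close>.\<close>
      define \<eta> where "\<eta> = min 1 (\<epsilon> ^ 4 / (C + 1))"
      have "0 < \<eta>"
        using C(1) \<epsilon> by (simp add: \<eta>_def)
      then obtain N where N: "\<And>m n. N \<le> m \<Longrightarrow> N \<le> n \<Longrightarrow> energy (lincomb 1 (U m) (-1) (U n)) < \<eta>"
        using cauchy by blast
      have "dist (U m e x) (U n e x) < \<epsilon>" if x: "x \<in> {0..b}" and mn: "N \<le> m" "N \<le> n" for x m n
      proof -
        let ?v = "lincomb 1 (U m) (-1) (U n)"
        let ?E = "energy ?v"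
        have v: "?v \<in> H"
          by (rule H1_lincomb[OF U U])
        have E: "0 \<le> ?E" "?E \<le> 1" "?E < \<epsilon> ^ 4 / (C + 1)"
          using N[OF mn] energy_nonneg[OF v] by (auto simp: \<eta>_def)
        have "norm (?v e x) ^ 4 \<le> C * (mass ?v * ?E)"
          by (rule C(2)[OF v x])
        also have "\<dots> \<le> C * (1 * ?E)"
          using E C(1) L2_le_energy[OF v] by (intro mult_left_mono mult_right_mono) auto
        also have "\<dots> \<le> (C + 1) * ?E"
          using E(1) by (simp add: algebra_simps)
        also have "\<dots> < \<epsilon> ^ 4"
          using E(3) C(1) by (simp add: field_simps)
        finally have "norm (?v e x) < \<epsilon>"
          using \<epsilon> power_less_imp_less_base[of "norm (?v e x)" 4 \<epsilon>] by simp
        then show ?thesis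
          by (simp add: lincomb_def dist_norm)
      qed
      then show "\<exists>N. \<forall>x\<in>{0..b}. \<forall>m\<ge>N. \<forall>n\<ge>N. dist (U m e x) (U n e x) < \<epsilon>"
        by blast
    qed
    then have "uniformly_convergent_on {0..b} (\<lambda>n. U n e)"
      by (rule Cauchy_uniformly_convergent)
    then show ?thesis
      by (simp add: uniformly_convergent_uniform_limit_iff u_def[abs_def])
  qed
  have pointwise: "(\<lambda>n. U n e x) \<longlonglongrightarrow> u e x" if e: "e \<in> edges G" and x: "x \<in> I e" for e x
  proof -
    obtain b where b: "0 < b" "x \<in> {0..b}" "{0..b} \<subseteq> I e"
      using edge_segment[OF e, of "{x}"] x by auto
    show ?thesis
      by (rule tendsto_uniform_limitI[OF unif[OF e b(1,3)] b(2)])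
  qed
  have wu: "square_integrable (M e) (weighted u e) \<and> (\<lambda>n. LINT x|M e. (norm (weighted (U n) e x - weighted u e x))\<^sup>2) \<longlonglongrightarrow> 0"
    if e: "e \<in> edges G" for e
  proof -
    obtain h r where h: "square_integrable (M e) h" "(\<lambda>n. LINT x|M e. (norm (weighted (U n) e x - h x))\<^sup>2) \<longlonglongrightarrow> 0"
      "strict_mono (r::nat \<Rightarrow> nat)" "AE x in M e. (\<lambda>n. weighted (U (r n)) e x) \<longlonglongrightarrow> h x"
      by (rule Riesz_Fischer[of "M e" "\<lambda>n. weighted (U n) e", OF H1_weighted[OF U e] cauchy_le[OF _ edge_L2_diff_le(2)[OF U U e]]])
    have "AE x in M e. weighted u e x = h x"
      using h(4) AE_space
    proof eventually_elim
      case (elim x)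
      have "(\<lambda>n. U n e x) \<longlonglongrightarrow> u e x"
        using pointwise[OF e] elim(2) by simp
      then have "(\<lambda>n. U (r n) e x) \<longlonglongrightarrow> u e x"
        using LIMSEQ_subseq_LIMSEQ[OF _ h(3)] by (auto simp: o_def)
      then have "(\<lambda>n. weighted (U (r n)) e x) \<longlonglongrightarrow> weighted u e x"
        unfolding weighted_def by (rule tendsto_mult_left)
      then show ?case
        using elim(1) LIMSEQ_unique by blast
    qed
    note ae = this
    have wsq: "square_integrable (M e) (weighted u e)"
      by (rule square_integrable_cong_AE[OF h(1) ae])
    have "(LINT x|M e. (norm (weighted (U n) e x - weighted u e x))\<^sup>2) = (LINT x|M e. (norm (weighted (U n) e x - h x))\<^sup>2)" for n
    proof (rule integral_cong_AE)
      show "(\<lambda>x. (norm (weighted (U n) e x - weighted u e x))\<^sup>2) \<in> borel_measurable (M e)"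
        using square_integrable_lincomb[OF H1_weighted[OF U e, of n] wsq, of 1 "-1"] by (auto dest!: norm_square_measurable)
      show "(\<lambda>x. (norm (weighted (U n) e x - h x))\<^sup>2) \<in> borel_measurable (M e)"
        using square_integrable_lincomb[OF H1_weighted[OF U e, of n] h(1), of 1 "-1"] by (auto dest!: norm_square_measurable)
      show "AE x in M e. (norm (weighted (U n) e x - weighted u e x))\<^sup>2 = (norm (weighted (U n) e x - h x))\<^sup>2"
        using ae by eventually_elim simp
    qed
    then show ?thesis
      using wsq h(2) by simp
  qed
  have "u \<in> H" "(\<lambda>n. energy (lincomb 1 (U n) (-1) u)) \<longlonglongrightarrow> 0"
    using limit_in_H1[of U u d, OF U unif d] wu by blast+
  then show ?thesis
    by blast
qed

end

section \<open>Minimization of a functional with a saturated nonlinearity\<close>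

context magnetic_graph
begin

lemma energy_expand:
  assumes "u \<in> H" "v \<in> H"
  shows "energy (lincomb (of_real a) u (of_real b) v)
    = a\<^sup>2 * energy u + 2 * a * b * Re (form u v) + b\<^sup>2 * energy v"
  using H1.expand_real[OF assms] assms H1_lincomb[OF assms] by (simp add: form_self)

lemma L2_expand:
  assumes "u \<in> L2_space G" "v \<in> L2_space G"
  shows "mass (lincomb (of_real a) u (of_real b) v)
    = a\<^sup>2 * mass u + 2 * a * b * Re (inner_L2 u v) + b\<^sup>2 * mass v"
  using L2.expand_real[OF assms] by (simp add: L2_inner_self)

definition scale :: "real \<Rightarrow> ('e \<Rightarrow> real \<Rightarrow> complex) \<Rightarrow> 'e \<Rightarrow> real \<Rightarrow> complex" where
  "scale c u = lincomb (of_real c) u (of_real 0) u"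

lemma scale_norms:
  assumes "u \<in> H"
  shows "scale c u \<in> H" "energy (scale c u) = c\<^sup>2 * energy u"
    "mass (scale c u) = c\<^sup>2 * mass u" "norm (scale c u e x) = \<bar>c\<bar> * norm (u e x)"
proof -
  show "scale c u \<in> H"
    unfolding scale_def by (rule H1_lincomb[OF assms assms])
  show "energy (scale c u) = c\<^sup>2 * energy u"
    unfolding scale_def using energy_expand[OF assms assms, of c 0] by simp
  show "mass (scale c u) = c\<^sup>2 * mass u"
    unfolding scale_def using L2_expand[OF H1_subset_L2 H1_subset_L2, OF assms assms, of c 0] by simp
  show "norm (scale c u e x) = \<bar>c\<bar> * norm (u e x)"
    by (simp add: scale_def lincomb_def norm_mult)
qed

lemma lambda1_le:
  assumes u: "u \<in> H"
  shows "lam1 * mass u \<le> energy u"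
proof (cases "mass u = 0")
  case True
  then show ?thesis
    using energy_nonneg[OF u] by simp
next
  case False
  then have pos: "0 < mass u"
    using L2_normsq_nonneg[of u] by simp
  have "lam1 \<le> energy u / mass u"
    unfolding lambda1_def
  proof (rule cInf_lower)
    show "energy u / mass u \<in> {energy u / mass u | u. u \<in> H \<and> nonzero_on G (edges G) u}"
      using u nonzero_on_iff[OF u] pos by auto
    show "bdd_below {energy u / mass u | u. u \<in> H \<and> nonzero_on G (edges G) u}"
      by (rule bdd_belowI[of _ 0]) (auto intro!: divide_nonneg_nonneg energy_nonneg L2_normsq_nonneg)
  qed
  then show ?thesis
    using pos by (simp add: field_simps)
qed

lemma lambda1_ge_1:
  assumes "cond_G G A V"
  shows "1 \<le> lam1"
proof -
  obtain \<phi> where \<phi>: "\<phi> \<in> H" "nonzero_on G (edges G) \<phi>"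
    "energy \<phi> / mass \<phi> = lam1"
    using assms unfolding cond_G_def by blast
  then have "0 < mass \<phi>"
    using nonzero_on_iff by blast
  then show ?thesis
    using L2_le_energy[OF \<phi>(1)] unfolding \<phi>(3)[symmetric] by simp
qed

lemma integrable_core:
  fixes f :: "real \<Rightarrow> 'b::{banach, second_countable_topology, euclidean_space}"
  assumes "e \<in> bedges G" "continuous_on (I e) f"
  shows "integrable (M e) f"
  using assms by (simp add: edge_interval_def continuous_imp_integrable_real)

lemma core_mass_le: "(\<Sum>e\<in>bedges G. LINT x|M e. (norm (f e x))\<^sup>2) \<le> mass f"
  unfolding L2_normsq_eq by (rule sum_mono2[OF finite_edges bedges_subset]) simp

end

text \<open>
  The nonlinear term \<open>|u|^(p-2) u\<close> is replaced by \<open>h(|u|\<^sup>2) u\<close> with \<open>h\<close> bounded, which makes the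
  functional bounded below on every sphere for every \<open>p\<close>. Monotonicity of \<open>h\<close> makes the primitive
  convex as a function of \<open>|u|\<^sup>2\<close>, and positivity makes it strictly profitable to be nonzero on the
  core.
\<close>

locale saturated_problem = magnetic_graph G A V
  for G :: "('v, 'e) metric_graph" and A V +
  fixes h :: "real \<Rightarrow> real" and L :: real
  assumes h_cont: "continuous_on {0..} h"
    and h_mono: "\<And>s t. 0 \<le> s \<Longrightarrow> s \<le> t \<Longrightarrow> h s \<le> h t"
    and h_nonneg: "\<And>s. 0 \<le> s \<Longrightarrow> 0 \<le> h s"
    and h_pos: "\<And>s. 0 < s \<Longrightarrow> 0 < h s"
    and h_le: "\<And>s. 0 \<le> s \<Longrightarrow> h s \<le> L"
begin

definition \<Gamma> :: "real \<Rightarrow> real" where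
  "\<Gamma> s = integral {0..s} h / 2"

lemma h_integrable: "0 \<le> a \<Longrightarrow> h integrable_on {a..b}"
  by (rule integrable_continuous_interval, rule continuous_on_subset[OF h_cont]) auto

lemma \<Gamma>_increment:
  assumes "0 \<le> a" "a \<le> b"
  shows "h a / 2 * (b - a) \<le> \<Gamma> b - \<Gamma> a" "\<Gamma> b - \<Gamma> a \<le> h b / 2 * (b - a)"
proof -
  have eq: "integral {0..a} h + integral {a..b} h = integral {0..b} h"
    using assms by (intro Henstock_Kurzweil_Integration.integral_combine h_integrable) auto
  have "integral {a..b} (\<lambda>_. h a) \<le> integral {a..b} h"
    using assms by (intro integral_le h_integrable h_mono) auto
  moreover have "integral {a..b} h \<le> integral {a..b} (\<lambda>_. h b)"
    using assms by (intro integral_le h_integrable h_mono) auto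
  ultimately have "h a * (b - a) \<le> integral {a..b} h" "integral {a..b} h \<le> h b * (b - a)"
    using assms by (simp_all add: mult.commute)
  then show "h a / 2 * (b - a) \<le> \<Gamma> b - \<Gamma> a" "\<Gamma> b - \<Gamma> a \<le> h b / 2 * (b - a)"
    using eq by (simp_all add: \<Gamma>_def field_simps)
qed

text \<open>
  Convexity in its tangent form: the slope \<open>h/2\<close> is nondecreasing.
\<close>

lemma \<Gamma>_convex:
  assumes "0 \<le> a" "0 \<le> b"
  shows "\<Gamma> a + h a / 2 * (b - a) \<le> \<Gamma> b"
proof (cases "a \<le> b")
  case True
  then show ?thesis
    using \<Gamma>_increment(1)[OF assms(1) True] by simp
next
  case False
  then have "b \<le> a"
    by simp
  from \<Gamma>_increment(2)[OF assms(2) this] show ?thesis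
    by (simp add: field_simps)
qed

lemma \<Gamma>_0 [simp]: "\<Gamma> 0 = 0"
  by (simp add: \<Gamma>_def)

lemma \<Gamma>_le:
  assumes "0 \<le> s"
  shows "2 * \<Gamma> s \<le> h s * s"
  using \<Gamma>_convex[OF assms order_refl] by (simp add: field_simps)

lemma \<Gamma>_nonneg:
  assumes "0 \<le> s"
  shows "0 \<le> \<Gamma> s"
proof -
  have "0 \<le> h 0 / 2 * (s - 0)"
    using h_nonneg[of 0] assms by simp
  then show ?thesis
    using \<Gamma>_convex[OF order_refl assms] by simp
qed

lemma \<Gamma>_pos:
  assumes "0 < s"
  shows "0 < \<Gamma> s"
proof -
  have "\<Gamma> (s / 2) + h (s / 2) / 2 * (s - s / 2) \<le> \<Gamma> s"
    using assms by (intro \<Gamma>_convex) auto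
  moreover have "0 \<le> \<Gamma> (s / 2)"
    using assms by (intro \<Gamma>_nonneg) auto
  moreover have "0 < h (s / 2) / 2 * (s - s / 2)"
    using assms h_pos[of "s / 2"] by simp
  ultimately show ?thesis
    by linarith
qed

lemma \<Gamma>_Lipschitz:
  assumes "0 \<le> a" "0 \<le> b"
  shows "\<bar>\<Gamma> a - \<Gamma> b\<bar> \<le> L * \<bar>a - b\<bar>"
proof -
  have *: "\<Gamma> t - \<Gamma> s \<le> L * (t - s)" "0 \<le> \<Gamma> t - \<Gamma> s" if "0 \<le> s" "s \<le> t" for s t
  proof -
    have "\<Gamma> t - \<Gamma> s \<le> h t / 2 * (t - s)"
      by (rule \<Gamma>_increment(2)[OF that])
    also have "\<dots> \<le> L * (t - s)"
      using that h_le[of t] h_nonneg[of t] by (intro mult_right_mono) auto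
    finally show "\<Gamma> t - \<Gamma> s \<le> L * (t - s)" .
    have "0 \<le> h s / 2 * (t - s)"
      using that h_nonneg[of s] by simp
    then show "0 \<le> \<Gamma> t - \<Gamma> s"
      using \<Gamma>_increment(1)[OF that] by linarith
  qed
  show ?thesis
    using *[of a b] *[of b a] assms by (cases "a \<le> b") (auto simp: abs_if algebra_simps)
qed

text \<open>
  The tangent at \<open>s\<close> evaluated at \<open>t s\<close>, together with \<open>2 \<Gamma>(s) \<le> h(s) s\<close>. It is this property that
  prevents a minimizing sequence from splitting its mass.
\<close>

lemma \<Gamma>_superlinear:
  assumes "0 \<le> s" "1 \<le> t"
  shows "t * \<Gamma> s \<le> \<Gamma> (t * s)"
proof -
  have "\<Gamma> s + h s / 2 * (t * s - s) \<le> \<Gamma> (t * s)"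
    using assms by (intro \<Gamma>_convex) auto
  moreover have "(t - 1) * \<Gamma> s \<le> (t - 1) * (h s * s / 2)"
    using \<Gamma>_le[OF assms(1)] assms(2) by (intro mult_left_mono) auto
  ultimately show ?thesis
    by (simp add: field_simps)
qed

lemma \<Gamma>_continuous: "continuous_on {0..} \<Gamma>"
proof -
  have "\<bar>L\<bar>-lipschitz_on {0..} \<Gamma>"
  proof (rule lipschitz_onI)
    fix a b :: real assume "a \<in> {0..}" "b \<in> {0..}"
    then have "\<bar>\<Gamma> a - \<Gamma> b\<bar> \<le> L * \<bar>a - b\<bar>"
      by (intro \<Gamma>_Lipschitz) auto
    also have "\<dots> \<le> \<bar>L\<bar> * \<bar>a - b\<bar>"
      by (intro mult_right_mono) auto
    finally show "dist (\<Gamma> a) (\<Gamma> b) \<le> \<bar>L\<bar> * dist a b"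
      by (simp add: dist_real_def)
  qed simp
  then show ?thesis
    by (rule lipschitz_on_continuous_on)
qed

definition nonlinear_part :: "('e \<Rightarrow> real \<Rightarrow> complex) \<Rightarrow> real" where
  "nonlinear_part u = (\<Sum>e\<in>bedges G. LINT x|M e. \<Gamma> ((norm (u e x))\<^sup>2))"

definition functional :: "('e \<Rightarrow> real \<Rightarrow> complex) \<Rightarrow> real" where
  "functional u = energy u / 2 - nonlinear_part u"

lemma \<Gamma>_integrable:
  assumes u: "u \<in> H" and e: "e \<in> bedges G"
  shows "integrable (M e) (\<lambda>x. \<Gamma> ((norm (u e x))\<^sup>2))"
proof (rule integrable_core[OF e])
  have "continuous_on (I e) (\<lambda>x. (norm (u e x))\<^sup>2)"
    using e bedges_subset by (intro continuous_intros H1_continuous u) auto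
  then show "continuous_on (I e) (\<lambda>x. \<Gamma> ((norm (u e x))\<^sup>2))"
    by (rule continuous_on_compose2[OF \<Gamma>_continuous]) auto
qed

lemma core_norm_integrable:
  assumes u: "u \<in> H" and e: "e \<in> bedges G"
  shows "integrable (M e) (\<lambda>x. (norm (u e x))\<^sup>2)"
  using H1_square_integrable[OF u] e bedges_subset by (auto simp: square_integrable_def)

lemma L_pos: "0 < L"
  using h_pos[of 1] h_le[of 1] by simp

lemma nonlinear_part_le:
  assumes u: "u \<in> H"
  shows "2 * nonlinear_part u \<le> L * mass u"
proof -
  have "2 * nonlinear_part u = (\<Sum>e\<in>bedges G. LINT x|M e. 2 * \<Gamma> ((norm (u e x))\<^sup>2))"
    by (simp add: nonlinear_part_def sum_distrib_left)
  also have "\<dots> \<le> (\<Sum>e\<in>bedges G. LINT x|M e. L * (norm (u e x))\<^sup>2)"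
  proof (intro sum_mono integral_mono)
    fix e x assume e: "e \<in> bedges G"
    show "integrable (M e) (\<lambda>x. 2 * \<Gamma> ((norm (u e x))\<^sup>2))"
      using \<Gamma>_integrable[OF u e] by simp
    show "integrable (M e) (\<lambda>x. L * (norm (u e x))\<^sup>2)"
      using core_norm_integrable[OF u e] by simp
    have "2 * \<Gamma> ((norm (u e x))\<^sup>2) \<le> h ((norm (u e x))\<^sup>2) * (norm (u e x))\<^sup>2"
      by (rule \<Gamma>_le) simp
    also have "\<dots> \<le> L * (norm (u e x))\<^sup>2"
      by (intro mult_right_mono h_le) auto
    finally show "2 * \<Gamma> ((norm (u e x))\<^sup>2) \<le> L * (norm (u e x))\<^sup>2" .
  qed
  also have "\<dots> = L * (\<Sum>e\<in>bedges G. LINT x|M e. (norm (u e x))\<^sup>2)"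
    by (simp add: sum_distrib_left)
  also have "\<dots> \<le> L * mass u"
    using L_pos by (intro mult_left_mono core_mass_le) auto
  finally show ?thesis .
qed

lemma nonlinear_part_pos:
  assumes u: "u \<in> H" and nz: "nonzero_on G (bedges G) u"
  shows "0 < nonlinear_part u"
proof -
  obtain e x where e: "e \<in> bedges G" and x: "x \<in> I e" "u e x \<noteq> 0"
    using nz by (auto simp: nonzero_on_def)
  let ?f = "\<lambda>x. \<Gamma> ((norm (u e x))\<^sup>2)"
  have Ie: "I e = {0..len G e}"
    using e by (simp add: edge_interval_def)
  have "continuous_on (I e) (\<lambda>x. (norm (u e x))\<^sup>2)"
    using e bedges_subset by (intro continuous_intros H1_continuous u) auto
  then have cont: "continuous_on {0..len G e} ?f"
    unfolding Ie by (rule continuous_on_compose2[OF \<Gamma>_continuous]) auto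
  have int: "integrable (M e) ?f"
    by (rule \<Gamma>_integrable[OF u e])
  have eq: "(LINT x|M e. ?f x) = integral {0..len G e} ?f"
    using int unfolding Ie by (simp add: lebesgue_integral_eq_integral)
  have ge0: "0 \<le> ?f y" for y
    by (rule \<Gamma>_nonneg) simp
  have "(LINT x|M e. ?f x) \<noteq> 0"
  proof
    assume "(LINT x|M e. ?f x) = 0"
    then have "integral {0..len G e} ?f = 0"
      using eq by simp
    then have "?f x = 0"
      using integral_eq_0_iff[OF cont _ ge0] len_pos[OF e] x(1) Ie by simp
    then show False
      using \<Gamma>_pos[of "(norm (u e x))\<^sup>2"] x(2) by simp
  qed
  moreover have nn: "0 \<le> (LINT x|M e'. \<Gamma> ((norm (u e' x))\<^sup>2))" for e'
    by (intro integral_nonneg_AE AE_I2 \<Gamma>_nonneg) simp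
  ultimately have "0 < (LINT x|M e. ?f x)"
    by (metis order_le_less)
  also have "\<dots> \<le> nonlinear_part u"
    unfolding nonlinear_part_def using e finite_bedges nn
    by (intro member_le_sum[where f = "\<lambda>e. LINT x|M e. \<Gamma> ((norm (u e x))\<^sup>2)"]) auto
  finally show ?thesis .
qed

lemma nonlinear_part_nonneg: "0 \<le> nonlinear_part u"
  unfolding nonlinear_part_def by (intro sum_nonneg integral_nonneg_AE AE_I2 \<Gamma>_nonneg) simp

lemma nonlinear_part_zero:
  assumes "u \<in> H" "mass u = 0"
  shows "nonlinear_part u = 0"
  using nonlinear_part_le[OF assms(1)] assms(2) nonlinear_part_nonneg[of u] by simp

lemma functional_scale_le:
  assumes u: "u \<in> H" and c: "1 \<le> c"
  shows "functional (scale c u) \<le> c\<^sup>2 * functional u"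
proof -
  have "c\<^sup>2 * nonlinear_part u = (\<Sum>e\<in>bedges G. LINT x|M e. c\<^sup>2 * \<Gamma> ((norm (u e x))\<^sup>2))"
    by (simp add: nonlinear_part_def sum_distrib_left)
  also have "\<dots> \<le> nonlinear_part (scale c u)"
    unfolding nonlinear_part_def
  proof (intro sum_mono integral_mono)
    fix e x assume e: "e \<in> bedges G"
    show "integrable (M e) (\<lambda>x. c\<^sup>2 * \<Gamma> ((norm (u e x))\<^sup>2))"
      using \<Gamma>_integrable[OF u e] by simp
    show "integrable (M e) (\<lambda>x. \<Gamma> ((norm (scale c u e x))\<^sup>2))"
      by (rule \<Gamma>_integrable[OF scale_norms(1)[OF u] e])
    have "c\<^sup>2 * \<Gamma> ((norm (u e x))\<^sup>2) \<le> \<Gamma> (c\<^sup>2 * (norm (u e x))\<^sup>2)"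
      using c by (intro \<Gamma>_superlinear) (auto simp: one_le_power)
    then show "c\<^sup>2 * \<Gamma> ((norm (u e x))\<^sup>2) \<le> \<Gamma> ((norm (scale c u e x))\<^sup>2)"
      by (simp add: scale_norms(4)[OF u] power_mult_distrib)
  qed
  finally show ?thesis
    unfolding functional_def scale_norms(2)[OF u] by (simp add: algebra_simps)
qed

lemma nonlinear_part_close:
  assumes u: "u \<in> H" and v: "v \<in> H" and "0 \<le> B" "0 \<le> \<eta>"
    and bound: "\<And>e x. e \<in> bedges G \<Longrightarrow> x \<in> I e \<Longrightarrow> norm (u e x) \<le> B \<and> norm (v e x) \<le> B \<and> norm (u e x - v e x) \<le> \<eta>"
  shows "\<bar>nonlinear_part u - nonlinear_part v\<bar> \<le> (2 * L * B * sum (len G) (bedges G)) * \<eta>"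
proof -
  have "\<bar>(LINT x|M e. \<Gamma> ((norm (u e x))\<^sup>2)) - (LINT x|M e. \<Gamma> ((norm (v e x))\<^sup>2))\<bar> \<le> (2 * L * B * \<eta>) * len G e"
    if e: "e \<in> bedges G" for e
  proof -
    have ie: "integrable (M e) (\<lambda>x. \<Gamma> ((norm (u e x))\<^sup>2) - \<Gamma> ((norm (v e x))\<^sup>2))"
      using \<Gamma>_integrable[OF u e] \<Gamma>_integrable[OF v e] by simp
    have fin: "finite_measure (M e)"
      using e by (simp add: edge_interval_def finite_measure_lebesgue_on)
    have "\<bar>(LINT x|M e. \<Gamma> ((norm (u e x))\<^sup>2)) - (LINT x|M e. \<Gamma> ((norm (v e x))\<^sup>2))\<bar>
        = \<bar>LINT x|M e. \<Gamma> ((norm (u e x))\<^sup>2) - \<Gamma> ((norm (v e x))\<^sup>2)\<bar>"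
      using \<Gamma>_integrable[OF u e] \<Gamma>_integrable[OF v e] by simp
    also have "\<dots> \<le> (LINT x|M e. \<bar>\<Gamma> ((norm (u e x))\<^sup>2) - \<Gamma> ((norm (v e x))\<^sup>2)\<bar>)"
      using integral_norm_bound[of "M e" "\<lambda>x. \<Gamma> ((norm (u e x))\<^sup>2) - \<Gamma> ((norm (v e x))\<^sup>2)"] by simp
    also have "\<dots> \<le> (LINT x|M e. 2 * L * B * \<eta>)"
    proof (rule integral_mono)
      show "integrable (M e) (\<lambda>x. \<bar>\<Gamma> ((norm (u e x))\<^sup>2) - \<Gamma> ((norm (v e x))\<^sup>2)\<bar>)"
        using ie by (rule integrable_abs)
      show "integrable (M e) (\<lambda>x. 2 * L * B * \<eta>)"
        by (rule finite_measure.integrable_const[OF fin])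
      fix x assume "x \<in> space (M e)"
      then have b: "norm (u e x) \<le> B" "norm (v e x) \<le> B" "norm (u e x - v e x) \<le> \<eta>"
        using bound[OF e] by auto
      have "\<bar>norm (u e x) - norm (v e x)\<bar> \<le> \<eta>"
        using norm_triangle_ineq3[of "u e x" "v e x"] b(3) by linarith
      moreover have "(norm (u e x))\<^sup>2 - (norm (v e x))\<^sup>2 = (norm (u e x) - norm (v e x)) * (norm (u e x) + norm (v e x))"
        by (simp add: power2_eq_square algebra_simps)
      ultimately have "\<bar>(norm (u e x))\<^sup>2 - (norm (v e x))\<^sup>2\<bar> \<le> \<eta> * (2 * B)"
        unfolding abs_mult using b \<open>0 \<le> \<eta>\<close> by (simp add: abs_mult mult_mono)
      then have "L * \<bar>(norm (u e x))\<^sup>2 - (norm (v e x))\<^sup>2\<bar> \<le> L * (\<eta> * (2 * B))"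
        using L_pos by (intro mult_left_mono) auto
      moreover have "\<bar>\<Gamma> ((norm (u e x))\<^sup>2) - \<Gamma> ((norm (v e x))\<^sup>2)\<bar> \<le> L * \<bar>(norm (u e x))\<^sup>2 - (norm (v e x))\<^sup>2\<bar>"
        by (rule \<Gamma>_Lipschitz) auto
      ultimately show "\<bar>\<Gamma> ((norm (u e x))\<^sup>2) - \<Gamma> ((norm (v e x))\<^sup>2)\<bar> \<le> 2 * L * B * \<eta>"
        by (simp add: algebra_simps)
    qed
    also have "\<dots> = (2 * L * B * \<eta>) * len G e"
      using e len_pos[OF e] by (simp add: edge_interval_def measure_restrict_space)
    finally show ?thesis .
  qed
  then have "\<bar>nonlinear_part u - nonlinear_part v\<bar> \<le> (\<Sum>e\<in>bedges G. (2 * L * B * \<eta>) * len G e)"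
    unfolding nonlinear_part_def sum_subtractf[symmetric] by (intro order_trans[OF sum_abs] sum_mono)
  then show ?thesis
    unfolding sum_distrib_left[symmetric] by (simp add: ac_simps)
qed

lemma functional_ge:
  assumes u: "u \<in> H"
  shows "energy u \<le> 2 * functional u + L * mass u"
  using nonlinear_part_le[OF u] by (simp add: functional_def)

definition ground_level :: "real \<Rightarrow> real" where
  "ground_level \<mu> = Inf (functional ` mass_sphere G A V \<mu>)"

lemma ground_level_le:
  assumes "u \<in> mass_sphere G A V \<mu>"
  shows "ground_level \<mu> \<le> functional u"
  unfolding ground_level_def
proof (rule cInf_lower)
  show "functional u \<in> functional ` mass_sphere G A V \<mu>"
    using assms by blast
  show "bdd_below (functional ` mass_sphere G A V \<mu>)"
  proof (rule bdd_belowI2)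
    fix w assume "w \<in> mass_sphere G A V \<mu>"
    then have "w \<in> H" "mass w = \<mu>"
      by (auto simp: mass_sphere_def)
    then show "- L * \<mu> / 2 \<le> functional w"
      using functional_ge[of w] energy_nonneg[of w] by simp
  qed
qed

text \<open>
  Inflating \<open>w\<close> to mass \<open>\<mu>\<close> multiplies the functional by at most the ratio of the masses.
\<close>

lemma ground_level_scaled_le:
  assumes \<mu>: "0 < \<mu>" and w: "w \<in> H" "mass w \<le> \<mu>"
  shows "mass w / \<mu> * ground_level \<mu> \<le> functional w"
proof (cases "mass w = 0")
  case True
  then show ?thesis
    using nonlinear_part_zero[OF w(1)] energy_nonneg[OF w(1)] by (simp add: functional_def)
next
  case False
  then have pos: "0 < mass w"
    using L2_normsq_nonneg[of w] by simp
  define c where "c = sqrt (\<mu> / mass w)"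
  have c: "1 \<le> c" "c\<^sup>2 = \<mu> / mass w"
    using pos w(2) \<mu> by (auto simp: c_def)
  have "scale c w \<in> mass_sphere G A V \<mu>"
    using scale_norms[OF w(1)] c(2) pos by (simp add: mass_sphere_def)
  then have "ground_level \<mu> \<le> c\<^sup>2 * functional w"
    using ground_level_le functional_scale_le[OF w(1) c(1)] order_trans by blast
  then show ?thesis
    using pos \<mu> unfolding c(2) by (simp add: field_simps)
qed

text \<open>
  A multiple of the ground state has energy \<open>\<lambda>\<^sub>1 \<mu>\<close>, and its nonlinear part is positive since it does not
  vanish on the core.
\<close>

lemma ground_level_less:
  assumes "cond_G G A V" "0 < \<mu>"
  shows "mass_sphere G A V \<mu> \<noteq> {}" "ground_level \<mu> < lam1 * \<mu> / 2"
proof -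
  obtain \<phi> where \<phi>: "\<phi> \<in> H" "nonzero_on G (edges G) \<phi>"
    "energy \<phi> / mass \<phi> = lam1" "nonzero_on G (bedges G) \<phi>"
    using assms(1) unfolding cond_G_def by blast
  have pos: "0 < mass \<phi>"
    using \<phi> nonzero_on_iff by blast
  define c where "c = sqrt (\<mu> / mass \<phi>)"
  have c: "c \<noteq> 0" "c\<^sup>2 = \<mu> / mass \<phi>"
    using pos assms(2) by (auto simp: c_def)
  let ?w = "scale c \<phi>"
  have w: "?w \<in> mass_sphere G A V \<mu>"
    using scale_norms[OF \<phi>(1)] c(2) pos by (simp add: mass_sphere_def)
  then show "mass_sphere G A V \<mu> \<noteq> {}"
    by blast
  have "nonzero_on G (bedges G) ?w"
    using \<phi>(4) c(1) scale_norms(4)[OF \<phi>(1), of c] unfolding nonzero_on_def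
    by (metis mult_eq_0_iff norm_eq_zero abs_eq_0)
  then have "0 < nonlinear_part ?w"
    using nonlinear_part_pos scale_norms(1)[OF \<phi>(1)] by blast
  moreover have "energy ?w = lam1 * \<mu>"
    unfolding scale_norms(2)[OF \<phi>(1)] c(2) \<phi>(3)[symmetric] by simp
  ultimately show "ground_level \<mu> < lam1 * \<mu> / 2"
    using ground_level_le[OF w] by (simp add: functional_def)
qed

end

section \<open>Existence of minimizers\<close>

context saturated_problem
begin

lemma parallelogram:
  assumes u: "u \<in> H" and v: "v \<in> H"
  shows "energy (lincomb (of_real (1/2)) u (of_real (1/2)) v)
      + energy (lincomb 1 u (-1) v) / 4 = (energy u + energy v) / 2"
    and "mass (lincomb (of_real (1/2)) u (of_real (1/2)) v)
      + mass (lincomb 1 u (-1) v) / 4 = (mass u + mass v) / 2"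
  using energy_expand[OF u v, of "1/2" "1/2"] energy_expand[OF u v, of 1 "-1"]
    L2_expand[OF H1_subset_L2[OF u] H1_subset_L2[OF v], of "1/2" "1/2"]
    L2_expand[OF H1_subset_L2[OF u] H1_subset_L2[OF v], of 1 "-1"]
  by (simp_all add: power2_eq_square field_simps)

text \<open>
  The compactness argument. Let \<open>M\<close> and \<open>m\<close> be the masses of \<open>(a+b)/2\<close> and \<open>(a-b)/2\<close>, so
  \<open>M + m = \<mu>\<close>, and let \<open>I\<close> be the ground level. On the core \<open>(a+b)/2\<close> is close to both \<open>a\<close> and \<open>b\<close>, so
  with the parallelogram law \<open>J((a+b)/2) + Q((a-b)/2)/2 \<le> I + t\<close> for some small \<open>t\<close>. Since
  \<open>J((a+b)/2) \<ge> (M/\<mu>) I\<close> and \<open>Q((a-b)/2) \<ge> \<lambda>\<^sub>1 m\<close>, this forces \<open>m (\<lambda>\<^sub>1/2 - I/\<mu>) \<le> t\<close>: the gap makes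
  \<open>m\<close> small, and then \<open>Q((a-b)/2)\<close> as well.
\<close>

lemma almost_minimizers_close:
  assumes \<mu>: "0 < \<mu>" and gap: "ground_level \<mu> < lam1 * \<mu> / 2"
    and a: "a \<in> mass_sphere G A V \<mu>" "functional a \<le> ground_level \<mu> + \<tau>"
    and b: "b \<in> mass_sphere G A V \<mu>" "functional b \<le> ground_level \<mu> + \<tau>"
    and B: "0 \<le> B" "0 \<le> \<eta>" "\<And>e x. e \<in> bedges G \<Longrightarrow> x \<in> I e \<Longrightarrow> norm (a e x) \<le> B \<and> norm (b e x) \<le> B \<and> norm (a e x - b e x) \<le> \<eta>"
  shows "energy (lincomb 1 a (-1) b)
    \<le> 8 * (1 + \<bar>ground_level \<mu>\<bar> / (lam1 * \<mu> / 2 - ground_level \<mu>))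
        * (\<tau> + 2 * L * B * sum (len G) (bedges G) * \<eta>)"
proof -
  let ?I = "ground_level \<mu>"
  let ?K = "2 * L * B * sum (len G) (bedges G)"
  let ?mid = "lincomb (of_real (1/2)) a (of_real (1/2)) b"
  let ?dif = "lincomb 1 a (-1) b"
  define t where "t = \<tau> + ?K * \<eta>"
  have aH: "a \<in> H" and bH: "b \<in> H" and am: "mass a = \<mu>" and bm: "mass b = \<mu>"
    using a b by (auto simp: mass_sphere_def)
  have midH: "?mid \<in> H" and difH: "?dif \<in> H"
    using aH bH H1_lincomb by blast+
  have mid_bound: "norm (?mid e x) \<le> B \<and> norm (a e x) \<le> B \<and> norm (?mid e x - a e x) \<le> \<eta>
      \<and> norm (b e x) \<le> B \<and> norm (?mid e x - b e x) \<le> \<eta>"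
    if ex: "e \<in> bedges G" "x \<in> I e" for e x
  proof -
    note Bx = B(3)[OF ex]
    have mid: "?mid e x = (a e x + b e x) / 2"
      by (simp add: lincomb_def field_simps)
    have "norm (?mid e x) = norm (a e x + b e x) / 2"
      unfolding mid by (simp add: norm_divide)
    moreover have "norm (a e x + b e x) \<le> norm (a e x) + norm (b e x)"
      by (rule norm_triangle_ineq)
    moreover have "?mid e x - a e x = - ((a e x - b e x) / 2)" "?mid e x - b e x = (a e x - b e x) / 2"
      unfolding mid by (simp_all add: field_simps)
    then have "norm (?mid e x - a e x) = norm (a e x - b e x) / 2" "norm (?mid e x - b e x) = norm (a e x - b e x) / 2"
      by (simp_all only: norm_minus_cancel norm_divide) simp_all
    ultimately show ?thesis
      using Bx B(2) by auto
  qed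
  have Na: "nonlinear_part a \<le> nonlinear_part ?mid + ?K * \<eta>"
    using nonlinear_part_close[OF midH aH B(1,2)] mid_bound by fastforce
  have Nb: "nonlinear_part b \<le> nonlinear_part ?mid + ?K * \<eta>"
    using nonlinear_part_close[OF midH bH B(1,2)] mid_bound by fastforce
  define M where "M = mass ?mid"
  define m where "m = mass ?dif / 4"
  define E where "E = energy ?dif / 4"
  have Mm: "M + m = \<mu>"
    using parallelogram(2)[OF aH bH] am bm by (simp add: M_def m_def)
  have m0: "0 \<le> m" "0 \<le> M"
    by (simp_all add: m_def M_def L2_normsq_nonneg)
  have fm: "functional ?mid + E / 2 \<le> ?I + t"
    using parallelogram(1)[OF aH bH] a(2) b(2) Na Nb
    by (simp add: functional_def E_def t_def field_simps)
  have Em: "lam1 * m \<le> E"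
    using lambda1_le[OF difH] by (simp add: E_def m_def)
  have "M / \<mu> * ?I \<le> functional ?mid"
    unfolding M_def by (rule ground_level_scaled_le[OF \<mu> midH]) (use Mm m0 in \<open>simp add: M_def\<close>)
  moreover have "M / \<mu> * ?I = ?I - m / \<mu> * ?I"
  proof -
    have "M = \<mu> - m"
      using Mm by simp
    then show ?thesis
      using \<mu> by (simp add: diff_divide_distrib left_diff_distrib)
  qed
  ultimately have key: "E / 2 \<le> t + m / \<mu> * ?I"
    using fm by linarith
  define \<gamma> where "\<gamma> = lam1 * \<mu> / 2 - ?I"
  have \<gamma>: "0 < \<gamma>"
    using gap by (simp add: \<gamma>_def)
  have "m / \<mu> * \<gamma> = lam1 * m / 2 - m / \<mu> * ?I"
    using \<mu> by (simp add: \<gamma>_def field_simps)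
  then have "m / \<mu> * \<gamma> \<le> t"
    using key Em by linarith
  then have m_le: "m / \<mu> \<le> t / \<gamma>"
    using \<gamma> by (simp add: pos_le_divide_eq)
  have "m / \<mu> * ?I \<le> m / \<mu> * \<bar>?I\<bar>"
    using m0 \<mu> by (intro mult_left_mono) auto
  also have "\<dots> \<le> t / \<gamma> * \<bar>?I\<bar>"
    by (rule mult_right_mono[OF m_le]) simp
  finally have "E / 2 \<le> t + t / \<gamma> * \<bar>?I\<bar>"
    using key by linarith
  also have "\<dots> = (1 + \<bar>?I\<bar> / \<gamma>) * t"
    by (simp add: algebra_simps)
  finally have "4 * E \<le> 8 * ((1 + \<bar>?I\<bar> / \<gamma>) * t)"
    by linarith
  moreover have "energy ?dif = 4 * E"
    by (simp add: E_def)
  ultimately show ?thesis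
    unfolding t_def[symmetric] \<gamma>_def[symmetric] by (simp only: mult.assoc)
qed

text \<open>
  A minimizing sequence that is uniformly Cauchy on the core is Cauchy in energy, by the preceding
  lemma; mass, energy and nonlinear part all pass to its limit.
\<close>

theorem minimizer_exists:
  assumes "cond_G G A V" and \<mu>: "0 < \<mu>"
  shows "\<exists>u\<in>mass_sphere G A V \<mu>. functional u = ground_level \<mu>"
proof -
  let ?I = "ground_level \<mu>"
  let ?S = "mass_sphere G A V \<mu>"
  note gl = ground_level_less[OF assms]
  have "\<exists>u\<in>?S. functional u < ?I + 1 / (real n + 1)" for n
  proof -
    have "Inf (functional ` ?S) < ?I + 1 / (real n + 1)"
      by (simp add: ground_level_def)
    then show ?thesis
      using cInf_lessD[of "functional ` ?S"] gl(1) by auto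
  qed
  then obtain U where U: "\<And>n. U n \<in> ?S" "\<And>n. functional (U n) < ?I + 1 / (real n + 1)"
    by metis
  have UH: "U n \<in> H" and Um: "mass (U n) = \<mu>" for n
    using U(1)[of n] by (auto simp: mass_sphere_def)
  define Q where "Q = 2 * (\<bar>?I\<bar> + 1) + L * \<mu>"
  have Q: "energy (U n) \<le> Q" for n
  proof -
    have "1 / (real n + 1) \<le> 1"
      by simp
    then have "functional (U n) \<le> \<bar>?I\<bar> + 1"
      using U(2)[of n] abs_ge_self[of ?I] by linarith
    then show ?thesis
      using functional_ge[OF UH[of n]] by (simp add: Q_def Um)
  qed
  have Q0: "0 \<le> Q"
    using \<mu> L_pos by (simp add: Q_def)
  obtain B where B: "1 \<le> B"
    "\<And>u e x. u \<in> H \<Longrightarrow> energy u \<le> Q \<Longrightarrow> e \<in> bedges G \<Longrightarrow> x \<in> I e \<Longrightarrow> norm (u e x) \<le> B"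
    using core_uniform_bound[OF Q0] by blast
  obtain k where k: "strict_mono (k :: nat \<Rightarrow> nat)"
    "\<And>\<epsilon>. 0 < \<epsilon> \<Longrightarrow> \<exists>N. \<forall>m\<ge>N. \<forall>n\<ge>N. \<forall>e\<in>bedges G. \<forall>x\<in>I e. norm (U (k m) e x - U (k n) e x) < \<epsilon>"
    using core_compactness[of U Q, OF UH Q] by blast
  define W where "W n = U (k n)" for n
  have WS: "W n \<in> ?S" and WH: "W n \<in> H" and Wm: "mass (W n) = \<mu>" and WB: "e \<in> bedges G \<Longrightarrow> x \<in> I e \<Longrightarrow> norm (W n e x) \<le> B" for n e x
    using U UH Um B(2)[OF UH Q] by (auto simp: W_def)
  have Wf: "functional (W n) \<le> ?I + 1 / (real n + 1)" for n
  proof -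
    have "1 / (real (k n) + 1) \<le> 1 / (real n + 1)"
      using seq_suble[OF k(1), of n] by (intro divide_left_mono) auto
    then show ?thesis
      using U(2)[of "k n"] by (simp add: W_def)
  qed
  define R where "R = 8 * (1 + \<bar>?I\<bar> / (lam1 * \<mu> / 2 - ?I))"
  have R: "0 < R"
    using gl(2) by (simp add: R_def add_pos_nonneg)
  define K where "K = 2 * L * B * sum (len G) (bedges G)"
  have len0: "0 \<le> sum (len G) (bedges G)"
    by (intro sum_nonneg less_imp_le len_pos)
  have K: "0 \<le> K"
    using L_pos B(1) len0 by (simp add: K_def)
  have "\<exists>N. \<forall>m\<ge>N. \<forall>n\<ge>N. energy (lincomb 1 (W m) (-1) (W n)) < \<epsilon>" if \<epsilon>: "0 < \<epsilon>" for \<epsilon>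
  proof -
    \<comment> \<open>Chosen so that \<open>R (\<eta> + K \<eta>) = \<epsilon> / 2\<close>.\<close>
    define \<eta> where "\<eta> = \<epsilon> / (2 * R * (K + 1))"
    have \<eta>: "0 < \<eta>"
      using \<epsilon> R K by (simp add: \<eta>_def)
    obtain N1 where N1: "\<And>n. N1 \<le> n \<Longrightarrow> 1 / (real n + 1) < \<eta>"
      using eventually_reciprocal_less[OF \<eta>] by blast
    obtain N2 where N2: "\<And>m n e x. N2 \<le> m \<Longrightarrow> N2 \<le> n \<Longrightarrow> e \<in> bedges G \<Longrightarrow> x \<in> I e \<Longrightarrow> norm (W m e x - W n e x) < \<eta>"
      using k(2)[OF \<eta>] unfolding W_def by blast
    have "energy (lincomb 1 (W m) (-1) (W n)) < \<epsilon>" if mn: "max N1 N2 \<le> m" "max N1 N2 \<le> n" for m n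
    proof -
      have "energy (lincomb 1 (W m) (-1) (W n)) \<le> R * (\<eta> + K * \<eta>)"
        unfolding R_def K_def
      proof (rule almost_minimizers_close[OF \<mu> gl(2) WS _ WS])
        show "functional (W m) \<le> ?I + \<eta>" "functional (W n) \<le> ?I + \<eta>"
          using Wf[of m] Wf[of n] N1[of m] N1[of n] mn by simp_all
        show "norm (W m e x) \<le> B \<and> norm (W n e x) \<le> B \<and> norm (W m e x - W n e x) \<le> \<eta>"
          if "e \<in> bedges G" "x \<in> I e" for e x
          using WB[OF that] N2[OF _ _ that, of m n] mn by (auto intro: less_imp_le)
      qed (use B(1) \<eta> in auto)
      also have "\<dots> = \<epsilon> / 2"
      proof -
        have "R * (\<eta> + K * \<eta>) = (R * (K + 1)) * \<eta>"
          by (simp add: algebra_simps)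
        moreover have "R * (K + 1) \<noteq> 0"
          using R K by auto
        then have "(R * (K + 1)) * \<eta> = \<epsilon> / 2"
          unfolding \<eta>_def by (simp add: divide_simps)
        ultimately show ?thesis
          by (simp only:)
      qed
      also have "\<dots> < \<epsilon>"
        using \<epsilon> by simp
      finally show ?thesis .
    qed
    then show ?thesis
      by blast
  qed
  from H1_complete[of W, OF WH this] obtain u where u: "u \<in> H"
    and conv: "(\<lambda>n. energy (lincomb 1 (W n) (-1) u)) \<longlonglongrightarrow> 0"
    by blast
  let ?z = "\<lambda>n. lincomb 1 (W n) (-1) u"
  have zH: "?z n \<in> H" for n
    by (rule H1_lincomb[OF WH u])
  have conv2: "(\<lambda>n. mass (?z n)) \<longlonglongrightarrow> 0"
    by (rule Lim_null_comparison[OF always_eventually conv]) (use L2_le_energy[OF zH] L2_normsq_nonneg in auto)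
  have "(\<lambda>n. Re (inner_L2 (W n) (W n))) \<longlonglongrightarrow> Re (inner_L2 u u)"
    by (rule L2.tendsto_form_diag[of W u, OF H1_subset_L2[OF WH] H1_subset_L2[OF u]])
      (use conv2 in \<open>simp add: L2_inner_self\<close>)
  then have "(\<lambda>n. \<mu>) \<longlonglongrightarrow> mass u"
    by (simp add: L2_inner_self Wm)
  then have um: "mass u = \<mu>"
    using LIMSEQ_unique tendsto_const by blast
  have "(\<lambda>n. Re (form (W n) (W n))) \<longlonglongrightarrow> Re (form u u)"
    by (rule H1.tendsto_form_diag[of W u, OF WH u]) (use conv zH in \<open>simp add: form_self\<close>)
  then have ue: "(\<lambda>n. energy (W n)) \<longlonglongrightarrow> energy u"
    using WH u by (simp add: form_self)
  have un: "(\<lambda>n. nonlinear_part (W n)) \<longlonglongrightarrow> nonlinear_part u"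
  proof (rule metric_LIMSEQ_I)
    fix r :: real assume r: "0 < r"
    obtain C where C: "0 \<le> C"
      "\<And>u e x. u \<in> H \<Longrightarrow> e \<in> bedges G \<Longrightarrow> x \<in> I e \<Longrightarrow> norm (u e x) ^ 4 \<le> C * (mass u * energy u)"
      using core_sup_bound by blast
    define K' where "K' = 2 * L * (B + 1) * sum (len G) (bedges G)"
    have K': "0 \<le> K'"
      using L_pos B(1) len0 by (simp add: K'_def)
    define \<eta> where "\<eta> = min 1 (r / (K' + 1))"
    have \<eta>: "0 < \<eta>" "\<eta> \<le> 1"
      using r K' by (auto simp: \<eta>_def)
    have "(\<lambda>n. C * (mass (?z n) * energy (?z n))) \<longlonglongrightarrow> C * (0 * 0)"
      by (intro tendsto_intros conv conv2)
    then have "\<forall>\<^sub>F n in sequentially. C * (mass (?z n) * energy (?z n)) < \<eta> ^ 4"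
      by (rule order_tendstoD) (use \<eta> in simp)
    then obtain N where N: "\<And>n. N \<le> n \<Longrightarrow> C * (mass (?z n) * energy (?z n)) < \<eta> ^ 4"
      unfolding eventually_sequentially by blast
    have "dist (nonlinear_part (W n)) (nonlinear_part u) < r" if n: "N \<le> n" for n
    proof -
      have close: "norm (W n e x - u e x) \<le> \<eta>" if "e \<in> bedges G" "x \<in> I e" for e x
      proof -
        have "norm (?z n e x) ^ 4 < \<eta> ^ 4"
          using C(2)[OF zH that, of n] N[OF n] by linarith
        then have "norm (?z n e x) < \<eta>"
          using \<eta> power_less_imp_less_base[of "norm (?z n e x)" 4 \<eta>] by simp
        then show ?thesis
          by (simp add: lincomb_def)
      qed
      have "\<bar>nonlinear_part (W n) - nonlinear_part u\<bar> \<le> K' * \<eta>"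
        unfolding K'_def
      proof (rule nonlinear_part_close[OF WH u])
        fix e x assume ex: "e \<in> bedges G" "x \<in> I e"
        have "norm (u e x) \<le> norm (W n e x) + norm (W n e x - u e x)"
          using norm_triangle_ineq2[of "u e x" "W n e x"] by (simp add: norm_minus_commute)
        then show "norm (W n e x) \<le> B + 1 \<and> norm (u e x) \<le> B + 1 \<and> norm (W n e x - u e x) \<le> \<eta>"
          using WB[OF ex, of n] close[OF ex] \<eta>(2) by linarith
      qed (use B(1) \<eta> in auto)
      also have "\<dots> \<le> K' * (r / (K' + 1))"
        using K' by (intro mult_left_mono) (auto simp: \<eta>_def)
      also have "\<dots> < r"
        using r K' by (simp add: field_simps)
      finally show ?thesis
        by (simp add: dist_real_def)
    qed
    then show "\<exists>no. \<forall>n\<ge>no. dist (nonlinear_part (W n)) (nonlinear_part u) < r"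
      by blast
  qed
  have lim1: "(\<lambda>n. functional (W n)) \<longlonglongrightarrow> functional u"
    unfolding functional_def using ue un by (intro tendsto_intros) auto
  have "(\<lambda>n. ?I + 1 / (real n + 1)) \<longlonglongrightarrow> ?I + 0"
    using LIMSEQ_inverse_real_of_nat by (intro tendsto_add tendsto_const) (simp add: inverse_eq_divide add.commute)
  then have "functional u \<le> ?I + 0"
    using lim1 Wf by (intro LIMSEQ_le[OF lim1]) auto
  moreover have "u \<in> ?S"
    using u um by (simp add: mass_sphere_def)
  ultimately show ?thesis
    using ground_level_le[of u \<mu>] by force
qed

section \<open>Minimizers solve a linear problem\<close>

text \<open>
  The form of the potential \<open>h(|u|\<^sup>2)\<close> on the core, with \<open>u\<close> frozen: the nonlinearity seen as a linear
  term.
\<close>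

definition potential :: "('e \<Rightarrow> real \<Rightarrow> complex) \<Rightarrow> ('e \<Rightarrow> real \<Rightarrow> complex) \<Rightarrow> ('e \<Rightarrow> real \<Rightarrow> complex) \<Rightarrow> complex" where
  "potential u v w = graph_integral G (bedges G) (\<lambda>e x. complex_of_real (h ((norm (u e x))\<^sup>2)) * v e x * cnj (w e x))"

lemma h_continuous_core:
  assumes u: "u \<in> H" and e: "e \<in> bedges G"
  shows "continuous_on (I e) (\<lambda>x. h ((norm (u e x))\<^sup>2))"
proof -
  have "continuous_on (I e) (\<lambda>x. (norm (u e x))\<^sup>2)"
    using e bedges_subset by (intro continuous_intros H1_continuous u) auto
  then show ?thesis
    by (rule continuous_on_compose2[OF h_cont]) auto
qed

lemma potential_integrable:
  assumes u: "u \<in> H" and v: "v \<in> H" and w: "w \<in> H" and e: "e \<in> bedges G"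
  shows "integrable (M e) (\<lambda>x. complex_of_real (h ((norm (u e x))\<^sup>2)) * v e x * cnj (w e x))"
  using e bedges_subset
  by (intro integrable_core[OF e] continuous_intros h_continuous_core[OF u e] H1_continuous v w) auto

lemma potential_self:
  "potential u v v = complex_of_real (\<Sum>e\<in>bedges G. LINT x|M e. h ((norm (u e x))\<^sup>2) * (norm (v e x))\<^sup>2)"
proof -
  have "(LINT x|M e. complex_of_real (h ((norm (u e x))\<^sup>2)) * v e x * cnj (v e x))
      = (LINT x|M e. complex_of_real (h ((norm (u e x))\<^sup>2) * (norm (v e x))\<^sup>2))" for e
    by (rule Bochner_Integration.integral_cong) (auto simp: complex_norm_square[symmetric] mult.assoc)
  then show ?thesis
    unfolding potential_def graph_integral_eq by (simp only: integral_complex_of_real of_real_sum)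
qed

lemma potential_hermitian_form:
  assumes u: "u \<in> H"
  shows "hermitian_form H (potential u)"
proof
  fix a b v v' w assume v: "v \<in> H" and v': "v' \<in> H" and w: "w \<in> H"
  have "(LINT x|M e. complex_of_real (h ((norm (u e x))\<^sup>2)) * lincomb a v b v' e x * cnj (w e x))
    = a * (LINT x|M e. complex_of_real (h ((norm (u e x))\<^sup>2)) * v e x * cnj (w e x))
      + b * (LINT x|M e. complex_of_real (h ((norm (u e x))\<^sup>2)) * v' e x * cnj (w e x))" if e: "e \<in> bedges G" for e
  proof -
    have "(LINT x|M e. complex_of_real (h ((norm (u e x))\<^sup>2)) * lincomb a v b v' e x * cnj (w e x))
      = (LINT x|M e. a * (complex_of_real (h ((norm (u e x))\<^sup>2)) * v e x * cnj (w e x))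
        + b * (complex_of_real (h ((norm (u e x))\<^sup>2)) * v' e x * cnj (w e x)))"
      by (rule Bochner_Integration.integral_cong) (auto simp: lincomb_def algebra_simps)
    then show ?thesis
      using potential_integrable[OF u v w e] potential_integrable[OF u v' w e] by simp
  qed
  then show "potential u (lincomb a v b v') w = a * potential u v w + b * potential u v' w"
    unfolding potential_def graph_integral_eq by (simp add: sum.distrib sum_distrib_left)
next
  fix v w
  have "(LINT x|M e. complex_of_real (h ((norm (u e x))\<^sup>2)) * w e x * cnj (v e x))
      = (LINT x|M e. cnj (complex_of_real (h ((norm (u e x))\<^sup>2)) * v e x * cnj (w e x)))" for e
    by (rule Bochner_Integration.integral_cong) (auto simp: ac_simps)
  then show "potential u w v = cnj (potential u v w)"
    unfolding potential_def graph_integral_eq by (simp only: Bochner_Integration.integral_cnj cnj_sum)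
next
  fix v
  show "0 \<le> Re (potential u v v)"
    unfolding potential_self Re_complex_of_real
    by (intro sum_nonneg integral_nonneg_AE AE_I2 mult_nonneg_nonneg h_nonneg) auto
qed (rule H1_lincomb)

text \<open>
  The tangent inequality for \<open>\<Gamma>\<close>, integrated over the core: it bounds the nonlinear part from below by
  a quadratic expression in \<open>w\<close>, with equality at \<open>u\<close>.
\<close>

lemma nonlinear_part_tangent:
  assumes u: "u \<in> H" and w: "w \<in> H"
  shows "2 * nonlinear_part u + (Re (potential u w w) - Re (potential u u u)) \<le> 2 * nonlinear_part w"
proof -
  have int: "integrable (M e) (\<lambda>x. h ((norm (u e x))\<^sup>2) * (norm (v e x))\<^sup>2)" if v: "v \<in> H" and e: "e \<in> bedges G" for v e
    using e bedges_subset
    by (intro integrable_core[OF e] continuous_intros h_continuous_core[OF u e] H1_continuous v) auto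
  have "2 * (LINT x|M e. \<Gamma> ((norm (u e x))\<^sup>2)) + ((LINT x|M e. h ((norm (u e x))\<^sup>2) * (norm (w e x))\<^sup>2)
      - (LINT x|M e. h ((norm (u e x))\<^sup>2) * (norm (u e x))\<^sup>2)) \<le> 2 * (LINT x|M e. \<Gamma> ((norm (w e x))\<^sup>2))"
    if e: "e \<in> bedges G" for e
  proof -
    have "(LINT x|M e. 2 * \<Gamma> ((norm (u e x))\<^sup>2) + (h ((norm (u e x))\<^sup>2) * (norm (w e x))\<^sup>2 - h ((norm (u e x))\<^sup>2) * (norm (u e x))\<^sup>2))
        \<le> (LINT x|M e. 2 * \<Gamma> ((norm (w e x))\<^sup>2))"
    proof (rule integral_mono)
      show "integrable (M e) (\<lambda>x. 2 * \<Gamma> ((norm (u e x))\<^sup>2) + (h ((norm (u e x))\<^sup>2) * (norm (w e x))\<^sup>2 - h ((norm (u e x))\<^sup>2) * (norm (u e x))\<^sup>2))"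
        using \<Gamma>_integrable[OF u e] int[OF w e] int[OF u e] by simp
      show "integrable (M e) (\<lambda>x. 2 * \<Gamma> ((norm (w e x))\<^sup>2))"
        using \<Gamma>_integrable[OF w e] by simp
      show "2 * \<Gamma> ((norm (u e x))\<^sup>2) + (h ((norm (u e x))\<^sup>2) * (norm (w e x))\<^sup>2 - h ((norm (u e x))\<^sup>2) * (norm (u e x))\<^sup>2)
          \<le> 2 * \<Gamma> ((norm (w e x))\<^sup>2)" for x
        using \<Gamma>_convex[of "(norm (u e x))\<^sup>2" "(norm (w e x))\<^sup>2"] by (simp add: field_simps)
    qed
    then show ?thesis
      using \<Gamma>_integrable[OF u e] \<Gamma>_integrable[OF w e] int[OF w e] int[OF u e] by simp
  qed
  then have "(\<Sum>e\<in>bedges G. 2 * (LINT x|M e. \<Gamma> ((norm (u e x))\<^sup>2)) + ((LINT x|M e. h ((norm (u e x))\<^sup>2) * (norm (w e x))\<^sup>2)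
      - (LINT x|M e. h ((norm (u e x))\<^sup>2) * (norm (u e x))\<^sup>2))) \<le> (\<Sum>e\<in>bedges G. 2 * (LINT x|M e. \<Gamma> ((norm (w e x))\<^sup>2)))"
    by (rule sum_mono)
  then show ?thesis
    unfolding potential_self Re_complex_of_real nonlinear_part_def
    by (simp only: sum.distrib sum_subtractf sum_distrib_left)
qed

text \<open>
  By the tangent inequality the minimizer \<open>u\<close> minimizes a quadratic form on the sphere, hence, by
  homogeneity, \<open>Q(w) - \<integral>\<^sub>K h(|u|\<^sup>2) |w|\<^sup>2 - \<lambda> |w|\<^sub>2\<^sup>2 \<ge> 0\<close> for every \<open>w\<close>, with equality at \<open>u\<close>. Along
  \<open>w = u + s v\<close> this is a nonnegative polynomial in \<open>s\<close> without constant term, so its linear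
  coefficient vanishes, which is the equation.
\<close>

theorem critical_point_exists:
  assumes cG: "cond_G G A V" and \<mu>: "0 < \<mu>"
  shows "\<exists>u lam. u \<in> mass_sphere G A V \<mu> \<and> lam < lam1 \<and> lam1 - L \<le> lam \<and>
    energy u \<le> (lam1 + L) * \<mu> \<and>
    (\<forall>v\<in>H. Re (form u v) - Re (potential u u v) = lam * Re (inner_L2 u v))"
proof -
  let ?E = "energy"
  let ?l1 = "lam1"
  obtain u where uS: "u \<in> mass_sphere G A V \<mu>" and umin: "functional u = ground_level \<mu>"
    using minimizer_exists[OF assms] by blast
  have u: "u \<in> H" and um: "mass u = \<mu>"
    using uS by (auto simp: mass_sphere_def)
  interpret P: hermitian_form H "potential u"
    by (rule potential_hermitian_form[OF u])
  define P where "P v = Re (potential u v v)" for v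
  define lam where "lam = (?E u - P u) / \<mu>"
  have lam: "lam * \<mu> = ?E u - P u"
    using \<mu> by (simp add: lam_def)
  have P_nonneg: "0 \<le> P v" if "v \<in> H" for v
    using P.nonneg[OF that] by (simp add: P_def)
  have P_le: "P v \<le> L * mass v" if v: "v \<in> H" for v
  proof -
    have "P v = (\<Sum>e\<in>bedges G. LINT x|M e. h ((norm (u e x))\<^sup>2) * (norm (v e x))\<^sup>2)"
      unfolding P_def potential_self by simp
    also have "\<dots> \<le> (\<Sum>e\<in>bedges G. LINT x|M e. L * (norm (v e x))\<^sup>2)"
    proof (intro sum_mono integral_mono)
      fix e x assume e: "e \<in> bedges G"
      show "integrable (M e) (\<lambda>x. h ((norm (u e x))\<^sup>2) * (norm (v e x))\<^sup>2)"
        using e bedges_subset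
        by (intro integrable_core[OF e] continuous_intros h_continuous_core[OF u e] H1_continuous v) auto
      show "integrable (M e) (\<lambda>x. L * (norm (v e x))\<^sup>2)"
        using core_norm_integrable[OF v e] by simp
      show "h ((norm (u e x))\<^sup>2) * (norm (v e x))\<^sup>2 \<le> L * (norm (v e x))\<^sup>2"
        by (intro mult_right_mono h_le) auto
    qed
    also have "\<dots> = L * (\<Sum>e\<in>bedges G. LINT x|M e. (norm (v e x))\<^sup>2)"
      by (simp add: sum_distrib_left)
    also have "\<dots> \<le> L * mass v"
      using L_pos by (intro mult_left_mono core_mass_le) auto
    finally show ?thesis .
  qed
  have N_le: "2 * nonlinear_part u \<le> P u"
  proof -
    have "2 * nonlinear_part u = (\<Sum>e\<in>bedges G. LINT x|M e. 2 * \<Gamma> ((norm (u e x))\<^sup>2))"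
      by (simp add: nonlinear_part_def sum_distrib_left)
    also have "\<dots> \<le> (\<Sum>e\<in>bedges G. LINT x|M e. h ((norm (u e x))\<^sup>2) * (norm (u e x))\<^sup>2)"
    proof (intro sum_mono integral_mono)
      fix e x assume e: "e \<in> bedges G"
      show "integrable (M e) (\<lambda>x. h ((norm (u e x))\<^sup>2) * (norm (u e x))\<^sup>2)"
        using e bedges_subset
        by (intro integrable_core[OF e] continuous_intros h_continuous_core[OF u e] H1_continuous u) auto
      show "integrable (M e) (\<lambda>x. 2 * \<Gamma> ((norm (u e x))\<^sup>2))"
        using \<Gamma>_integrable[OF u e] by simp
      show "2 * \<Gamma> ((norm (u e x))\<^sup>2) \<le> h ((norm (u e x))\<^sup>2) * (norm (u e x))\<^sup>2"
        by (rule \<Gamma>_le) simp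
    qed
    also have "\<dots> = P u"
      unfolding P_def potential_self by simp
    finally show ?thesis .
  qed
  have E_lt: "?E u < ?l1 * \<mu> + P u"
    using ground_level_less(2)[OF assms] umin N_le by (simp add: functional_def)
  have "lam * \<mu> < ?l1 * \<mu>"
    using E_lt lam by linarith
  then have 1: "lam < ?l1"
    using \<mu> by simp
  have Pu: "P u \<le> L * \<mu>"
    using P_le[OF u] um by simp
  have "?l1 * \<mu> \<le> ?E u"
    using lambda1_le[OF u] um by simp
  then have "(?l1 - L) * \<mu> \<le> lam * \<mu>"
    using Pu lam by (simp add: algebra_simps)
  then have 2: "?l1 - L \<le> lam"
    using \<mu> by simp
  have 3: "?E u \<le> (?l1 + L) * \<mu>"
    using E_lt Pu by (simp add: algebra_simps)
  have sphere_ineq: "lam * \<mu> \<le> ?E w - P w" if w: "w \<in> mass_sphere G A V \<mu>" for w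
  proof -
    have wH: "w \<in> H"
      using w by (simp add: mass_sphere_def)
    have "functional u \<le> functional w"
      using ground_level_le[OF w] umin by simp
    then show ?thesis
      using nonlinear_part_tangent[OF u wH] lam by (simp add: functional_def P_def)
  qed
  have ineq: "lam * mass w \<le> ?E w - P w" if w: "w \<in> H" for w
  proof (cases "mass w = 0")
    case True
    then show ?thesis
      using P_le[OF w] energy_nonneg[OF w] by simp
  next
    case False
    then have pos: "0 < mass w"
      using L2_normsq_nonneg[of w] by simp
    define c where "c = sqrt (\<mu> / mass w)"
    have c: "c\<^sup>2 = \<mu> / mass w"
      using pos \<mu> by (simp add: c_def)
    have "scale c w \<in> mass_sphere G A V \<mu>"
      using scale_norms[OF w] c pos by (simp add: mass_sphere_def)
    then have "lam * \<mu> \<le> ?E (scale c w) - P (scale c w)"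
      by (rule sphere_ineq)
    also have "P (scale c w) = c\<^sup>2 * P w"
      using P.expand_real[OF w w, of c 0] by (simp add: P_def scale_def)
    also have "?E (scale c w) - c\<^sup>2 * P w = \<mu> / mass w * (?E w - P w)"
      unfolding scale_norms(2)[OF w] c by (simp add: right_diff_distrib)
    finally have "\<mu> * (lam * mass w) \<le> \<mu> * (?E w - P w)"
      using pos by (simp add: field_simps)
    then show ?thesis
      using \<mu> by (simp only: mult_le_cancel_left_pos)
  qed
  have "Re (form u v) - Re (potential u u v) = lam * Re (inner_L2 u v)" if v: "v \<in> H" for v
  proof -
    let ?b = "Re (form u v) - Re (potential u u v) - lam * Re (inner_L2 u v)"
    let ?c = "?E v - P v - lam * mass v"
    have "?b\<^sup>2 \<le> 0 * ?c"
    proof (rule quadratic_nonneg_imp_discriminant)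
      fix s :: real
      let ?w = "lincomb (of_real 1) u (of_real s) v"
      have "lam * mass ?w \<le> ?E ?w - P ?w"
        by (rule ineq[OF H1_lincomb[OF u v]])
      then have "lam * (1\<^sup>2 * \<mu> + 2 * 1 * s * Re (inner_L2 u v) + s\<^sup>2 * mass v)
        \<le> (1\<^sup>2 * ?E u + 2 * 1 * s * Re (form u v) + s\<^sup>2 * ?E v)
          - (1\<^sup>2 * P u + 2 * 1 * s * Re (potential u u v) + s\<^sup>2 * P v)"
        unfolding P_def P.expand_real[OF u v] energy_expand[OF u v] L2_expand[OF H1_subset_L2[OF u] H1_subset_L2[OF v]] um .
      then show "0 \<le> 0 + 2 * s * ?b + s\<^sup>2 * ?c"
        using lam by (simp add: algebra_simps)
    qed
    then show ?thesis
      by simp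
  qed
  with uS 1 2 3 show ?thesis
    by blast
qed

end

section \<open>Test functions on an edge\<close>

text \<open>
  Integration by parts: the product of two test functions vanishes at the ends of a large interval.
\<close>

lemma test_function_has_weak_deriv:
  assumes \<phi>: "test_function (interior S) \<phi>"
  shows "has_weak_deriv S (\<lambda>x. complex_of_real (\<phi> x)) (\<lambda>x. complex_of_real (deriv \<phi> x))"
  unfolding has_weak_deriv_def
proof (intro conjI allI impI)
  obtain K where "compact K \<and> K \<subseteq> interior S \<and> (\<forall>x. x \<notin> K \<longrightarrow> \<phi> x = 0) \<and> (\<forall>x. x \<notin> K \<longrightarrow> deriv \<phi> x = 0)
    \<and> continuous_on UNIV \<phi> \<and> continuous_on UNIV (deriv \<phi>)"
    using test_function_cutoff[OF \<phi>] by (rule exE)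
  then have K: "compact K" "K \<subseteq> interior S" "\<And>x. x \<notin> K \<Longrightarrow> \<phi> x = 0" "\<And>x. x \<notin> K \<Longrightarrow> deriv \<phi> x = 0"
    "continuous_on UNIV \<phi>" "continuous_on UNIV (deriv \<phi>)"
    by blast+
  have int: "set_integrable lebesgue C (\<lambda>x. complex_of_real (f x))" if fc: "continuous_on UNIV f" and C: "compact C" for f :: "real \<Rightarrow> real" and C
  proof -
    obtain b where "C \<subseteq> cbox (- b) b"
      using bounded_subset_cbox_symmetric[OF compact_imp_bounded[OF C]] by blast
    then have ab: "C \<subseteq> {- b..b}"
      by simp
    have "C \<in> sets lebesgue"
      using C by (simp add: borel_compact sets_completionI_sets)
    moreover have "set_integrable lebesgue {- b..b} (\<lambda>x. complex_of_real (f x))"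
      by (intro absolutely_integrable_continuous_real continuous_intros continuous_on_subset[OF fc]) auto
    ultimately show ?thesis
      using ab by (rule_tac set_integrable_subset)
  qed
  {
    fix C assume "compact C \<and> C \<subseteq> interior S"
    then show "set_integrable lebesgue C (\<lambda>x. complex_of_real (\<phi> x))" "set_integrable lebesgue C (\<lambda>x. complex_of_real (deriv \<phi> x))"
      using int K by auto
  }
  fix \<psi> assume \<psi>: "test_function (interior S) \<psi>"
  obtain L where "compact L \<and> L \<subseteq> interior S \<and> (\<forall>x. x \<notin> L \<longrightarrow> \<psi> x = 0) \<and> (\<forall>x. x \<notin> L \<longrightarrow> deriv \<psi> x = 0)
    \<and> continuous_on UNIV \<psi> \<and> continuous_on UNIV (deriv \<psi>)"
    using test_function_cutoff[OF \<psi>] by (rule exE)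
  then have L: "compact L" "L \<subseteq> interior S" "\<And>x. x \<notin> L \<Longrightarrow> \<psi> x = 0" "\<And>x. x \<notin> L \<Longrightarrow> deriv \<psi> x = 0"
    "continuous_on UNIV \<psi>" "continuous_on UNIV (deriv \<psi>)"
    by blast+
  obtain a b where ab: "L \<subseteq> {a<..<b}" "a < b"
  proof -
    obtain R where "0 < R" "\<And>x. x \<in> L \<Longrightarrow> norm x \<le> R"
      using compact_imp_bounded[OF L(1)] bounded_pos by metis
    then have "L \<subseteq> {- R - 1<..<R + 1}" "- R - 1 < R + 1"
      by (auto simp: abs_le_iff) (smt (verit) real_norm_def)+
    then show ?thesis
      by (rule that)
  qed
  define F where "F x = deriv \<psi> x *\<^sub>R complex_of_real (\<phi> x) + \<psi> x *\<^sub>R complex_of_real (deriv \<phi> x)" for x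
  have "(F has_integral complex_of_real (\<psi> b * \<phi> b) - complex_of_real (\<psi> a * \<phi> a)) {a..b}"
  proof (rule fundamental_theorem_of_calculus)
    fix x
    have d: "(\<phi> has_real_derivative deriv \<phi> x) (at x)" "(\<psi> has_real_derivative deriv \<psi> x) (at x)"
      using smooth_deriv[of \<phi> 0 x] smooth_deriv[of \<psi> 0 x] \<phi> \<psi> by (auto simp: test_function_def)
    have "((\<lambda>x. \<psi> x * \<phi> x) has_real_derivative deriv \<psi> x * \<phi> x + deriv \<phi> x * \<psi> x) (at x within {a..b})"
      using DERIV_mult[OF d(2,1)] by (rule has_field_derivative_at_within)
    then have "((\<lambda>x. \<psi> x * \<phi> x) has_vector_derivative deriv \<psi> x * \<phi> x + deriv \<phi> x * \<psi> x) (at x within {a..b})"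
      by (simp add: has_real_derivative_iff_has_vector_derivative)
    then have "((\<lambda>x. complex_of_real (\<psi> x * \<phi> x)) has_vector_derivative complex_of_real (deriv \<psi> x * \<phi> x + deriv \<phi> x * \<psi> x)) (at x within {a..b})"
      by (rule bounded_linear.has_vector_derivative[OF bounded_linear_of_real])
    then show "((\<lambda>x. complex_of_real (\<psi> x * \<phi> x)) has_vector_derivative F x) (at x within {a..b})"
      by (simp add: F_def scaleR_conv_of_real mult.commute)
  qed (use ab in simp)
  moreover have "a \<notin> L" "b \<notin> L"
    using ab by auto
  then have "\<psi> a = 0" "\<psi> b = 0"
    by (blast intro: L(3))+
  ultimately have F0: "integral {a..b} F = 0"
    by (simp add: has_integral_iff)
  have Fi: "set_integrable lebesgue {a..b} F"
    unfolding F_def by (intro absolutely_integrable_continuous_real continuous_intros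
      continuous_on_subset[OF K(5)] continuous_on_subset[OF K(6)] continuous_on_subset[OF L(5)] continuous_on_subset[OF L(6)]) auto
  have "(LINT x:S|lebesgue. deriv \<psi> x *\<^sub>R complex_of_real (\<phi> x)) + (LINT x:S|lebesgue. \<psi> x *\<^sub>R complex_of_real (deriv \<phi> x))
      = (LINT x:S|lebesgue. F x)"
    unfolding F_def
    by (rule set_integral_add(2)[symmetric]; rule cutoff_integrable(1)[OF L(1,2)])
       (use L int[OF K(5) L(1)] int[OF K(6) L(1)] in auto)
  also have "\<dots> = (LINT x:{a..b}|lebesgue. F x)"
  proof -
    have "indicator S x *\<^sub>R F x = indicator {a..b} x *\<^sub>R F x" for x
    proof (cases "x \<in> L")
      case True
      then have "x \<in> S" "x \<in> {a..b}"
        using L(2) interior_subset[of S] ab(1) by (blast, auto)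
      then show ?thesis
        by simp
    next
      case False
      then show ?thesis
        by (simp add: F_def L(3,4))
    qed
    then show ?thesis
      unfolding set_lebesgue_integral_def by (rule Bochner_Integration.integral_cong[OF refl])
  qed
  also have "\<dots> = 0"
    using F0 Fi by (simp add: set_lebesgue_integral_eq_integral(2))
  finally show "(LINT x:S|lebesgue. deriv \<psi> x *\<^sub>R complex_of_real (\<phi> x)) = - (LINT x:S|lebesgue. \<psi> x *\<^sub>R complex_of_real (deriv \<phi> x))"
    by (simp add: add_eq_0_iff2)
qed

context magnetic_graph
begin

lemma H1_intro:
  assumes cont: "continuous_on_graph G u"
    and w: "\<And>e. e \<in> edges G \<Longrightarrow> has_weak_deriv (I e) (u e) (w e)"
    and D: "\<And>e. e \<in> edges G \<Longrightarrow> square_integrable (M e) (\<lambda>x. - \<i> * w e x - complex_of_real (A e x) * u e x)"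
    and V: "\<And>e. e \<in> edges G \<Longrightarrow> set_integrable lebesgue (I e) (\<lambda>x. V e x * (norm (u e x))\<^sup>2)"
  shows "u \<in> H"
proof -
  have "square_integrable_on (I e) (D u e)" if e: "e \<in> edges G" for e
    unfolding square_integrable_on_iff[OF edge_interval_sets]
    by (rule square_integrable_cong_AE[OF D[OF e] D_of_weak_deriv[where u = u and e = e, OF w[OF e]]])
  then show ?thesis
    unfolding H1_mag_def using cont w V by blast
qed

lemma zero_in_H1: "(\<lambda>e x. 0) \<in> H"
proof (rule H1_intro[where w = "\<lambda>e x. 0"])
  show "has_weak_deriv (I e) (\<lambda>x. 0) (\<lambda>x. 0)" for e
    by (auto simp: has_weak_deriv_def set_integrable_def)
qed (auto simp: continuous_on_graph_def square_integrable_def set_integrable_def)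

text \<open>
  A test function on one edge, extended by zero. \<open>A\<close> and \<open>V\<close> are only locally integrable, but they are
  multiplied by a bounded function of compact support.
\<close>

lemma test_function_in_H1:
  assumes e0: "e0 \<in> edges G" and \<phi>: "test_function (interior (I e0)) \<phi>"
  shows "(\<lambda>e x. if e = e0 then complex_of_real (\<phi> x) else 0) \<in> H"
proof -
  let ?u = "\<lambda>e x. if e = e0 then complex_of_real (\<phi> x) else 0"
  let ?S = "I e0"
  obtain K where "compact K \<and> K \<subseteq> interior ?S \<and> (\<forall>x. x \<notin> K \<longrightarrow> \<phi> x = 0) \<and> (\<forall>x. x \<notin> K \<longrightarrow> deriv \<phi> x = 0)
    \<and> continuous_on UNIV \<phi> \<and> continuous_on UNIV (deriv \<phi>)"
    using test_function_cutoff[OF \<phi>] by (rule exE)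
  then have K: "compact K" "K \<subseteq> interior ?S" "\<And>x. x \<notin> K \<Longrightarrow> \<phi> x = 0" "\<And>x. x \<notin> K \<Longrightarrow> deriv \<phi> x = 0"
    "continuous_on UNIV \<phi>" "continuous_on UNIV (deriv \<phi>)"
    by blast+
  have Kset: "K \<in> sets lebesgue"
    using K(1) by (simp add: borel_compact sets_completionI_sets)
  obtain b where b: "0 < b" "K \<subseteq> {0..b}" "{0..b} \<subseteq> ?S"
    using edge_segment[OF e0 compact_imp_bounded[OF K(1)]] K(2) interior_subset by blast
  have int0: "0 \<notin> interior ?S" "e0 \<in> bedges G \<Longrightarrow> len G e0 \<notin> interior ?S"
    by (auto simp: edge_interval_def interior_real_atLeast)
  have \<phi>0: "\<phi> 0 = 0" "e0 \<in> bedges G \<Longrightarrow> \<phi> (len G e0) = 0"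
    using K(2,3) int0 by blast+
  note Asq = A_square_integrable[OF e0 b(3) order_refl order_refl]
  have KA: "set_integrable lebesgue K (\<lambda>x. complex_of_real (A e0 x))"
  proof -
    have "integrable (lebesgue_on {0..b}) (\<lambda>x. complex_of_real (A e0 x))"
      by (rule integrable_interval_if_square[OF Asq(1)]) (use b(1) in simp)
    then have "set_integrable lebesgue {0..b} (\<lambda>x. complex_of_real (A e0 x))"
      by (simp add: set_integrable_iff_lebesgue_on)
    then show ?thesis
      using Kset b(2) by (rule set_integrable_subset)
  qed
  have KA2: "set_integrable lebesgue K (\<lambda>x. complex_of_real ((A e0 x)\<^sup>2))"
  proof -
    have "integrable (lebesgue_on {0..b}) (\<lambda>x. (A e0 x)\<^sup>2)"
      using Asq(1) by (simp add: square_integrable_def)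
    then have "set_integrable lebesgue {0..b} (\<lambda>x. complex_of_real ((A e0 x)\<^sup>2))"
      by (simp add: set_integrable_iff_lebesgue_on del: of_real_power)
    then show ?thesis
      using Kset b(2) by (rule set_integrable_subset)
  qed
  have KV: "set_integrable lebesgue K (\<lambda>x. complex_of_real (V e0 x))"
  proof -
    have "bounded K" "K \<subseteq> ?S"
      using compact_imp_bounded[OF K(1)] b by auto
    then have "set_integrable lebesgue K (V e0)"
      using V_loc e0 Kset unfolding L1_loc_def by blast
    then show ?thesis
      using Kset by (simp add: set_integrable_iff_lebesgue_on)
  qed
  have K1: "set_integrable lebesgue K (\<lambda>x. 1 :: complex)"
    using compact_imp_bounded[OF K(1)] K(1) by (simp add: set_integrable_iff_lebesgue_on Kset finite_measure.integrable_const
       finite_measure_lebesgue_on lmeasurable_compact)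
  have cut: "integrable (M e0) (\<lambda>x. \<psi> x *\<^sub>R w x)"
    if "continuous_on UNIV \<psi>" "\<And>x. x \<notin> K \<Longrightarrow> \<psi> x = 0" "set_integrable lebesgue K w" for \<psi> :: "real \<Rightarrow> real" and w :: "real \<Rightarrow> complex"
    using cutoff_integrable(1)[OF K(1,2) that] by (simp add: set_integrable_iff_lebesgue_on edge_interval_sets)
  have cut_re: "integrable (M e0) (\<lambda>x. \<psi> x * g x)"
    if "continuous_on UNIV \<psi>" "\<And>x. x \<notin> K \<Longrightarrow> \<psi> x = 0" "set_integrable lebesgue K (\<lambda>x. complex_of_real (g x))" for \<psi> g :: "real \<Rightarrow> real"
  proof -
    have "integrable (M e0) (\<lambda>x. complex_of_real (\<psi> x * g x))"
      using cut[OF that] by (simp add: scaleR_conv_of_real)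
    then show ?thesis
      by (simp only: complex_of_real_integrable_eq)
  qed
  have sqA: "square_integrable (M e0) (\<lambda>x. complex_of_real (A e0 x) * complex_of_real (\<phi> x))"
    unfolding square_integrable_def
  proof
    have "integrable (M e0) (\<lambda>x. \<phi> x *\<^sub>R complex_of_real (A e0 x))"
      by (rule cut[OF K(5,3) KA])
    then show "(\<lambda>x. complex_of_real (A e0 x) * complex_of_real (\<phi> x)) \<in> borel_measurable (M e0)"
      by (auto dest!: borel_measurable_integrable simp: scaleR_conv_of_real mult.commute)
    have "integrable (M e0) (\<lambda>x. (\<phi> x)\<^sup>2 * (A e0 x)\<^sup>2)"
      by (rule cut_re[OF _ _ KA2]) (auto intro!: continuous_intros K)
    then show "integrable (M e0) (\<lambda>x. (norm (complex_of_real (A e0 x) * complex_of_real (\<phi> x)))\<^sup>2)"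
      by (simp add: norm_mult power_mult_distrib mult.commute)
  qed
  have sqd: "square_integrable (M e0) (\<lambda>x. complex_of_real (deriv \<phi> x))"
    unfolding square_integrable_def
  proof
    have "integrable (M e0) (\<lambda>x. deriv \<phi> x *\<^sub>R (1::complex))"
      by (rule cut[OF K(6,4) K1])
    then show "(\<lambda>x. complex_of_real (deriv \<phi> x)) \<in> borel_measurable (M e0)"
      by (auto dest!: borel_measurable_integrable simp: scaleR_conv_of_real)
    have "integrable (M e0) (\<lambda>x. (deriv \<phi> x)\<^sup>2 * 1)"
      by (rule cut_re) (use K1 in \<open>auto intro!: continuous_intros K\<close>)
    then show "integrable (M e0) (\<lambda>x. (norm (complex_of_real (deriv \<phi> x)))\<^sup>2)"
      by simp
  qed
  show ?thesis
  proof (rule H1_intro[where w = "\<lambda>e x. if e = e0 then complex_of_real (deriv \<phi> x) else 0"])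
    have "continuous_on (I e) (?u e)" for e
      using continuous_on_subset[OF K(5), of "I e"] by (cases "e = e0") (auto intro!: continuous_intros)
    then show "continuous_on_graph G ?u"
      unfolding continuous_on_graph_def using \<phi>0 by (intro conjI ballI exI[of _ "\<lambda>_. 0"]) auto
    show "has_weak_deriv (I e) (?u e) (\<lambda>x. if e = e0 then complex_of_real (deriv \<phi> x) else 0)" for e
      using test_function_has_weak_deriv[OF \<phi>] by (cases "e = e0") (auto simp: has_weak_deriv_def set_integrable_def)
    show "square_integrable (M e) (\<lambda>x. - \<i> * (if e = e0 then complex_of_real (deriv \<phi> x) else 0) - complex_of_real (A e x) * ?u e x)" for e
      using square_integrable_lincomb[OF sqd sqA, of "- \<i>" "- 1"] by (cases "e = e0") (auto simp: square_integrable_def)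
    show "set_integrable lebesgue (I e) (\<lambda>x. V e x * (norm (?u e x))\<^sup>2)" for e
    proof (cases "e = e0")
      case True
      have "integrable (M e0) (\<lambda>x. (\<phi> x)\<^sup>2 * V e0 x)"
        by (rule cut_re[OF _ _ KV]) (auto intro!: continuous_intros K)
      then show ?thesis
        using True by (simp add: set_integrable_iff_lebesgue_on edge_interval_sets mult.commute)
    qed (simp add: set_integrable_def)
  qed
qed

lemma L2_locally_integrable:
  assumes f: "square_integrable (M e) f" and e: "e \<in> edges G" and C: "compact C" "C \<subseteq> interior (I e)"
  shows "set_integrable lebesgue C f"
proof -
  obtain b where b: "0 < b" "C \<subseteq> {0..b}" "{0..b} \<subseteq> I e"
    using edge_segment[OF e compact_imp_bounded[OF C(1)]] C(2) interior_subset by blast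
  have f': "square_integrable (lebesgue_on {0..b}) f"
    by (rule square_integrable_subset(1)[OF f edge_interval_sets _ b(3)]) simp
  then have "integrable (lebesgue_on {0..b}) f"
    by (rule integrable_interval_if_square) (use b(1) in simp)
  then have "set_integrable lebesgue {0..b} f"
    by (simp add: set_integrable_iff_lebesgue_on)
  moreover have "C \<in> sets lebesgue"
    using C(1) by (simp add: borel_compact sets_completionI_sets)
  ultimately show ?thesis
    using b(2) by (rule_tac set_integrable_subset)
qed

text \<open>
  Density of the form domain in \<open>L\<^sup>2\<close>, in its dual form. It already contains enough functions supported
  on a single edge for the fundamental lemma to apply.
\<close>

lemma H1_orthogonal_imp_zero:
  assumes g: "g \<in> L2_space G" and orth: "\<And>v. v \<in> H \<Longrightarrow> inner_L2 g v = 0"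
  shows "ae_eq G g (\<lambda>e x. 0)"
  unfolding ae_eq_def
proof
  fix e0 assume e0: "e0 \<in> edges G"
  have "AE x in lebesgue. x \<in> interior (I e0) \<longrightarrow> g e0 x = 0"
  proof (rule fundamental_lemma)
    show "set_integrable lebesgue C (g e0)" if "compact C" "C \<subseteq> interior (I e0)" for C
      by (rule L2_locally_integrable[OF L2_spaceD[OF g e0] e0 that])
    fix \<phi> assume \<phi>: "test_function (interior (I e0)) \<phi>"
    let ?v = "\<lambda>e x. if e = e0 then complex_of_real (\<phi> x) else 0"
    have "0 = inner_L2 g ?v"
      using orth[OF test_function_in_H1[OF e0 \<phi>]] by simp
    also have "\<dots> = (\<Sum>e\<in>edges G. if e = e0 then (LINT x|M e0. g e0 x * cnj (complex_of_real (\<phi> x))) else 0)"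
      unfolding L2_inner_eq by (rule sum.cong) auto
    also have "\<dots> = (LINT x|M e0. g e0 x * cnj (complex_of_real (\<phi> x)))"
      using e0 finite_edges by simp
    also have "\<dots> = (LINT x|M e0. \<phi> x *\<^sub>R g e0 x)"
      by (rule Bochner_Integration.integral_cong) (auto simp: scaleR_conv_of_real mult.commute)
    finally show "(LINT t:I e0|lebesgue. \<phi> t *\<^sub>R g e0 t) = 0"
      by (simp add: set_lebesgue_integral_eq_lebesgue_on edge_interval_sets)
  qed
  then show "AE x in lebesgue. x \<in> I e0 \<longrightarrow> g e0 x = 0"
    using AE_edge_interior[of G e0] by eventually_elim auto
qed

section \<open>The operator of the magnetic form\<close>

lemma ae_eq_refl: "ae_eq G f f"
  by (simp add: ae_eq_def)

lemma ae_eq_sym: "ae_eq G f g \<Longrightarrow> ae_eq G g f"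
  unfolding ae_eq_def by (auto elim!: eventually_mono)

lemma ae_eq_trans: 
  assumes "ae_eq G f g" "ae_eq G g h" shows "ae_eq G f h"
  unfolding ae_eq_def
proof
  fix e assume "e \<in> edges G"
  then have "AE x in lebesgue. x \<in> I e \<longrightarrow> f e x = g e x" "AE x in lebesgue. x \<in> I e \<longrightarrow> g e x = h e x"
    using assms by (auto simp: ae_eq_def)
  then show "AE x in lebesgue. x \<in> I e \<longrightarrow> f e x = h e x"
    by eventually_elim auto
qed

lemma ae_eq_lincomb:
  assumes "ae_eq G f f'" "ae_eq G g g'" shows "ae_eq G (lincomb a f b g) (lincomb a f' b g')"
  unfolding ae_eq_def
proof
  fix e assume "e \<in> edges G"
  then have "AE x in lebesgue. x \<in> I e \<longrightarrow> f e x = f' e x" "AE x in lebesgue. x \<in> I e \<longrightarrow> g e x = g' e x"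
    using assms by (auto simp: ae_eq_def)
  then show "AE x in lebesgue. x \<in> I e \<longrightarrow> lincomb a f b g e x = lincomb a f' b g' e x"
    by eventually_elim (auto simp: lincomb_def)
qed

lemma L2_inner_cong:
  assumes f: "f \<in> L2_space G" "f' \<in> L2_space G" "g \<in> L2_space G" and eq: "ae_eq G f f'"
  shows "inner_L2 f g = inner_L2 f' g" "inner_L2 g f = inner_L2 g f'"
proof -
  show 1: "inner_L2 f g = inner_L2 f' g"
    unfolding L2_inner_eq
  proof (rule sum.cong[OF refl])
    fix e assume e: "e \<in> edges G"
    have "AE x in M e. f e x = f' e x"
      using eq e by (simp add: ae_eq_def AE_lebesgue_on edge_interval_sets)
    then show "(LINT x|M e. f e x * cnj (g e x)) = (LINT x|M e. f' e x * cnj (g e x))"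
      by (rule pairing_cong_AE[OF L2_spaceD[OF f(1) e] L2_spaceD[OF f(2) e] L2_spaceD[OF f(3) e]])
  qed
  show "inner_L2 g f = inner_L2 g f'"
    using 1 L2.hermitian[OF f(1,3)] L2.hermitian[OF f(2,3)] by simp
qed

lemma L2_normsq_cong:
  assumes f: "f \<in> L2_space G" "f' \<in> L2_space G" and eq: "ae_eq G f f'"
  shows "mass f = mass f'"
proof -
  have "inner_L2 f f = inner_L2 f' f'"
    using L2_inner_cong[OF f f(1) eq] L2_inner_cong[OF f f(2) eq] by simp
  then show ?thesis
    by (simp add: L2_inner_self)
qed

lemma ae_zero_if_L2_normsq_zero:
  assumes f: "f \<in> L2_space G" and 0: "mass f = 0"
  shows "ae_eq G f (\<lambda>e x. 0)"
  unfolding ae_eq_def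
proof
  fix e assume e: "e \<in> edges G"
  have "(LINT x|M e. (norm (f e x))\<^sup>2) = 0"
    using edge_L2_le[OF e, of f] 0 by (simp add: order_antisym)
  moreover have "integrable (M e) (\<lambda>x. (norm (f e x))\<^sup>2)"
    using L2_spaceD[OF f e] by (simp add: square_integrable_def)
  ultimately have "AE x in M e. (norm (f e x))\<^sup>2 = 0"
    by (subst (asm) integral_nonneg_eq_0_iff_AE) auto
  then show "AE x in lebesgue. x \<in> I e \<longrightarrow> f e x = 0"
    unfolding AE_lebesgue_on[OF edge_interval_sets] by eventually_elim auto
qed

lemma ae_eq_if_diff_zero:
  assumes "ae_eq G (lincomb 1 f (-1) g) (\<lambda>e x. 0)"
  shows "ae_eq G f g"
  using assms unfolding ae_eq_def by (auto simp: lincomb_def elim!: eventually_mono)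

lemma energy_zero_if_L2_zero:
  assumes z: "z \<in> H" and 0: "mass z = 0"
  shows "energy z = 0"
  unfolding energy_eq[OF z]
proof (rule sum.neutral, rule ballI)
  fix e assume e: "e \<in> edges G"
  have z0: "z e x = 0" if "x \<in> I e" for x
    by (rule zero_if_L2_zero[OF z 0 e that])
  have "AE x in lebesgue. x \<in> interior (I e) \<longrightarrow> weak_deriv (I e) (z e) x = 0"
    by (rule weak_deriv_of_zero[OF H1_weak_deriv[OF z e]]) (simp add: z0)
  then have "AE x in M e. weak_deriv (I e) (z e) x = 0"
    by (rule AE_lebesgue_on_edge)
  then have "AE x in M e. (norm (D z e x))\<^sup>2 = 0"
    using AE_space by eventually_elim (simp add: D_mag_def z0)
  then have "(LINT x|M e. (norm (D z e x))\<^sup>2) = 0"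
    by (rule integral_eq_zero_AE)
  moreover have "(LINT x|M e. (norm (weighted z e x))\<^sup>2) = 0"
    by (rule integral_eq_zero_AE, rule AE_I2) (simp add: weighted_def z0)
  ultimately show "(LINT x|M e. (norm (D z e x))\<^sup>2) + (LINT x|M e. (norm (weighted z e x))\<^sup>2) = 0"
    by simp
qed

lemma form_zero:
  assumes z: "z \<in> H" and v: "v \<in> H" and 0: "energy z = 0"
  shows "form z v = 0"
  using H1.Cauchy_Schwarz[OF z v] by (simp add: form_self z 0)

text \<open>
  The difference has zero mass, so it vanishes identically and its energy is zero.
\<close>

lemma form_ae_cong:
  assumes u: "u \<in> H" "u' \<in> H" and eq: "ae_eq G u u'" and v: "v \<in> H"
  shows "form u v = form u' v"
proof -
  let ?z = "lincomb 1 u (-1) u'"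
  have z: "?z \<in> H"
    by (rule H1_lincomb[OF u])
  have "ae_eq G ?z (lincomb 1 u (-1) u)"
    by (intro ae_eq_lincomb ae_eq_refl ae_eq_sym[OF eq])
  then have "mass ?z = mass (lincomb 1 u (-1) u)"
    by (intro L2_normsq_cong H1_subset_L2 z H1_lincomb u)
  also have "\<dots> = 0"
    by (simp add: lincomb_def L2_normsq_eq)
  finally have "form ?z v = 0"
    by (intro form_zero z v energy_zero_if_L2_zero)
  then show ?thesis
    using H1.linear[OF u v, of 1 "-1"] by simp
qed

text \<open>
  The Riesz representation theorem in the magnetic Sobolev space; \<open>v \<mapsto> \<langle>g, v\<rangle>\<close> is bounded there
  because the energy dominates the mass.
\<close>

lemma weak_solution_exists:
  assumes g: "g \<in> L2_space G"
  shows "\<exists>u\<in>H. \<forall>v\<in>H. form u v = inner_L2 g v"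
proof -
  obtain U where U: "\<And>n. U n \<in> H"
    "\<And>e. 0 < e \<Longrightarrow> \<exists>N. \<forall>m\<ge>N. \<forall>n\<ge>N. Re (form (lincomb 1 (U m) (-1) (U n)) (lincomb 1 (U m) (-1) (U n))) < e"
    "\<And>v. v \<in> H \<Longrightarrow> (\<lambda>n. form (U n) v) \<longlonglongrightarrow> inner_L2 g v"
  proof (rule H1.minimizing_sequence[OF zero_in_H1, of "inner_L2 g" "mass g"])
    show "inner_L2 g (lincomb a u b v) = cnj a * inner_L2 g u + cnj b * inner_L2 g v" if "u \<in> H" "v \<in> H" for a b u v
      by (rule L2.antilinear[OF H1_subset_L2[OF that(1)] H1_subset_L2[OF that(2)] g])
    show "0 \<le> mass g"
      by (rule L2_normsq_nonneg)
    show "(norm (inner_L2 g u))\<^sup>2 \<le> mass g * Re (form u u)" if u: "u \<in> H" for u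
    proof -
      have "(norm (inner_L2 g u))\<^sup>2 \<le> mass g * mass u"
        using L2.Cauchy_Schwarz[OF g H1_subset_L2[OF u]] by (simp add: L2_inner_self)
      also have "\<dots> \<le> mass g * Re (form u u)"
        using L2_le_energy[OF u] by (intro mult_left_mono L2_normsq_nonneg) (simp add: form_self u)
      finally show ?thesis .
    qed
  qed (rule that)
  have "\<exists>N. \<forall>m\<ge>N. \<forall>n\<ge>N. energy (lincomb 1 (U m) (-1) (U n)) < e" if "0 < e" for e
    using U(2)[OF that] by (simp add: form_self H1_lincomb U(1))
  from H1_complete[of U, OF U(1) this] obtain u where u: "u \<in> H"
    and conv: "(\<lambda>n. energy (lincomb 1 (U n) (-1) u)) \<longlonglongrightarrow> 0"
    by blast
  have "(\<lambda>n. form (U n) v) \<longlonglongrightarrow> form u v" if v: "v \<in> H" for v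
    by (rule H1.tendsto_form[of U u, OF U(1) u v]) (use conv in \<open>simp add: form_self H1_lincomb U(1) u\<close>)
  then show ?thesis
    using U(3) u LIMSEQ_unique by blast
qed

lemma L2_complete:
  assumes U: "\<And>n. U n \<in> L2_space G"
    and cauchy: "\<And>\<epsilon>. 0 < \<epsilon> \<Longrightarrow> \<exists>N. \<forall>m\<ge>N. \<forall>n\<ge>N. mass (lincomb 1 (U m) (-1) (U n)) < \<epsilon>"
  shows "\<exists>g\<in>L2_space G. (\<lambda>n. mass (lincomb 1 (U n) (-1) g)) \<longlonglongrightarrow> 0"
proof -
  have "\<forall>e\<in>edges G. \<exists>d. square_integrable (M e) d \<and> (\<lambda>n. LINT x|M e. (norm (U n e x - d x))\<^sup>2) \<longlonglongrightarrow> 0"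
  proof
    fix e assume e: "e \<in> edges G"
    have c: "\<exists>N. \<forall>m\<ge>N. \<forall>n\<ge>N. (LINT x|M e. (norm (U m e x - U n e x))\<^sup>2) < \<epsilon>" if "0 < \<epsilon>" for \<epsilon>
    proof -
      have "(LINT x|M e. (norm (U m e x - U n e x))\<^sup>2) \<le> mass (lincomb 1 (U m) (-1) (U n))" for m n
        using edge_L2_le[OF e, of "lincomb 1 (U m) (-1) (U n)"] by (simp add: lincomb_def)
      then show ?thesis
        using cauchy[OF that] by (meson order_le_less_trans)
    qed
    obtain d r where "square_integrable (M e) d" "(\<lambda>n. LINT x|M e. (norm (U n e x - d x))\<^sup>2) \<longlonglongrightarrow> 0"
      "strict_mono (r::nat \<Rightarrow> nat)" "AE x in M e. (\<lambda>n. U (r n) e x) \<longlonglongrightarrow> d x"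
      by (rule Riesz_Fischer[of "M e" "\<lambda>n. U n e", OF L2_spaceD[OF U e] c])
    then show "\<exists>d. square_integrable (M e) d \<and> (\<lambda>n. LINT x|M e. (norm (U n e x - d x))\<^sup>2) \<longlonglongrightarrow> 0"
      by blast
  qed
  from bchoice[OF this] obtain d where
    d: "\<forall>e\<in>edges G. square_integrable (M e) (d e) \<and> (\<lambda>n. LINT x|M e. (norm (U n e x - d e x))\<^sup>2) \<longlonglongrightarrow> 0" ..
  then have "d \<in> L2_space G"
    by (simp add: L2_space_def square_integrable_on_iff edge_interval_sets)
  moreover have "(\<lambda>n. mass (lincomb 1 (U n) (-1) d)) \<longlonglongrightarrow> (\<Sum>e\<in>edges G. 0)"
    unfolding L2_normsq_eq using d by (intro tendsto_sum) (simp add: lincomb_def)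
  ultimately show ?thesis
    by auto
qed

text \<open>
  The operator associated with the form, as a set of pairs of representatives. The first component
  need only agree almost everywhere with a function of the form domain, as a graph that is its own
  adjoint contains all representatives.
\<close>

definition form_op :: "'e graph_op" where
  "form_op = {(u, f). u \<in> L2_space G \<and> f \<in> L2_space G \<and>
     (\<exists>u'\<in>H. ae_eq G u u' \<and> (\<forall>v\<in>H. form u' v = inner_L2 f v))}"

lemma form_opD:
  assumes "(u, f) \<in> form_op"
  shows "u \<in> L2_space G" "f \<in> L2_space G"
    "\<exists>u'. u' \<in> H \<and> ae_eq G u u' \<and> (\<forall>v\<in>H. form u' v = inner_L2 f v)"
  using assms unfolding form_op_def by blast+

lemma form_opI:
  assumes "u \<in> H" "f \<in> L2_space G" "\<And>v. v \<in> H \<Longrightarrow> form u v = inner_L2 f v"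
  shows "(u, f) \<in> form_op"
  using assms H1_subset_L2 ae_eq_refl by (auto simp: form_op_def)

lemma form_op_lincomb:
  assumes "(u, f) \<in> form_op" "(v, g) \<in> form_op"
  shows "(lincomb a u b v, lincomb a f b g) \<in> form_op"
proof -
  obtain u' where u: "u' \<in> H" "ae_eq G u u'" "\<forall>w\<in>H. form u' w = inner_L2 f w"
    using form_opD(3)[OF assms(1)] by blast
  obtain v' where v: "v' \<in> H" "ae_eq G v v'" "\<forall>w\<in>H. form v' w = inner_L2 g w"
    using form_opD(3)[OF assms(2)] by blast
  have f: "f \<in> L2_space G" and g: "g \<in> L2_space G"
    using form_opD(2) assms by blast+
  have "form (lincomb a u' b v') w = inner_L2 (lincomb a f b g) w" if w: "w \<in> H" for w
    using H1.linear[OF u(1) v(1) w] L2.linear[OF f g H1_subset_L2[OF w]] u(3) v(3) w by simp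
  moreover have "ae_eq G (lincomb a u b v) (lincomb a u' b v')"
    by (rule ae_eq_lincomb[OF u(2) v(2)])
  moreover have "lincomb a u b v \<in> L2_space G" "lincomb a f b g \<in> L2_space G"
    using form_opD(1,2) assms L2_lincomb by blast+
  moreover have "lincomb a u' b v' \<in> H"
    by (rule H1_lincomb[OF u(1) v(1)])
  ultimately show ?thesis
    unfolding form_op_def by blast
qed

lemma form_op_symmetric:
  assumes "(u, f) \<in> form_op" "(v, g) \<in> form_op"
  shows "inner_L2 f v = inner_L2 u g"
proof -
  obtain u' where "u' \<in> H \<and> ae_eq G u u' \<and> (\<forall>v\<in>H. form u' v = inner_L2 f v)"
    using form_opD(3)[OF assms(1)] by (rule exE)
  then have u: "u \<in> L2_space G" "f \<in> L2_space G" "u' \<in> H" "ae_eq G u u'"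
    "\<And>v. v \<in> H \<Longrightarrow> form u' v = inner_L2 f v"
    using form_opD(1,2)[OF assms(1)] by blast+
  obtain v' where "v' \<in> H \<and> ae_eq G v v' \<and> (\<forall>w\<in>H. form v' w = inner_L2 g w)"
    using form_opD(3)[OF assms(2)] by (rule exE)
  then have v: "v \<in> L2_space G" "g \<in> L2_space G" "v' \<in> H" "ae_eq G v v'"
    "\<And>w. w \<in> H \<Longrightarrow> form v' w = inner_L2 g w"
    using form_opD(1,2)[OF assms(2)] by blast+
  have "inner_L2 f v = inner_L2 f v'"
    by (rule L2_inner_cong(2)[OF v(1) H1_subset_L2[OF v(3)] u(2) v(4)])
  also have "\<dots> = form u' v'"
    using u(5)[OF v(3)] by simp
  also have "\<dots> = cnj (form v' u')"
    by (rule H1.hermitian[OF v(3) u(3)])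
  also have "\<dots> = cnj (inner_L2 g u')"
    using v(5)[OF u(3)] by simp
  also have "\<dots> = inner_L2 u' g"
    by (rule L2.hermitian[OF v(2) H1_subset_L2[OF u(3)], symmetric])
  also have "\<dots> = inner_L2 u g"
    by (rule L2_inner_cong(1)[OF u(1) H1_subset_L2[OF u(3)] v(2) u(4), symmetric])
  finally show ?thesis .
qed

text \<open>
  Project \<open>g\<close> onto the closure of the domain and let \<open>z\<close> be the remainder. The weak solution \<open>w\<close> for
  the right-hand side \<open>z\<close> lies in the domain, so \<open>Q(w) = \<langle>z, w\<rangle> = 0\<close>. Hence \<open>w\<close> vanishes, \<open>z\<close> is
  orthogonal to the whole form domain, and \<open>z = 0\<close>.
\<close>

lemma form_op_densely_defined: "densely_defined G form_op"
  unfolding densely_defined_def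
proof (intro ballI allI impI)
  fix g and \<epsilon> :: real assume g: "g \<in> L2_space G" and \<epsilon>: "0 < \<epsilon>"
  define X where "X = {u. \<exists>f. (u, f) \<in> form_op}"
  have XL: "X \<subseteq> L2_space G"
    by (auto simp: X_def form_op_def)
  interpret X: hermitian_form X "inner_L2"
  proof
    fix a b u v assume "u \<in> X" "v \<in> X"
    then show "lincomb a u b v \<in> X"
      using form_op_lincomb unfolding X_def by blast
  qed (use XL in \<open>auto intro!: L2.linear L2.hermitian L2.nonneg\<close>)
  have zero: "(\<lambda>e x. 0) \<in> X"
  proof -
    have "form (\<lambda>e x. 0) v = inner_L2 (\<lambda>e x. 0) v" if v: "v \<in> H" for v
    proof -
      have "form (\<lambda>e x. 0) v = 0"
        by (intro form_zero zero_in_H1 v energy_zero_if_L2_zero) (simp add: L2_normsq_eq)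
      then show ?thesis
        by (simp add: L2_inner_eq)
    qed
    then have "((\<lambda>e x. 0), (\<lambda>e x. 0)) \<in> form_op"
      by (intro form_opI zero_in_H1 H1_subset_L2)
    then show ?thesis
      by (auto simp: X_def)
  qed
  obtain U where U: "\<And>n. U n \<in> X"
    "\<And>e. 0 < e \<Longrightarrow> \<exists>N. \<forall>m\<ge>N. \<forall>n\<ge>N. Re (inner_L2 (lincomb 1 (U m) (-1) (U n)) (lincomb 1 (U m) (-1) (U n))) < e"
    "\<And>v. v \<in> X \<Longrightarrow> (\<lambda>n. inner_L2 (U n) v) \<longlonglongrightarrow> inner_L2 g v"
  proof (rule X.minimizing_sequence[OF zero, of "inner_L2 g" "mass g"])
    show "inner_L2 g (lincomb a u b v) = cnj a * inner_L2 g u + cnj b * inner_L2 g v" if "u \<in> X" "v \<in> X" for a b u v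
      by (rule L2.antilinear) (use that XL g in auto)
    show "0 \<le> mass g"
      by (rule L2_normsq_nonneg)
    show "(norm (inner_L2 g u))\<^sup>2 \<le> mass g * Re (inner_L2 u u)" if u: "u \<in> X" for u
      using L2.Cauchy_Schwarz[of g u] g u XL by (auto simp: L2_inner_self)
  qed (rule that)
  have UL: "U n \<in> L2_space G" for n
    using U(1) XL by blast
  have "\<exists>N. \<forall>m\<ge>N. \<forall>n\<ge>N. mass (lincomb 1 (U m) (-1) (U n)) < e" if "0 < e" for e
    using U(2)[OF that] by (simp add: L2_inner_self)
  from L2_complete[of U, OF UL this] obtain k where k: "k \<in> L2_space G"
    and conv: "(\<lambda>n. mass (lincomb 1 (U n) (-1) k)) \<longlonglongrightarrow> 0"
    by blast
  have kg: "inner_L2 k v = inner_L2 g v" if v: "v \<in> X" for v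
  proof -
    have "(\<lambda>n. inner_L2 (U n) v) \<longlonglongrightarrow> inner_L2 k v"
      by (rule L2.tendsto_form[of U k, OF UL k]) (use v XL conv in \<open>auto simp: L2_inner_self\<close>)
    then show ?thesis
      using U(3)[OF v] LIMSEQ_unique by blast
  qed
  define z where "z = lincomb 1 g (-1) k"
  have z: "z \<in> L2_space G"
    unfolding z_def by (rule L2_lincomb[OF g k])
  obtain w where w: "w \<in> H" "\<And>v. v \<in> H \<Longrightarrow> form w v = inner_L2 z v"
    using weak_solution_exists[OF z] by blast
  have wX: "w \<in> X"
    using form_opI[OF w(1) z w(2)] by (auto simp: X_def)
  have "form w w = inner_L2 z w"
    by (rule w(2)[OF w(1)])
  also have "\<dots> = 0"
    using L2.linear[OF g k H1_subset_L2[OF w(1)], of 1 "-1"] kg[OF wX] by (simp add: z_def)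
  finally have "energy w = 0"
    using form_self[OF w(1)] by simp
  then have "inner_L2 z v = 0" if "v \<in> H" for v
    using form_zero[OF w(1) that] w(2)[OF that] by simp
  then have "ae_eq G z (\<lambda>e x. 0)"
    by (rule H1_orthogonal_imp_zero[OF z])
  then have gk: "ae_eq G g k"
    unfolding z_def by (rule ae_eq_if_diff_zero)
  have "\<forall>\<^sub>F n in sequentially. mass (lincomb 1 (U n) (-1) k) < \<epsilon>\<^sup>2"
    by (rule order_tendstoD(2)[OF conv]) (use \<epsilon> in simp)
  then obtain n where n: "mass (lincomb 1 (U n) (-1) k) < \<epsilon>\<^sup>2"
    by (auto simp: eventually_sequentially)
  have "mass (lincomb 1 (U n) (-1) k) = mass (lincomb 1 (U n) (-1) g)"
    by (intro L2_normsq_cong L2_lincomb UL k g ae_eq_lincomb ae_eq_refl ae_eq_sym[OF gk])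
  also have "\<dots> = mass (\<lambda>e x. g e x - U n e x)"
    by (simp add: L2_normsq_eq lincomb_def norm_minus_commute)
  finally have "sqrt (mass (\<lambda>e x. g e x - U n e x)) < \<epsilon>"
    using n \<epsilon> real_sqrt_less_iff[of _ "\<epsilon>\<^sup>2"] by simp
  then show "\<exists>(u, f)\<in>form_op. sqrt (mass (\<lambda>e x. g e x - u e x)) < \<epsilon>"
    using U(1)[of n] by (auto simp: X_def)
qed

text \<open>
  A symmetric operator that is onto is self-adjoint: if \<open>(v, g)\<close> is in the adjoint and \<open>w\<close> solves the
  equation with right-hand side \<open>g\<close>, then \<open>v - w\<close> is orthogonal to the range, hence to everything.
\<close>

lemma form_op_self_adjoint: "self_adjoint G form_op"
  unfolding self_adjoint_def
proof (intro conjI form_op_densely_defined)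
  show "form_op \<subseteq> L2_space G \<times> L2_space G"
    by (auto simp: form_op_def)
  show "adjoint_op G form_op = form_op"
  proof (rule set_eqI, rule iffI)
    fix p assume p: "p \<in> form_op"
    obtain v g where vg: "p = (v, g)"
      by (cases p)
    show "p \<in> adjoint_op G form_op"
      unfolding vg adjoint_op_def using form_opD(1,2)[OF p[unfolded vg]] form_op_symmetric[OF _ p[unfolded vg]] by auto
  next
    fix p assume "p \<in> adjoint_op G form_op"
    moreover obtain v g where p: "p = (v, g)"
      by (cases p)
    ultimately have v: "v \<in> L2_space G" and g: "g \<in> L2_space G"
      and adj: "\<And>u f. (u, f) \<in> form_op \<Longrightarrow> inner_L2 f v = inner_L2 u g"
      by (auto simp: adjoint_op_def)
    obtain w where w: "w \<in> H" "\<And>v. v \<in> H \<Longrightarrow> form w v = inner_L2 g v"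
      using weak_solution_exists[OF g] by blast
    have wL: "w \<in> L2_space G"
      by (rule H1_subset_L2[OF w(1)])
    let ?z = "lincomb 1 v (-1) w"
    have z: "?z \<in> L2_space G"
      by (rule L2_lincomb[OF v wL])
    obtain u where u: "u \<in> H" "\<And>v. v \<in> H \<Longrightarrow> form u v = inner_L2 ?z v"
      using weak_solution_exists[OF z] by blast
    have "inner_L2 ?z v = inner_L2 u g"
      by (rule adj[OF form_opI[OF u(1) z u(2)]])
    also have "\<dots> = inner_L2 ?z w"
      by (rule form_op_symmetric[OF form_opI[OF u(1) z u(2)] form_opI[OF w(1) g w(2)], symmetric])
    finally have "inner_L2 ?z ?z = 0"
      using L2.antilinear[OF v wL z, of 1 "-1"] by simp
    then have "mass ?z = 0"
      by (simp add: L2_inner_self)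
    from ae_eq_if_diff_zero[OF ae_zero_if_L2_normsq_zero[OF z this]] have "ae_eq G v w" .
    then show "p \<in> form_op"
      unfolding p form_op_def using v g w by blast
  qed
qed

lemma form_op_is_magnetic_op: "is_magnetic_op G A V form_op"
  unfolding is_magnetic_op_def
proof (intro conjI form_op_self_adjoint)
  show "\<forall>(u, f)\<in>form_op. \<exists>u'\<in>H. ae_eq G u u'"
    by (auto simp: form_op_def)
  have "form u v = inner_L2 f v" if uf: "(u, f) \<in> form_op" and u: "u \<in> H" and v: "v \<in> H" for u f v
  proof -
    obtain u' where "u' \<in> H" "ae_eq G u u'" "\<forall>v\<in>H. form u' v = inner_L2 f v"
      using form_opD(3)[OF uf] by blast
    then show ?thesis
      using form_ae_cong[OF u _ _ v, of u'] v by simp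
  qed
  then show "\<forall>(u, f)\<in>form_op. u \<in> H \<longrightarrow> (\<forall>v\<in>H. form u v = inner_L2 f v)"
    by blast
qed

text \<open>
  Any such operator \<open>T\<close> is contained in \<open>form_op\<close>. As \<open>form_op\<close> is symmetric, it is contained in the
  adjoint of its restriction \<open>T\<close>, which is \<open>T\<close> itself.
\<close>

lemma magnetic_op_unique:
  assumes T: "is_magnetic_op G A V T"
  shows "T = form_op"
proof -
  have TL: "T \<subseteq> L2_space G \<times> L2_space G" and adj: "adjoint_op G T = T"
    and dom: "\<And>u f. (u, f) \<in> T \<Longrightarrow> \<exists>u'\<in>H. ae_eq G u u'"
    and form: "\<And>u f v. (u, f) \<in> T \<Longrightarrow> u \<in> H \<Longrightarrow> v \<in> H \<Longrightarrow> form u v = inner_L2 f v"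
    using T unfolding is_magnetic_op_def self_adjoint_def by auto
  have sub: "T \<subseteq> form_op"
  proof (rule subrelI)
    fix u f assume uf: "(u, f) \<in> T"
    then have L: "u \<in> L2_space G" "f \<in> L2_space G"
      using TL by auto
    obtain u' where u': "u' \<in> H" "ae_eq G u u'"
      using dom[OF uf] by blast
    have "inner_L2 k u' = inner_L2 w f" if wk: "(w, k) \<in> T" for w k
    proof -
      have "k \<in> L2_space G"
        using TL wk by auto
      then have "inner_L2 k u' = inner_L2 k u"
        by (rule L2_inner_cong(2)[OF L(1) H1_subset_L2[OF u'(1)] _ u'(2), symmetric])
      also have "\<dots> = inner_L2 w f"
      proof -
        have "(u, f) \<in> adjoint_op G T"
          using uf adj by simp
        then show ?thesis
          using wk by (auto simp: adjoint_op_def)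
      qed
      finally show ?thesis .
    qed
    then have "(u', f) \<in> adjoint_op G T"
      using H1_subset_L2[OF u'(1)] L(2) by (auto simp: adjoint_op_def)
    then have "(u', f) \<in> T"
      using adj by simp
    then have "form u' v = inner_L2 f v" if "v \<in> H" for v
      using form u'(1) that by blast
    then show "(u, f) \<in> form_op"
      unfolding form_op_def using L u' by blast
  qed
  have "form_op \<subseteq> adjoint_op G T"
  proof (rule subrelI)
    fix v g assume vg: "(v, g) \<in> form_op"
    then show "(v, g) \<in> adjoint_op G T"
      unfolding adjoint_op_def using form_op_symmetric[OF _ vg] sub form_opD(1,2)[OF vg] by auto
  qed
  then show ?thesis
    using sub adj by auto
qed

lemma magnetic_op_eq: "magnetic_op G A V = form_op"
  unfolding magnetic_op_def using form_op_is_magnetic_op magnetic_op_unique by (rule the_equality)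

end

section \<open>The bottom of the spectrum\<close>

context magnetic_graph
begin

text \<open>
  Let \<open>q\<close> be the nonnegative form of \<open>T - \<lambda>\<^sub>1\<close> and suppose that this operator had a bounded inverse.
  For \<open>v\<close> in the form domain let \<open>w\<close> be the solution of \<open>(T - \<lambda>\<^sub>1) w = v\<close>. Then
  \<open>|v|\<^sub>2\<^sup>2 = q(w,v) \<le> \<surd>q(w,w) \<surd>q(v,v)\<close> and \<open>q(w,w) = \<langle>v, w\<rangle> \<le> C |v|\<^sub>2\<^sup>2\<close>, so \<open>|v|\<^sub>2\<^sup>2 \<le> C q(v,v)\<close>. Hence
  \<open>Q(v) \<ge> (\<lambda>\<^sub>1 + 1/C) |v|\<^sub>2\<^sup>2\<close>, against the definition of \<open>\<lambda>\<^sub>1\<close>.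
\<close>

lemma lambda1_in_spectrum:
  assumes v0: "v0 \<in> H" "0 < mass v0"
  shows "complex_of_real (lam1) \<in> op_spectrum G form_op"
proof (rule ccontr)
  let ?l1 = "lam1"
  assume "complex_of_real ?l1 \<notin> op_spectrum G form_op"
  then have res: "complex_of_real ?l1 \<in> resolvent_set G form_op"
    by (simp add: op_spectrum_def)
  obtain C where C: "\<And>u f. (u, f) \<in> form_op \<Longrightarrow>
      sqrt (mass u) \<le> C * sqrt (mass (\<lambda>e x. f e x - complex_of_real ?l1 * u e x))"
    using res unfolding resolvent_set_def by blast
  have onto: "\<exists>u f. (u, f) \<in> form_op \<and> ae_eq G (\<lambda>e x. f e x - complex_of_real ?l1 * u e x) g" if "g \<in> L2_space G" for g
    using res that unfolding resolvent_set_def by blast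
  define q where "q u v = form u v - complex_of_real ?l1 * inner_L2 u v" for u v
  interpret Q: hermitian_form H q
  proof
    fix a b u v w assume u: "u \<in> H" and v: "v \<in> H" and w: "w \<in> H"
    show "q (lincomb a u b v) w = a * q u w + b * q v w"
      unfolding q_def H1.linear[OF u v w] L2.linear[OF H1_subset_L2[OF u] H1_subset_L2[OF v] H1_subset_L2[OF w]]
      by (simp add: algebra_simps)
  next
    fix u v assume u: "u \<in> H" and v: "v \<in> H"
    show "q v u = cnj (q u v)"
      unfolding q_def H1.hermitian[OF u v] L2.hermitian[OF H1_subset_L2[OF u] H1_subset_L2[OF v]] by simp
  next
    fix u assume u: "u \<in> H"
    show "0 \<le> Re (q u u)"
      using lambda1_le[OF u] by (simp add: q_def form_self[OF u] L2_inner_self)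
  qed (rule H1_lincomb)
  have bound: "mass v \<le> \<bar>C\<bar> * Re (q v v)" if v: "v \<in> H" for v
  proof (cases "mass v = 0")
    case True
    then show ?thesis
      using Q.nonneg[OF v] by simp
  next
    case False
    then have pos: "0 < mass v"
      using L2_normsq_nonneg[of v] by simp
    have vL: "v \<in> L2_space G"
      by (rule H1_subset_L2[OF v])
    obtain w f where wf: "(w, f) \<in> form_op" "ae_eq G (\<lambda>e x. f e x - complex_of_real ?l1 * w e x) v"
      using onto[OF vL] by blast
    let ?r = "lincomb 1 f (- complex_of_real ?l1) w"
    have r_eq: "(\<lambda>e x. f e x - complex_of_real ?l1 * w e x) = ?r"
      by (simp add: lincomb_def)
    have L: "w \<in> L2_space G" "f \<in> L2_space G"
      using form_opD(1,2)[OF wf(1)] by blast+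
    have rL: "?r \<in> L2_space G"
      by (rule L2_lincomb[OF L(2,1)])
    have rv: "ae_eq G ?r v"
      using wf(2) unfolding r_eq .
    obtain w' where w': "w' \<in> H" "ae_eq G w w'" "\<And>v. v \<in> H \<Longrightarrow> form w' v = inner_L2 f v"
      using form_opD(3)[OF wf(1)] by blast
    have q_eq: "q w' k = inner_L2 v k" if k: "k \<in> H" for k
    proof -
      have kL: "k \<in> L2_space G"
        by (rule H1_subset_L2[OF k])
      have "q w' k = inner_L2 f k - complex_of_real ?l1 * inner_L2 w k"
        unfolding q_def w'(3)[OF k] L2_inner_cong(1)[OF L(1) H1_subset_L2[OF w'(1)] kL w'(2)] ..
      also have "\<dots> = inner_L2 ?r k"
        using L2.linear[OF L(2,1) kL, of 1 "- complex_of_real ?l1"] by simp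
      also have "\<dots> = inner_L2 v k"
        by (rule L2_inner_cong(1)[OF rL vL kL rv])
      finally show ?thesis .
    qed
    have "sqrt (mass w') \<le> C * sqrt (mass v)"
      using C[OF wf(1)] unfolding r_eq L2_normsq_cong[OF rL vL rv] L2_normsq_cong[OF L(1) H1_subset_L2[OF w'(1)] w'(2)] .
    also have "\<dots> \<le> \<bar>C\<bar> * sqrt (mass v)"
      by (intro mult_right_mono real_sqrt_ge_zero L2_normsq_nonneg) simp
    finally have w'_le: "sqrt (mass w') \<le> \<bar>C\<bar> * sqrt (mass v)" .
    have "Re (q w' w') \<le> norm (inner_L2 v w')"
      unfolding q_eq[OF w'(1)] by (rule complex_Re_le_cmod)
    also have "\<dots> \<le> sqrt (mass v * mass w')"
      using L2.Cauchy_Schwarz[OF vL H1_subset_L2[OF w'(1)]] by (intro real_le_rsqrt) (simp add: L2_inner_self)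
    also have "\<dots> \<le> sqrt (mass v) * (\<bar>C\<bar> * sqrt (mass v))"
      unfolding real_sqrt_mult by (intro mult_left_mono w'_le real_sqrt_ge_zero L2_normsq_nonneg)
    also have "\<dots> = \<bar>C\<bar> * mass v"
      using L2_normsq_nonneg[of v] by simp
    finally have q1: "Re (q w' w') \<le> \<bar>C\<bar> * mass v" .
    have "(mass v)\<^sup>2 = (norm (q w' v))\<^sup>2"
      unfolding q_eq[OF v] L2_inner_self by simp
    also have "\<dots> \<le> Re (q w' w') * Re (q v v)"
      by (rule Q.Cauchy_Schwarz[OF w'(1) v])
    also have "\<dots> \<le> \<bar>C\<bar> * mass v * Re (q v v)"
      by (rule mult_right_mono[OF q1 Q.nonneg[OF v]])
    finally have "mass v * mass v \<le> mass v * (\<bar>C\<bar> * Re (q v v))"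
      by (simp add: power2_eq_square ac_simps)
    then show ?thesis
      using pos by simp
  qed
  \<comment> \<open>The constant \<open>C\<close> of the resolvent estimate may be zero or negative.\<close>
  define c where "c = \<bar>C\<bar> + 1"
  have c: "0 < c"
    by (simp add: c_def)
  have "?l1 + 1 / c \<le> ?l1"
    unfolding lambda1_def[of G A V]
  proof (rule cInf_greatest)
    show "{energy u / mass u |u. u \<in> H \<and> nonzero_on G (edges G) u} \<noteq> {}"
      using v0 nonzero_on_iff[OF v0(1)] by blast
    fix t assume "t \<in> {energy u / mass u |u. u \<in> H \<and> nonzero_on G (edges G) u}"
    then obtain u where t: "t = energy u / mass u" and u: "u \<in> H" and pos: "0 < mass u"
      using nonzero_on_iff by blast
    have "mass u \<le> \<bar>C\<bar> * Re (q u u)"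
      by (rule bound[OF u])
    also have "\<dots> \<le> c * Re (q u u)"
      using Q.nonneg[OF u] by (intro mult_right_mono) (auto simp: c_def)
    also have "Re (q u u) = energy u - ?l1 * mass u"
      by (simp add: q_def form_self[OF u] L2_inner_self)
    finally have "mass u / c \<le> energy u - ?l1 * mass u"
      using c by (simp add: field_simps)
    then have "(?l1 + 1 / c) * mass u \<le> energy u"
      by (simp add: algebra_simps)
    then have "?l1 + 1 / c \<le> t"
      unfolding t using pos by (simp add: pos_le_divide_eq)
    then show "Inf {energy u / mass u |u. u \<in> H \<and> nonzero_on G (edges G) u} + 1 / c \<le> t"
      unfolding lambda1_def .
  qed
  then show False
    using c by simp
qed

lemma form_op_eigenvector:
  assumes "op_eigenvalue G form_op (complex_of_real l)"
  shows "\<exists>\<phi>\<in>H. 0 < mass \<phi> \<and> (\<forall>v\<in>H. form \<phi> v = complex_of_real l * inner_L2 \<phi> v)"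
proof -
  obtain u where u: "(u, \<lambda>e x. complex_of_real l * u e x) \<in> form_op" "\<not> ae_eq G u (\<lambda>e x. 0)"
    using assms by (auto simp: op_eigenvalue_def op_eigenspace_def)
  have uL: "u \<in> L2_space G"
    by (rule form_opD(1)[OF u(1)])
  obtain \<phi> where \<phi>: "\<phi> \<in> H" "ae_eq G u \<phi>"
    "\<And>v. v \<in> H \<Longrightarrow> form \<phi> v = inner_L2 (\<lambda>e x. complex_of_real l * u e x) v"
    using form_opD(3)[OF u(1)] by blast
  have "mass \<phi> \<noteq> 0"
  proof
    assume "mass \<phi> = 0"
    then have "ae_eq G \<phi> (\<lambda>e x. 0)"
      by (intro ae_zero_if_L2_normsq_zero H1_subset_L2 \<phi>(1))
    then show False
      using ae_eq_trans[OF \<phi>(2)] u(2) by blast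
  qed
  then have "0 < mass \<phi>"
    using L2_normsq_nonneg[of \<phi>] by simp
  moreover have "form \<phi> v = complex_of_real l * inner_L2 \<phi> v" if v: "v \<in> H" for v
  proof -
    have "inner_L2 (\<lambda>e x. complex_of_real l * u e x) v = complex_of_real l * inner_L2 u v"
      using L2.linear[OF uL uL H1_subset_L2[OF v], of "complex_of_real l" 0] by (simp add: lincomb_def)
    then show ?thesis
      using \<phi>(3)[OF v] L2_inner_cong(1)[OF uL H1_subset_L2[OF \<phi>(1)] H1_subset_L2[OF v] \<phi>(2)] by simp
  qed
  ultimately show ?thesis
    using \<phi>(1) by blast
qed

text \<open>
  \<open>\<lambda>\<^sub>1\<close> does not exceed the first given eigenvalue, so it lies below the essential spectrum. A point
  of the spectrum outside the essential spectrum is an eigenvalue.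
\<close>

lemma ground_state_exists:
  assumes "cond_Gm G A V"
  shows "\<exists>\<phi>\<in>H. 0 < mass \<phi> \<and> (\<forall>v\<in>H. form \<phi> v = complex_of_real (lam1) * inner_L2 \<phi> v)"
proof -
  let ?l1 = "lam1"
  obtain m :: enat and \<Lambda> :: "nat \<Rightarrow> real" where m: "1 \<le> m" and
    \<Lambda>: "\<And>j. 1 \<le> j \<Longrightarrow> enat j \<le> m \<Longrightarrow> op_eigenvalue G form_op (complex_of_real (\<Lambda> j)) \<and>
        ereal (\<Lambda> j) < inf_ess_spectrum G form_op"
    using assms unfolding cond_Gm_def magnetic_op_eq by blast
  have "enat 1 \<le> m"
    using m by (simp add: one_enat_def)
  then have ev: "op_eigenvalue G form_op (complex_of_real (\<Lambda> 1))" and below: "ereal (\<Lambda> 1) < inf_ess_spectrum G form_op"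
    using \<Lambda>[of 1] by auto
  obtain \<psi> where \<psi>: "\<psi> \<in> H" "0 < mass \<psi>"
    "\<And>v. v \<in> H \<Longrightarrow> form \<psi> v = complex_of_real (\<Lambda> 1) * inner_L2 \<psi> v"
    using form_op_eigenvector[OF ev] by blast
  have "energy \<psi> = \<Lambda> 1 * mass \<psi>"
    using \<psi>(3)[OF \<psi>(1)] unfolding form_self[OF \<psi>(1)] L2_inner_self of_real_mult[symmetric] of_real_eq_iff .
  then have "?l1 \<le> \<Lambda> 1"
    using lambda1_le[OF \<psi>(1)] \<psi>(2) by simp
  then have "ereal ?l1 < inf_ess_spectrum G form_op"
    using below by (meson ereal_less_eq(3) order_le_less_trans)
  then have "complex_of_real ?l1 \<notin> ess_spectrum G form_op"
    unfolding inf_ess_spectrum_def by (metis (mono_tags, lifting) Inf_lower image_eqI mem_Collect_eq not_le)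
  then have "op_eigenvalue G form_op (complex_of_real ?l1)"
    using lambda1_in_spectrum[OF \<psi>(1,2)] by (auto simp: ess_spectrum_def)
  then show ?thesis
    by (rule form_op_eigenvector)
qed

text \<open>
  A ground state exists and must vanish on the core, where alone the equation is nonlinear; so it
  solves the nonlinear equation as well.
\<close>

lemma linear_critical_point:
  assumes cGm: "cond_Gm G A V" and ncG: "\<not> cond_G G A V" and \<mu>: "0 < \<mu>"
  shows "\<exists>u. constrained_critical_point G A V p \<mu> u (lam1)" "1 \<le> lam1"
proof -
  let ?l1 = "lam1"
  obtain \<phi> where \<phi>: "\<phi> \<in> H" "0 < mass \<phi>"
    "\<And>v. v \<in> H \<Longrightarrow> form \<phi> v = complex_of_real ?l1 * inner_L2 \<phi> v"
    using ground_state_exists[OF cGm] by blast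
  have energy: "energy \<phi> = ?l1 * mass \<phi>"
    using \<phi>(3)[OF \<phi>(1)] unfolding form_self[OF \<phi>(1)] L2_inner_self of_real_mult[symmetric] of_real_eq_iff .
  then show "1 \<le> ?l1"
    using L2_le_energy[OF \<phi>(1)] \<phi>(2) by simp
  have vanish: "\<not> nonzero_on G (bedges G) \<phi>"
    using ncG \<phi>(1,2) nonzero_on_iff[OF \<phi>(1)] energy unfolding cond_G_def by force
  define c where "c = sqrt (\<mu> / mass \<phi>)"
  have c: "c\<^sup>2 = \<mu> / mass \<phi>"
    using \<phi>(2) \<mu> by (simp add: c_def)
  let ?u = "scale c \<phi>"
  have "?u \<in> mass_sphere G A V \<mu>"
    using scale_norms[OF \<phi>(1)] c \<phi>(2) by (simp add: mass_sphere_def)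
  moreover have "Re (form ?u v)
      - Re (graph_integral G (bedges G) (\<lambda>e x. complex_of_real (norm (?u e x) powr (p - 2)) * ?u e x * cnj (v e x)))
      = ?l1 * Re (inner_L2 ?u v)" if v: "v \<in> H" for v
  proof -
    have "?u e x = 0" if "e \<in> bedges G" "x \<in> I e" for e x
      using vanish that by (auto simp: nonzero_on_def scale_def lincomb_def)
    then have "graph_integral G (bedges G) (\<lambda>e x. complex_of_real (norm (?u e x) powr (p - 2)) * ?u e x * cnj (v e x)) = 0"
      unfolding graph_integral_eq by (intro sum.neutral ballI integral_eq_zero_AE AE_I2) simp
    moreover have "form ?u v = complex_of_real ?l1 * inner_L2 ?u v"
      unfolding scale_def H1.linear[OF \<phi>(1) \<phi>(1) v]
        L2.linear[OF H1_subset_L2[OF \<phi>(1)] H1_subset_L2[OF \<phi>(1)] H1_subset_L2[OF v]] \<phi>(3)[OF v]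
      by simp
    ultimately show ?thesis
      by simp
  qed
  ultimately show "\<exists>u. constrained_critical_point G A V p \<mu> u ?l1"
    unfolding constrained_critical_point_def by blast
qed

section \<open>Removing the saturation\<close>

lemma saturated_power:
  assumes p: "2 < p" and k: "0 < k"
  shows "saturated_problem G A V (\<lambda>s. min s (k\<^sup>2) powr ((p - 2) / 2)) (k powr (p - 2))"
proof
  let ?q = "(p - 2) / 2"
  show "continuous_on {0..} (\<lambda>s. min s (k\<^sup>2) powr ?q)"
    using p by (intro continuous_on_powr' continuous_intros) auto
  show "min s (k\<^sup>2) powr ?q \<le> min t (k\<^sup>2) powr ?q" if "0 \<le> s" "s \<le> t" for s t
    using that p by (intro powr_mono2) auto
  show "0 < min s (k\<^sup>2) powr ?q" if "0 < s" for s
    using that k by (simp add: min_def)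
  show "min s (k\<^sup>2) powr ?q \<le> k powr (p - 2)" if "0 \<le> s" for s
  proof -
    have "min s (k\<^sup>2) powr ?q \<le> (k\<^sup>2) powr ?q"
      using that p by (intro powr_mono2) auto
    also have "\<dots> = k powr (p - 2)"
      using k by (simp add: powr_powr diff_divide_distrib flip: powr_numeral)
    finally show ?thesis .
  qed
qed auto

text \<open>
  The solution of the saturated problem satisfies \<open>|u|^4 \<le> C \<mu> Q(u) \<le> C \<mu>\<^sup>2 (\<lambda>\<^sub>1 + k^(p-2)) \<le> k^4\<close> on
  the core, so the saturation is never reached.
\<close>

lemma saturated_critical_point:
  assumes cG: "cond_G G A V" and p: "2 < p" and k: "0 < k" and \<mu>: "0 < \<mu>"
    and C: "\<And>u e x. u \<in> H \<Longrightarrow> e \<in> bedges G \<Longrightarrow> x \<in> I e \<Longrightarrow> norm (u e x) ^ 4 \<le> C * (mass u * energy u)" "0 \<le> C"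
    and small: "C * \<mu>\<^sup>2 * (lam1 + k powr (p - 2)) \<le> k ^ 4"
  shows "\<exists>u lam. constrained_critical_point G A V p \<mu> u lam \<and> lam < lam1 \<and> lam1 - k powr (p - 2) \<le> lam"
proof -
  let ?h = "\<lambda>s. min s (k\<^sup>2) powr ((p - 2) / 2)"
  interpret S: saturated_problem G A V ?h "k powr (p - 2)"
    by (rule saturated_power[OF p k])
  obtain u lam where uS: "u \<in> mass_sphere G A V \<mu>" and lam: "lam < lam1" "lam1 - k powr (p - 2) \<le> lam"
    and E: "energy u \<le> (lam1 + k powr (p - 2)) * \<mu>"
    and crit: "\<And>v. v \<in> H \<Longrightarrow> Re (form u v) - Re (S.potential u u v) = lam * Re (inner_L2 u v)"
    using S.critical_point_exists[OF cG \<mu>] by blast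
  have u: "u \<in> H" and um: "mass u = \<mu>"
    using uS by (auto simp: mass_sphere_def)
  have h_eq: "?h ((norm (u e x))\<^sup>2) = norm (u e x) powr (p - 2)" if ex: "e \<in> bedges G" "x \<in> I e" for e x
  proof -
    have "norm (u e x) ^ 4 \<le> C * (\<mu> * energy u)"
      using C(1)[OF u ex] um by simp
    also have "\<dots> \<le> C * (\<mu> * ((lam1 + k powr (p - 2)) * \<mu>))"
      using E C(2) \<mu> by (intro mult_left_mono) auto
    also have "\<dots> = C * \<mu>\<^sup>2 * (lam1 + k powr (p - 2))"
      by (simp add: power2_eq_square)
    also have "\<dots> \<le> k ^ 4"
      by (rule small)
    finally have "norm (u e x) \<le> k"
      using k power_mono_iff[of "norm (u e x)" k 4] by simp
    then have "(norm (u e x))\<^sup>2 \<le> k\<^sup>2"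
      by (intro power_mono) auto
    moreover have "((norm (u e x))\<^sup>2) powr ((p - 2) / 2) = norm (u e x) powr (p - 2)"
    proof (cases "u e x = 0")
      case False
      then show ?thesis
        by (simp add: powr_powr diff_divide_distrib flip: powr_numeral)
    qed simp
    ultimately show ?thesis
      by (simp add: min_def)
  qed
  have "graph_integral G (bedges G) (\<lambda>e x. complex_of_real (norm (u e x) powr (p - 2)) * u e x * cnj (v e x)) = S.potential u u v" for v
    unfolding S.potential_def graph_integral_eq
    by (intro sum.cong Bochner_Integration.integral_cong refl) (simp add: h_eq)
  then have "constrained_critical_point G A V p \<mu> u lam"
    unfolding constrained_critical_point_def using uS crit by simp
  then show ?thesis
    using lam by blast
qed

text \<open>
  Saturation at \<open>k = 1\<close>, which leaves \<open>\<lambda> \<ge> \<lambda>\<^sub>1 - 1 \<ge> 0\<close>.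
\<close>

lemma small_mass_critical_point:
  assumes cG: "cond_G G A V" and p: "2 < p"
  shows "\<exists>\<mu>0>0. \<forall>\<mu>. 0 < \<mu> \<and> \<mu> \<le> \<mu>0 \<longrightarrow>
    (\<exists>u lam. constrained_critical_point G A V p \<mu> u lam \<and> 0 \<le> lam \<and> lam < lam1)"
proof -
  let ?l1 = "lam1"
  obtain C where C: "0 \<le> C"
    "\<And>u e x. u \<in> H \<Longrightarrow> e \<in> bedges G \<Longrightarrow> x \<in> I e \<Longrightarrow> norm (u e x) ^ 4 \<le> C * (mass u * energy u)"
    using core_sup_bound by blast
  have l1: "1 \<le> ?l1"
  by (rule lambda1_ge_1[OF cG])
  \<comment> \<open>As \<open>d \<ge> 1\<close>, a mass of at most \<open>1/d\<close> also has its square below \<open>1/d\<close>.\<close>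
  define d where "d = C * (?l1 + 1) + 1"
  have d: "1 \<le> d"
    using C(1) l1 by (simp add: d_def)
  have "\<exists>u lam. constrained_critical_point G A V p \<mu> u lam \<and> 0 \<le> lam \<and> lam < ?l1"
    if \<mu>: "0 < \<mu>" "\<mu> \<le> 1 / d" for \<mu>
  proof -
    have "\<mu> \<le> 1"
      using \<mu>(2) d by (simp add: order_trans)
    then have "\<mu>\<^sup>2 \<le> 1 / d"
      using \<mu> by (simp add: power2_eq_square mult_left_le order_trans[of _ \<mu>])
    then have "C * (?l1 + 1) * \<mu>\<^sup>2 \<le> C * (?l1 + 1) * (1 / d)"
      using C(1) l1 by (intro mult_left_mono) auto
    also have "\<dots> \<le> 1"
      using d by (simp add: d_def)
    finally have "C * \<mu>\<^sup>2 * (?l1 + 1 powr (p - 2)) \<le> 1 ^ 4"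
      by (simp add: ac_simps)
    from saturated_critical_point[OF cG p zero_less_one \<mu>(1) C(2,1) this] show ?thesis
      using l1 by force
  qed
  then show ?thesis
    using d by (intro exI[of _ "1 / d"]) auto
qed

text \<open>
  Saturation at a large level: as \<open>p - 2 < 4\<close>, the smallness condition holds for large \<open>k\<close>, whatever
  the mass.
\<close>

lemma subcritical_critical_point:
  assumes cG: "cond_G G A V" and p: "2 < p" "p < 6" and \<mu>: "0 < \<mu>"
  shows "\<exists>u lam. constrained_critical_point G A V p \<mu> u lam \<and> lam < lam1"
proof -
  let ?l1 = "lam1"
  obtain C where C: "0 \<le> C"
    "\<And>u e x. u \<in> H \<Longrightarrow> e \<in> bedges G \<Longrightarrow> x \<in> I e \<Longrightarrow> norm (u e x) ^ 4 \<le> C * (mass u * energy u)"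
    using core_sup_bound by blast
  have l1: "1 \<le> ?l1"
  by (rule lambda1_ge_1[OF cG])
  define b where "b = C * \<mu>\<^sup>2 * (?l1 + 1)"
  have b: "0 \<le> b"
    using C(1) l1 by (simp add: b_def)
  \<comment> \<open>With \<open>k \<ge> 1\<close> the left side of the condition is at most \<open>b k^(p-2)\<close>, so \<open>b \<le> k^(6-p)\<close> is enough.\<close>
  define k where "k = max 1 (b powr (1 / (6 - p)))"
  have k: "1 \<le> k"
    by (simp add: k_def)
  have "b = (b powr (1 / (6 - p))) powr (6 - p)"
    using p b by (simp add: powr_powr)
  also have "\<dots> \<le> k powr (6 - p)"
    using p by (intro powr_mono2) (auto simp: k_def)
  finally have bk: "b \<le> k powr (6 - p)" .
  have k1: "1 \<le> k powr (p - 2)"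
    using k p by (simp add: ge_one_powr_ge_zero)
  have "C * \<mu>\<^sup>2 * (?l1 + k powr (p - 2)) \<le> C * \<mu>\<^sup>2 * ((?l1 + 1) * k powr (p - 2))"
  proof (rule mult_left_mono)
    have "?l1 * 1 \<le> ?l1 * k powr (p - 2)"
      using k1 l1 by (intro mult_left_mono) auto
    then show "?l1 + k powr (p - 2) \<le> (?l1 + 1) * k powr (p - 2)"
      by (simp add: distrib_right)
  qed (use C(1) in simp)
  also have "\<dots> = b * k powr (p - 2)"
    by (simp add: b_def)
  also have "\<dots> \<le> k powr (6 - p) * k powr (p - 2)"
    using bk by (intro mult_right_mono) auto
  also have "\<dots> = k powr 4"
    by (simp flip: powr_add)
  also have "\<dots> = k ^ 4"
    using k by simp
  finally have "C * \<mu>\<^sup>2 * (?l1 + k powr (p - 2)) \<le> k ^ 4" .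
  from saturated_critical_point[OF cG p(1) _ \<mu> C(2,1) this] show ?thesis
    using k by force
qed

end

section \<open>Normalized critical points\<close>

theorem theorem1p4:
  fixes G :: "('v, 'e) metric_graph"
    and A V :: "'e \<Rightarrow> real \<Rightarrow> real"
    and p :: real
  assumes "finite_metric_graph G" and "connected_graph G"
    and "compact_graph G \<or> (\<not> compact_graph G \<and> bedges G \<noteq> {})"
    and "2 < p"
    and "\<And>e x. e \<in> edges G \<Longrightarrow> x \<in> edge_interval G e \<Longrightarrow> 1 \<le> V e x"
    and "L2_loc G A" and "L1_loc G V"
    and "cond_G G A V \<or> cond_Gm G A V"
  shows "(\<exists>\<mu>0>0. \<forall>\<mu>. 0 < \<mu> \<and> \<mu> \<le> \<mu>0 \<longrightarrow>
            (\<exists>u lam. constrained_critical_point G A V p \<mu> u lam \<and>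
               0 \<le> lam \<and> lam \<le> lambda1 G A V \<and> (cond_G G A V \<longrightarrow> lam < lambda1 G A V)))
       \<and> (p < 6 \<longrightarrow> (\<forall>\<mu>>0.
            (\<exists>u lam. constrained_critical_point G A V p \<mu> u lam \<and>
               lam \<le> lambda1 G A V \<and> (cond_G G A V \<longrightarrow> lam < lambda1 G A V))))"
proof -
  interpret magnetic_graph G A V
    using assms(1,5-7) by unfold_locales
  show ?thesis
  proof (cases "cond_G G A V")
    case True
    obtain \<mu>0 where \<mu>0: "0 < \<mu>0" "\<And>\<mu>. 0 < \<mu> \<Longrightarrow> \<mu> \<le> \<mu>0 \<Longrightarrow>
        \<exists>u lam. constrained_critical_point G A V p \<mu> u lam \<and> 0 \<le> lam \<and> lam < lambda1 G A V"
      using small_mass_critical_point[OF True assms(4)] by blast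
    have "\<exists>\<mu>0>0. \<forall>\<mu>. 0 < \<mu> \<and> \<mu> \<le> \<mu>0 \<longrightarrow>
            (\<exists>u lam. constrained_critical_point G A V p \<mu> u lam \<and>
               0 \<le> lam \<and> lam \<le> lambda1 G A V \<and> (cond_G G A V \<longrightarrow> lam < lambda1 G A V))"
      using \<mu>0 by (meson less_imp_le)
    moreover have "\<exists>u lam. constrained_critical_point G A V p \<mu> u lam \<and>
        lam \<le> lambda1 G A V \<and> (cond_G G A V \<longrightarrow> lam < lambda1 G A V)" if "p < 6" "0 < \<mu>" for \<mu>
      using subcritical_critical_point[OF True assms(4) that] by (meson less_imp_le)
    ultimately show ?thesis
      by blast
  next
    case False
    with assms(8) have "cond_Gm G A V"
      by simp
    note lin = linear_critical_point[OF this False]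
    have crit: "\<exists>u lam. constrained_critical_point G A V p \<mu> u lam \<and> 0 \<le> lam \<and> lam \<le> lambda1 G A V
        \<and> (cond_G G A V \<longrightarrow> lam < lambda1 G A V)" if \<mu>: "0 < \<mu>" for \<mu>
    proof -
      obtain u where "constrained_critical_point G A V p \<mu> u (lambda1 G A V)"
        using lin(1)[OF \<mu>] by blast
      moreover have "0 \<le> lambda1 G A V"
        using lin(2)[OF \<mu>] by simp
      ultimately show ?thesis
        using False by blast
    qed
    then show ?thesis
      by (intro conjI exI[of _ 1]) (simp, blast+)
  qed
qed

end
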